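(* Let $\epsilon>0$, and let $(X_t,\sigma_t)_{t\in\mathbb{Z}}$ be the stationary LARCH process with true parameter $\theta_0=(d_0,c_0,a_0)^T$ described in the context, with the separability property stated there. Assume that $E|\varepsilon_t|^3<\infty$ and that at least one of the following two conditions holds: (i) $|\mu|_3^{1/3}\|b(\theta_0)\|_3+3\zeta\|b(\theta_0)\|_2<1$, where $\zeta$ is the positive solution of $3\zeta^2-3\zeta-1=0$; (ii) $(2^3-3-1)^{1/2}|\mu|_3^{1/3}\|b(\theta_0)\|_2<1$. Then the estimator $\theta_n^{(1)}:=\arg\min_{\theta\in\Theta}L_n(\theta)$, where $$L_n(\theta)=\frac1n\sum_{t=1}^n\left(\frac{X_t^2+\epsilon}{\sigma_t^2(\theta)+\epsilon}+\ln(\sigma_t^2(\theta)+\epsilon)\right),$$ is strongly consistent for $\theta_0$, that is, $\theta_n^{(1)}\to\theta_0$ almost surely as $n\to\infty$.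
   Context: Innovations: $(\varepsilon_t)_{t\in\mathbb{Z}}$ are i.i.d. real random variables on a probability space $(\Omega,\mathcal{A},P)$ with continuous distribution, $E(\varepsilon_t)=0$ and $E(\varepsilon_t^2)=1$. (The constant $\epsilon$ is unrelated to the innovations $\varepsilon_t$.) Notation: $|\mu|_p=E(|\varepsilon_t|^p)$. Parameter space: fix constants $0<d_u<\tfrac12$, $0<C<1$ and $0<a_d<a_u<\infty$. Let $b_j(c,d)=c\,j^{d-1}$ for $j\ge1$, and let $\Theta$ be the set of all $\theta=(d,c,a)^T$ with $d\in[0,d_u]$, $c\in[0,c_u(d)]$, $c_u(d)=C\big(\sum_{j=1}^\infty j^{2d-2}\big)^{-1/2}$, and $a\in[a_d,a_u]$. Write $b(\theta)=(b_j(c,d))_{j\ge1}$ and $\|b(\theta)\|_p=\big(\sum_{j\ge1}|b_j(c,d)|^p\big)^{1/p}$. Process: $\theta_0=(d_0,c_0,a_0)^T$ lies in the interior of $\Theta$, and $(X_t,\sigma_t)_{t\in\mathbb{Z}}$ is the strictly and second order stationary solution of $X_t=\varepsilon_t\sigma_t$, $\sigma_t=a_0+\sum_{j=1}^\infty b_j(c_0,d_0)X_{t-j}$, given with $b_j=b_j(c_0,d_0)$ by $\sigma_t=a_0+a_0\sum_{k=1}^\infty\sum_{j_1,\dots,j_k=1}^\infty b_{j_1}\cdots b_{j_k}\varepsilon_{t-j_1}\cdots\varepsilon_{t-j_1-\cdots-j_k}$ (convergence in $L^2(\Omega)$). For $\theta=(d,c,a)^T\in\Theta$ put $\sigma_t(\theta)=a+\sum_{j=1}^\infty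 b_j(c,d)X_{t-j}$ (series in $L^2(\Omega)$), so $\sigma_t(\theta_0)=\sigma_t$. Separability: for every $t\in\mathbb{Z}$, $(\sigma_t(\theta))_{\theta\in\Theta}$ is a separable stochastic process, that is, there is a set $N_0$ with $P(N_0)=0$ such that for every open $A\subset\Theta$ and every closed interval $B$ the sets $\{\omega:\sigma_t(\theta)\in B\ \forall\theta\in A\}$ and $\{\omega:\sigma_t(\theta)\in B\ \forall\theta\in A\cap\mathbb{Q}^3\}$ differ only on a subset of $N_0$. *)

theory Defs
  imports "HOL-Probability.Probability"
begin

definition square_integrable :: "'w measure \<Rightarrow> ('w \<Rightarrow> real) \<Rightarrow> bool" where
  "square_integrable M f \<longleftrightarrow> f \<in> borel_measurable M \<and> integrable M (\<lambda>\<omega>. (f \<omega>)\<^sup>2)"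

definition L2_tendsto ::
  "'w measure \<Rightarrow> ('i \<Rightarrow> 'w \<Rightarrow> real) \<Rightarrow> ('w \<Rightarrow> real) \<Rightarrow> 'i filter \<Rightarrow> bool" where
  "L2_tendsto M f g F \<longleftrightarrow>
     square_integrable M g \<and> (\<forall>\<^sub>F i in F. square_integrable M (f i)) \<and>
     ((\<lambda>i. \<integral>\<omega>. (f i \<omega> - g \<omega>)\<^sup>2 \<partial>M) \<longlongrightarrow> 0) F"

text \<open>Ordered series over the index set $0, 1, 2, \ldots$, and unordered sums over a set.\<close>

definition L2_sums :: "'w measure \<Rightarrow> (nat \<Rightarrow> 'w \<Rightarrow> real) \<Rightarrow> ('w \<Rightarrow> real) \<Rightarrow> bool" where
  "L2_sums M f s \<longleftrightarrow> L2_tendsto M (\<lambda>n \<omega>. \<Sum>i<n. f i \<omega>) s sequentially"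

definition L2_has_sum ::
  "'w measure \<Rightarrow> ('i \<Rightarrow> 'w \<Rightarrow> real) \<Rightarrow> 'i set \<Rightarrow> ('w \<Rightarrow> real) \<Rightarrow> bool" where
  "L2_has_sum M f A s \<longleftrightarrow> L2_tendsto M (\<lambda>F \<omega>. \<Sum>i\<in>F. f i \<omega>) s (finite_subsets_at_top A)"

definition strictly_stationary :: "'w measure \<Rightarrow> (int \<Rightarrow> 'w \<Rightarrow> 'b::topological_space) \<Rightarrow> bool" where
  "strictly_stationary M Y \<longleftrightarrow>
     (\<forall>t. Y t \<in> borel_measurable M) \<and>
     (\<forall>h. distr M (PiM UNIV (\<lambda>_. borel)) (\<lambda>\<omega> t. Y (t + h) \<omega>) =
          distr M (PiM UNIV (\<lambda>_. borel)) (\<lambda>\<omega> t. Y t \<omega>))"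

text \<open>A set \<open>S\<close> of real processes is jointly second order stationary: the components have finite
  second moments and constant means, and all auto- and cross-covariances depend on the lag only.\<close>

definition second_order_stationary :: "'w measure \<Rightarrow> (int \<Rightarrow> 'w \<Rightarrow> real) set \<Rightarrow> bool" where
  "second_order_stationary M S \<longleftrightarrow>
     (\<forall>Y\<in>S. \<forall>t. square_integrable M (Y t)) \<and>
     (\<forall>Y\<in>S. \<forall>s t. (\<integral>\<omega>. Y s \<omega> \<partial>M) = (\<integral>\<omega>. Y t \<omega> \<partial>M)) \<and>
     (\<forall>Y\<in>S. \<forall>Z\<in>S. \<forall>s t h.
        (\<integral>\<omega>. (Y (s + h) \<omega> - (\<integral>\<omega>'. Y (s + h) \<omega>' \<partial>M)) * (Z (t + h) \<omega> - (\<integral>\<omega>'. Z (t + h) \<omega>' \<partial>M)) \<partial>M) =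
        (\<integral>\<omega>. (Y s \<omega> - (\<integral>\<omega>'. Y s \<omega>' \<partial>M)) * (Z t \<omega> - (\<integral>\<omega>'. Z t \<omega>' \<partial>M)) \<partial>M))"

text \<open>The index set is \<open>T\<close>, so open sets are the relatively open subsets of \<open>T\<close>; the separating
  set consists of the rational points of \<open>T\<close>.  Closed intervals may be unbounded.\<close>

definition separable_process ::
  "'w measure \<Rightarrow> (real \<times> real \<times> real) set \<Rightarrow> (real \<times> real \<times> real \<Rightarrow> 'w \<Rightarrow> real) \<Rightarrow> bool" where
  "separable_process M T Y \<longleftrightarrow>
     (\<exists>N\<in>null_sets M. \<forall>A B. openin (top_of_set T) A \<and> closed B \<and> is_interval B \<longrightarrow>
        (let S1 = {\<omega> \<in> space M. \<forall>\<theta>\<in>A. Y \<theta> \<omega> \<in> B};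
             S2 = {\<omega> \<in> space M. \<forall>\<theta>\<in>A \<inter> (\<rat> \<times> \<rat> \<times> \<rat>). Y \<theta> \<omega> \<in> B}
         in (S1 - S2) \<union> (S2 - S1) \<subseteq> N))"

definition innovations :: "'w measure \<Rightarrow> (int \<Rightarrow> 'w \<Rightarrow> real) \<Rightarrow> bool" where
  "innovations M \<epsilon> \<longleftrightarrow>
     prob_space.indep_vars M (\<lambda>_. borel) \<epsilon> UNIV \<and>
     (\<forall>t. distr M borel (\<epsilon> t) = distr M borel (\<epsilon> 0)) \<and>
     (\<forall>t. continuous_on UNIV (cdf (distr M borel (\<epsilon> t)))) \<and>
     (\<forall>t. integrable M (\<epsilon> t) \<and> (\<integral>\<omega>. \<epsilon> t \<omega> \<partial>M) = 0) \<and>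
     (\<forall>t. integrable M (\<lambda>\<omega>. (\<epsilon> t \<omega>)\<^sup>2) \<and> (\<integral>\<omega>. (\<epsilon> t \<omega>)\<^sup>2 \<partial>M) = 1)"

text \<open>The index 0 is immaterial for identically distributed innovations.\<close>

definition abs_moment :: "'w measure \<Rightarrow> (int \<Rightarrow> 'w \<Rightarrow> real) \<Rightarrow> nat \<Rightarrow> real" where
  "abs_moment M \<epsilon> p = (\<integral>\<omega>. \<bar>\<epsilon> 0 \<omega>\<bar> ^ p \<partial>M)"

text \<open>Parameters are triples \<open>(d, c, a)\<close>.  Coefficient sequences \<open>b\<close> are only ever used at indices
  $j \ge 1$; series over $j \ge 1$ are therefore written with \<open>Suc j\<close>.\<close>

definition coeff_b :: "real \<times> real \<times> real \<Rightarrow> nat \<Rightarrow> real" where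
  "coeff_b = (\<lambda>(d, c, a) j. c * real j powr (d - 1))"

definition intercept :: "real \<times> real \<times> real \<Rightarrow> real" where
  "intercept = (\<lambda>(d, c, a). a)"

definition lp_norm :: "nat \<Rightarrow> (nat \<Rightarrow> real) \<Rightarrow> real" where
  "lp_norm p b = (\<Sum>j. \<bar>b (Suc j)\<bar> ^ p) powr (1 / real p)"

definition c_upper :: "real \<Rightarrow> real \<Rightarrow> real" where
  "c_upper C d = C * (\<Sum>j. real (Suc j) powr (2 * d - 2)) powr (- 1 / 2)"

definition parameter_space ::
  "real \<Rightarrow> real \<Rightarrow> real \<Rightarrow> real \<Rightarrow> (real \<times> real \<times> real) set" where
  "parameter_space d\<^sub>u C a\<^sub>d a\<^sub>u =
     {(d, c, a). d \<in> {0..d\<^sub>u} \<and> c \<in> {0..c_upper C d} \<and> a \<in> {a\<^sub>d..a\<^sub>u}}"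

text \<open>For a list of lags $[j_1, \ldots, j_k]$ this is
  $b_{j_1} \cdots b_{j_k} \varepsilon_{t-j_1} \cdots \varepsilon_{t-j_1-\cdots-j_k}$.\<close>

definition volterra_term ::
  "(int \<Rightarrow> 'w \<Rightarrow> real) \<Rightarrow> (nat \<Rightarrow> real) \<Rightarrow> int \<Rightarrow> nat list \<Rightarrow> 'w \<Rightarrow> real" where
  "volterra_term \<epsilon> b t js \<omega> =
     (\<Prod>i<length js. b (js ! i)) *
     (\<Prod>i<length js. \<epsilon> (t - int (sum_list (take (Suc i) js))) \<omega>)"

text \<open>The auxiliary \<open>V k\<close> is the inner $k$-fold sum.\<close>

definition volterra_expansion ::
  "'w measure \<Rightarrow> (int \<Rightarrow> 'w \<Rightarrow> real) \<Rightarrow> (nat \<Rightarrow> real) \<Rightarrow> real \<Rightarrow> int \<Rightarrow> ('w \<Rightarrow> real) \<Rightarrow> bool" where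
  "volterra_expansion M \<epsilon> b a t s \<longleftrightarrow>
     (\<exists>V. (\<forall>k\<ge>1. L2_has_sum M (volterra_term \<epsilon> b t) {js. length js = k \<and> (\<forall>j\<in>set js. j \<ge> 1)} (V k)) \<and>
          L2_sums M (\<lambda>k \<omega>. a * V (Suc k) \<omega>) (\<lambda>\<omega>. s \<omega> - a))"

text \<open>\<open>s\<close> is a version of $a + \sum_{j \ge 1} b_j X_{t-j}$.\<close>

definition linear_filter ::
  "'w measure \<Rightarrow> (nat \<Rightarrow> real) \<Rightarrow> real \<Rightarrow> (int \<Rightarrow> 'w \<Rightarrow> real) \<Rightarrow> int \<Rightarrow> ('w \<Rightarrow> real) \<Rightarrow> bool" where
  "linear_filter M b a X t s \<longleftrightarrow>
     L2_sums M (\<lambda>j \<omega>. b (Suc j) * X (t - int (Suc j)) \<omega>) (\<lambda>\<omega>. s \<omega> - a)"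

definition stationary_larch ::
  "'w measure \<Rightarrow> (int \<Rightarrow> 'w \<Rightarrow> real) \<Rightarrow> (nat \<Rightarrow> real) \<Rightarrow> real \<Rightarrow>
   (int \<Rightarrow> 'w \<Rightarrow> real) \<Rightarrow> (int \<Rightarrow> 'w \<Rightarrow> real) \<Rightarrow> bool" where
  "stationary_larch M \<epsilon> b a X \<sigma> \<longleftrightarrow>
     strictly_stationary M (\<lambda>t \<omega>. (X t \<omega>, \<sigma> t \<omega>)) \<and>
     second_order_stationary M {X, \<sigma>} \<and>
     (\<forall>t. AE \<omega> in M. X t \<omega> = \<epsilon> t \<omega> * \<sigma> t \<omega>) \<and>
     (\<forall>t. linear_filter M b a X t (\<sigma> t)) \<and>
     (\<forall>t. volterra_expansion M \<epsilon> b a t (\<sigma> t))"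

text \<open>\<open>sig t \<theta>\<close> stands for $\sigma_t(\theta)$.\<close>

definition L_contrast ::
  "real \<Rightarrow> (int \<Rightarrow> 'w \<Rightarrow> real) \<Rightarrow> (int \<Rightarrow> real \<times> real \<times> real \<Rightarrow> 'w \<Rightarrow> real) \<Rightarrow>
   nat \<Rightarrow> real \<times> real \<times> real \<Rightarrow> 'w \<Rightarrow> real" where
  "L_contrast e X sig n \<theta> \<omega> =
     1 / real n * (\<Sum>t=1..int n.
       ((X t \<omega>)\<^sup>2 + e) / ((sig t \<theta> \<omega>)\<^sup>2 + e) + ln ((sig t \<theta> \<omega>)\<^sup>2 + e))"

end

theory Submission
  imports Defs
begin

text \<open>
  The contrast $L_n(\theta)$ is an average, along the orbit of the innovations under the time shift,
  of one functional of the innovations.  It therefore converges to its expectation for each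
  $\theta$; the expectation has its only minimum at $\theta_0$; and the functional has a modulus of
  continuity in $\theta$ whose expectation tends to 0, so that the convergence is uniform on a
  compact set of parameters and minimisers of $L_n$ are forced towards $\theta_0$ (Wald's argument,
  \<open>contrast_separation\<close>).

  Everything takes place on the space of paths of the innovations.  The Volterra expansion expresses
  $\sigma_t$ as $\varphi$ of the path shifted by $t$, with one functional $\varphi$ of the strict past
  (\<open>volterra_expansion_factors\<close>).  On path space the law of large numbers is Birkhoff's theorem for
  the shift of a product measure.  The maximal inequality makes the class of functions with
  convergent averages closed in $L^1$ (\<open>ergodic_average_converges_L1_closed\<close>), and indicators of
  cylinders belong to it because they are independent of their distant shifts.

  Uniformity in $\theta = (d, c, a)$ rests on $\sigma_t(\theta) = a + c\,S_t(d)$ with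
  $S_t(d) = \sum_j j^{d-1} X_{t-j}$: only $d$ enters nonlinearly.  The $X_t$ are uncorrelated, so the
  partial sums of $\sum_j j^{q-1} X_{t-j}$ are bounded in $L^2$ for a fixed $q$ between the largest
  $d$ and $1/2$.  Summation by parts against them turns $S_t(d)$ into a series that converges
  absolutely, is Lipschitz in $d$, and has an integrable random variable as its bound and Lipschitz
  constant (\<open>filter_sum_bound\<close>, \<open>filter_sum_lipschitz\<close>).  By separability this continuous version
  agrees with the given $\sigma_t(\theta)$ for all $\theta$ at once.

  For the minimum, put $u = (\sigma_t^2 + \epsilon) / (\sigma_t^2(\theta) + \epsilon)$.  Since
  $\varepsilon_t$ is independent of the past and has unit variance, the expected contrast at $\theta$
  exceeds that at $\theta_0$ by $E(u - 1 - \ln u) \ge 0$, with equality only if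
  $\sigma_t^2(\theta) = \sigma_t^2$ almost surely.  A continuous distribution of the innovations
  excludes this for $\theta \ne \theta_0$: an affine function of $\varepsilon_{t-j}$ whose coefficients
  depend on the path before $t - j$ vanishes with probability 0 if its slope is nonzero
  (\<open>lag_combination_nonzero\<close>, \<open>identification\<close>).
\<close>

section \<open>Maximal inequality and averages along orbits\<close>

locale measure_preserving_system = prob_space N for N :: "'x measure" +
  fixes T :: "'x \<Rightarrow> 'x"
  assumes T_measurable [measurable]: "T \<in> N \<rightarrow>\<^sub>M N"
    and distr_T: "distr N N T = N"
begin

definition ergodic_sum :: "('x \<Rightarrow> real) \<Rightarrow> nat \<Rightarrow> 'x \<Rightarrow> real" where
  "ergodic_sum f n x = (\<Sum>i<n. f ((T ^^ i) x))"

text \<open>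
  The maximum of the ergodic sums of lengths 0 to $n$, in the recursive form that the proof of the
  maximal inequality uses.
\<close>

fun maximal_sum :: "('x \<Rightarrow> real) \<Rightarrow> nat \<Rightarrow> 'x \<Rightarrow> real" where
  "maximal_sum f 0 x = 0"
| "maximal_sum f (Suc n) x = max 0 (f x + maximal_sum f n (T x))"

lemma funpow_T_measurable [measurable]: "T ^^ i \<in> N \<rightarrow>\<^sub>M N"
proof (induction i)
  case (Suc i)
  then show ?case using measurable_comp[OF Suc T_measurable] by simp
qed (simp add: id_def)

lemma distr_funpow_T: "distr N N (T ^^ i) = N"
proof (induction i)
  case 0
  then show ?case by (simp add: distr_id)
next
  case (Suc i)
  have "distr N N (T ^^ Suc i) = distr (distr N N (T ^^ i)) N T"
    using distr_distr[OF T_measurable funpow_T_measurable[of i]] by simp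
  then show ?case using Suc distr_T by (simp only:)
qed

lemma integrable_funpow_T:
  fixes f :: "'x \<Rightarrow> real"
  assumes "integrable N f"
  shows "integrable N (\<lambda>x. f ((T ^^ i) x))"
  using integrable_distr[of "T ^^ i" N N f] assms by (simp add: distr_funpow_T)

lemma integral_funpow_T:
  fixes f :: "'x \<Rightarrow> real"
  assumes "f \<in> borel_measurable N"
  shows "(\<integral>x. f ((T ^^ i) x) \<partial>N) = (\<integral>x. f x \<partial>N)"
  using integral_distr[of "T ^^ i" N N f] assms by (simp add: distr_funpow_T)

lemma integrable_T:
  fixes f :: "'x \<Rightarrow> real"
  shows "integrable N f \<Longrightarrow> integrable N (\<lambda>x. f (T x))"
  using integrable_funpow_T[of f 1] by simp

lemma integral_T:
  fixes f :: "'x \<Rightarrow> real"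
  shows "f \<in> borel_measurable N \<Longrightarrow> (\<integral>x. f (T x) \<partial>N) = (\<integral>x. f x \<partial>N)"
  using integral_funpow_T[of f 1] by simp

lemma ergodic_sum_measurable [measurable]:
  assumes [measurable]: "f \<in> borel_measurable N"
  shows "ergodic_sum f n \<in> borel_measurable N"
  unfolding ergodic_sum_def by measurable

lemma ergodic_sum_integrable:
  "integrable N f \<Longrightarrow> integrable N (ergodic_sum f n)"
  unfolding ergodic_sum_def by (intro Bochner_Integration.integrable_sum integrable_funpow_T)

lemma ergodic_sum_Suc: "ergodic_sum f (Suc n) x = f x + ergodic_sum f n (T x)"
  unfolding ergodic_sum_def by (simp add: sum.lessThan_Suc_shift funpow_Suc_right del: funpow.simps(2) sum.lessThan_Suc)

lemma ergodic_sum_add: "ergodic_sum f (m + n) x = ergodic_sum f m x + ergodic_sum f n ((T ^^ m) x)"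
  unfolding ergodic_sum_def
  by (induction n) (auto simp: funpow_add add.commute algebra_simps)

lemma maximal_sum_nonneg: "0 \<le> maximal_sum f n x"
  by (cases n) auto

lemma maximal_sum_mono: "maximal_sum f n x \<le> maximal_sum f (Suc n) x"
proof (induction n arbitrary: x)
  case (Suc n)
  have "f x + maximal_sum f n (T x) \<le> f x + maximal_sum f (Suc n) (T x)"
    using Suc by simp
  then show ?case by (simp only: maximal_sum.simps)
qed simp

lemma ergodic_sum_le_maximal_sum:
  "k \<le> n \<Longrightarrow> ergodic_sum f k x \<le> maximal_sum f n x"
proof (induction n arbitrary: k x)
  case 0
  then show ?case by (simp add: ergodic_sum_def)
next
  case (Suc n)
  show ?case
  proof (cases k)
    case 0
    then show ?thesis using maximal_sum_nonneg[of f "Suc n" x] by (simp add: ergodic_sum_def)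
  next
    case (Suc k')
    then have "ergodic_sum f k' (T x) \<le> maximal_sum f n (T x)" using Suc.IH[of k'] Suc.prems by simp
    then show ?thesis using Suc by (simp add: ergodic_sum_Suc)
  qed
qed

lemma maximal_sum_integrable:
  assumes "integrable N f"
  shows "integrable N (maximal_sum f n)"
proof (induction n)
  case 0
  then show ?case by simp
next
  case (Suc n)
  have "maximal_sum f (Suc n) = (\<lambda>x. max 0 (f x + maximal_sum f n (T x)))" by auto
  then show ?case
    using assms integrable_T[OF Suc] by (auto intro!: integrable_max)
qed

text \<open>
  Garsia's argument: where the maximum $M$ is positive, the recursion gives $f \ge M - M \circ T$, while
  elsewhere $M - M \circ T \le 0$; and $M - M \circ T$ has integral 0.
\<close>

lemma maximal_ergodic_inequality:
  assumes f: "integrable N f"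
  shows "0 \<le> (\<integral>x. indicator {x\<in>space N. 0 < maximal_sum f n x} x * f x \<partial>N)"
proof (cases n)
  case 0
  then show ?thesis by simp
next
  case (Suc m)
  have M: "integrable N (maximal_sum f n)" by (rule maximal_sum_integrable[OF f])
  have [measurable]: "maximal_sum f n \<in> borel_measurable N" "f \<in> borel_measurable N" using M f by auto
  have "0 = (\<integral>x. maximal_sum f n x - maximal_sum f n (T x) \<partial>N)"
    using M integrable_T[OF M] integral_T[of "maximal_sum f n"] by simp
  also have "\<dots> \<le> (\<integral>x. indicator {x\<in>space N. 0 < maximal_sum f n x} x * f x \<partial>N)"
  proof (rule integral_mono)
    show "integrable N (\<lambda>x. maximal_sum f n x - maximal_sum f n (T x))"
      using M integrable_T[OF M] by simp
    show "integrable N (\<lambda>x. indicator {x\<in>space N. 0 < maximal_sum f n x} x * f x)"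
      using integrable_mult_indicator[OF _ f, of "{x\<in>space N. 0 < maximal_sum f n x}"] by simp
  next
    fix x assume x: "x \<in> space N"
    have "maximal_sum f m (T x) \<le> maximal_sum f n (T x)" unfolding Suc by (rule maximal_sum_mono)
    then show "maximal_sum f n x - maximal_sum f n (T x) \<le> indicator {x\<in>space N. 0 < maximal_sum f n x} x * f x"
      using x maximal_sum_nonneg[of f n "T x"] maximal_sum_nonneg[of f n x]
      by (auto simp: Suc max_def indicator_def split: if_splits)
  qed
  finally show ?thesis .
qed

text \<open>
  The maximal inequality for $|f| - l$, in the limit of infinitely long orbits.
\<close>

lemma orbit_average_weak_type:
  assumes f: "integrable N f" and l: "0 < l"
  shows "{x\<in>space N. \<exists>n\<ge>1. l * real n < ergodic_sum (\<lambda>x. \<bar>f x\<bar>) n x} \<in> sets N" (is "?A \<in> _")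
    and "l * measure N {x\<in>space N. \<exists>n\<ge>1. l * real n < ergodic_sum (\<lambda>x. \<bar>f x\<bar>) n x} \<le> (\<integral>x. \<bar>f x\<bar> \<partial>N)"
proof -
  have [measurable]: "f \<in> borel_measurable N" using f by auto
  show "?A \<in> sets N" by measurable
  define g where "g = (\<lambda>x. \<bar>f x\<bar> - l)"
  have g: "integrable N g" unfolding g_def using f by auto
  have [measurable]: "maximal_sum g n \<in> borel_measurable N" for n using maximal_sum_integrable[OF g] by auto
  define B where "B n = {x\<in>space N. 0 < maximal_sum g n x}" for n
  have B[measurable]: "B n \<in> sets N" for n unfolding B_def by measurable
  have "incseq B"
  proof (rule incseq_SucI, rule subsetI)
    fix n x assume "x \<in> B n"
    then show "x \<in> B (Suc n)" using maximal_sum_mono[of g n x] by (simp add: B_def)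
  qed
  have bound: "l * measure N (B n) \<le> (\<integral>x. \<bar>f x\<bar> \<partial>N)" for n
  proof -
    have i: "integrable N (\<lambda>x. indicator (B n) x * \<bar>f x\<bar>)"
      using integrable_real_mult_indicator[of "B n" N "\<lambda>x. \<bar>f x\<bar>"] f by (simp add: mult.commute)
    have "0 \<le> (\<integral>x. indicator (B n) x * g x \<partial>N)" unfolding B_def by (rule maximal_ergodic_inequality[OF g])
    also have "\<dots> = (\<integral>x. indicator (B n) x * \<bar>f x\<bar> \<partial>N) - (\<integral>x. l * indicator (B n) x \<partial>N)"
      unfolding g_def using i
      by (subst Bochner_Integration.integral_diff[symmetric])
         (auto simp: algebra_simps integrable_indicator_iff emeasure_eq_measure)
    also have "\<dots> \<le> (\<integral>x. \<bar>f x\<bar> \<partial>N) - l * measure N (B n)"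
    proof -
      have "(\<integral>x. indicator (B n) x * \<bar>f x\<bar> \<partial>N) \<le> (\<integral>x. \<bar>f x\<bar> \<partial>N)"
        using f i by (intro integral_mono) (auto simp: indicator_def)
      then show ?thesis by simp
    qed
    finally show ?thesis by simp
  qed
  have "?A \<subseteq> (\<Union>n. B n)"
  proof
    fix x assume "x \<in> ?A"
    then obtain n where n: "x \<in> space N" "l * real n < ergodic_sum (\<lambda>x. \<bar>f x\<bar>) n x" by auto
    have "ergodic_sum g n x = ergodic_sum (\<lambda>x. \<bar>f x\<bar>) n x - l * real n"
      unfolding ergodic_sum_def g_def by (simp add: sum_subtractf)
    then show "x \<in> (\<Union>n. B n)"
      using n ergodic_sum_le_maximal_sum[of n n g x] by (auto simp: B_def intro!: exI[of _ n])
  qed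
  then have "measure N ?A \<le> measure N (\<Union>n. B n)" by (intro finite_measure_mono) auto
  moreover have "(\<lambda>n. l * measure N (B n)) \<longlonglongrightarrow> l * measure N (\<Union>n. B n)"
    using \<open>incseq B\<close> by (intro tendsto_intros finite_Lim_measure_incseq) auto
  then have "l * measure N (\<Union>n. B n) \<le> (\<integral>x. \<bar>f x\<bar> \<partial>N)"
    by (rule LIMSEQ_le_const2) (use bound in auto)
  ultimately show "l * measure N ?A \<le> (\<integral>x. \<bar>f x\<bar> \<partial>N)"
    using mult_left_mono[of "measure N ?A" "measure N (\<Union>n. B n)" l] l by linarith
qed

definition ergodic_average_converges :: "('x \<Rightarrow> real) \<Rightarrow> bool" where
  "ergodic_average_converges f \<longleftrightarrow>
     integrable N f \<and> (AE x in N. (\<lambda>n. ergodic_sum f n x / real n) \<longlonglongrightarrow> (\<integral>x. f x \<partial>N))"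

text \<open>
  If $g$ is close to $f$ in $L^1$, then by the weak-type bound all orbit averages of $|f - g|$ are small
  outside a small set, so the averages of $f$ inherit convergence from those of $g$.
\<close>

lemma ergodic_average_converges_L1_closed:
  assumes f: "integrable N f"
    and approx: "\<And>\<eta>. 0 < \<eta> \<Longrightarrow> \<exists>g. ergodic_average_converges g \<and> (\<integral>x. \<bar>f x - g x\<bar> \<partial>N) \<le> \<eta>"
  shows "ergodic_average_converges f"
proof -
  \<comment> \<open>Almost no point lies in all sets \<open>B d k\<close> with $k \ge d$; outside one of them the averages of \<open>f\<close> and \<open>g k\<close> differ by at most $1 / (d + 1)$.\<close>
  have "\<forall>k::nat. \<exists>g. ergodic_average_converges g \<and> (\<integral>x. \<bar>f x - g x\<bar> \<partial>N) \<le> 1 / Suc k"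
    by (intro allI approx) simp
  then obtain g where g: "\<And>k. ergodic_average_converges (g k)"
    and fg: "\<And>k. (\<integral>x. \<bar>f x - g k x\<bar> \<partial>N) \<le> 1 / Suc k" by metis
  have gi: "integrable N (g k)" for k using g by (auto simp: ergodic_average_converges_def)
  have di: "integrable N (\<lambda>x. f x - g k x)" for k using f gi by auto
  have AEg: "AE x in N. \<forall>k. (\<lambda>n. ergodic_sum (g k) n x / real n) \<longlonglongrightarrow> (\<integral>x. g k x \<partial>N)"
    using g by (auto simp: ergodic_average_converges_def AE_all_countable)
  define B where "B d k = {x\<in>space N. \<exists>n\<ge>1. 1 / Suc d * real n < ergodic_sum (\<lambda>x. \<bar>f x - g k x\<bar>) n x}" for d k :: nat
  have B: "B d k \<in> sets N" "measure N (B d k) \<le> Suc d * (1 / Suc k)" for d k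
  proof -
    show "B d k \<in> sets N" unfolding B_def by (rule orbit_average_weak_type[OF di]) auto
    have "1 / Suc d * measure N (B d k) \<le> 1 / Suc k"
      unfolding B_def by (rule order_trans[OF orbit_average_weak_type(2)[OF di] fg]) simp
    then show "measure N (B d k) \<le> Suc d * (1 / Suc k)" by (simp add: field_simps)
  qed
  have "AE x in N. \<exists>k\<ge>d. x \<notin> B d k" for d
  proof (rule AE_I')
    have "measure N (\<Inter>k\<in>{d..}. B d k) \<le> 0"
    proof (rule LIMSEQ_le_const)
      have "(\<lambda>k. 1 / real (Suc k)) \<longlonglongrightarrow> 0"
        using LIMSEQ_inverse_real_of_nat by (simp add: inverse_eq_divide)
      then have "(\<lambda>k. real (Suc d) * (1 / real (Suc k))) \<longlonglongrightarrow> real (Suc d) * 0"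
        by (intro tendsto_intros)
      then show "(\<lambda>k. real (Suc d) * (1 / real (Suc k))) \<longlonglongrightarrow> 0" by simp
      show "\<exists>n0. \<forall>n\<ge>n0. measure N (\<Inter>k\<in>{d..}. B d k) \<le> real (Suc d) * (1 / real (Suc n))"
      proof (intro exI[of _ d] allI impI)
        fix n assume "d \<le> n"
        then have "measure N (\<Inter>k\<in>{d..}. B d k) \<le> measure N (B d n)"
          using B by (intro finite_measure_mono) auto
        then show "measure N (\<Inter>k\<in>{d..}. B d k) \<le> real (Suc d) * (1 / real (Suc n))"
          using B(2)[of d n] by linarith
      qed
    qed
    then have "emeasure N (\<Inter>k\<in>{d..}. B d k) = 0" by (simp add: emeasure_eq_measure measure_le_0_iff)
    then show "(\<Inter>k\<in>{d..}. B d k) \<in> null_sets N" using B(1) by (intro null_setsI) auto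
    show "{x \<in> space N. \<not> (\<exists>k\<ge>d. x \<notin> B d k)} \<subseteq> (\<Inter>k\<in>{d..}. B d k)" by auto
  qed
  then have AEB: "AE x in N. \<forall>d. \<exists>k\<ge>d. x \<notin> B d k" by (simp add: AE_all_countable)
  have "AE x in N. (\<lambda>n. ergodic_sum f n x / real n) \<longlonglongrightarrow> (\<integral>x. f x \<partial>N)"
    using AEg AEB AE_space
  proof eventually_elim
    case (elim x)
    show ?case
    proof (rule LIMSEQ_I)
      fix r :: real assume "0 < r"
      then obtain d where d: "1 / real (Suc d) < r / 3"
        using reals_Archimedean[of "r/3"] by (auto simp: inverse_eq_divide)
      obtain k where k: "k \<ge> d" "x \<notin> B d k" using elim by auto
      have "\<bar>(\<integral>x. f x \<partial>N) - (\<integral>x. g k x \<partial>N)\<bar> \<le> (\<integral>x. \<bar>f x - g k x\<bar> \<partial>N)"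
        using f gi integral_abs_bound[of N "\<lambda>x. f x - g k x"] by simp
      also have "\<dots> \<le> 1 / real (Suc k)" by (rule fg)
      also have "\<dots> \<le> 1 / real (Suc d)" using k by (simp add: field_simps)
      finally have 1: "\<bar>(\<integral>x. f x \<partial>N) - (\<integral>x. g k x \<partial>N)\<bar> < r / 3" using d by linarith
      obtain n0 where n0: "\<And>n. n \<ge> n0 \<Longrightarrow> \<bar>ergodic_sum (g k) n x / real n - (\<integral>x. g k x \<partial>N)\<bar> < r / 3"
        using LIMSEQ_D[OF elim(1)[rule_format, of k], of "r/3"] \<open>0 < r\<close> by auto
      have "norm (ergodic_sum f n x / real n - (\<integral>x. f x \<partial>N)) < r" if n: "n \<ge> max 1 n0" for n
      proof -
        have "\<bar>ergodic_sum f n x - ergodic_sum (g k) n x\<bar> \<le> ergodic_sum (\<lambda>x. \<bar>f x - g k x\<bar>) n x"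
          unfolding ergodic_sum_def sum_subtractf[symmetric] by (rule sum_abs)
        also have "\<dots> \<le> 1 / Suc d * real n"
          using k(2) elim(3) n by (auto simp: B_def not_less)
        finally have "\<bar>ergodic_sum f n x - ergodic_sum (g k) n x\<bar> / real n \<le> 1 / Suc d"
          using n by (simp add: field_simps)
        then have "\<bar>ergodic_sum f n x / real n - ergodic_sum (g k) n x / real n\<bar> \<le> 1 / Suc d"
          by (simp add: diff_divide_distrib[symmetric] abs_divide)
        then have "\<bar>ergodic_sum f n x / real n - ergodic_sum (g k) n x / real n\<bar> < r / 3"
          using d by linarith
        then show ?thesis using 1 n0[of n] n unfolding real_norm_def by linarith
      qed
      then show "\<exists>no. \<forall>n\<ge>no. norm (ergodic_sum f n x / real n - (\<integral>x. f x \<partial>N)) < r" by blast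
    qed
  qed
  then show ?thesis using f by (simp add: ergodic_average_converges_def)
qed

lemma ergodic_average_converges_const: "ergodic_average_converges (\<lambda>_. c)"
proof -
  have "(\<lambda>n. ergodic_sum (\<lambda>_. c) n x / real n) \<longlonglongrightarrow> c" for x
    by (rule tendsto_eventually) (auto simp: ergodic_sum_def eventually_sequentially intro!: exI[of _ 1])
  then show ?thesis by (simp add: ergodic_average_converges_def prob_space)
qed

lemma ergodic_average_converges_add:
  assumes "ergodic_average_converges f" "ergodic_average_converges g"
  shows "ergodic_average_converges (\<lambda>x. f x + g x)"
proof -
  have i: "integrable N f" "integrable N g" using assms by (auto simp: ergodic_average_converges_def)
  have "AE x in N. (\<lambda>n. ergodic_sum f n x / real n) \<longlonglongrightarrow> (\<integral>x. f x \<partial>N)"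
       "AE x in N. (\<lambda>n. ergodic_sum g n x / real n) \<longlonglongrightarrow> (\<integral>x. g x \<partial>N)"
    using assms by (auto simp: ergodic_average_converges_def)
  then have "AE x in N. (\<lambda>n. ergodic_sum (\<lambda>x. f x + g x) n x / real n) \<longlonglongrightarrow> (\<integral>x. f x + g x \<partial>N)"
  proof eventually_elim
    case (elim x)
    have "(\<lambda>n. ergodic_sum f n x / real n + ergodic_sum g n x / real n) \<longlonglongrightarrow> (\<integral>x. f x \<partial>N) + (\<integral>x. g x \<partial>N)"
      by (intro tendsto_add elim)
    then show ?case using i by (simp add: ergodic_sum_def sum.distrib add_divide_distrib)
  qed
  then show ?thesis using i by (simp add: ergodic_average_converges_def)
qed

lemma ergodic_average_converges_scale:
  assumes "ergodic_average_converges f"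
  shows "ergodic_average_converges (\<lambda>x. c * f x)"
proof -
  have "AE x in N. (\<lambda>n. ergodic_sum f n x / real n) \<longlonglongrightarrow> (\<integral>x. f x \<partial>N)"
    using assms by (auto simp: ergodic_average_converges_def)
  then have "AE x in N. (\<lambda>n. ergodic_sum (\<lambda>x. c * f x) n x / real n) \<longlonglongrightarrow> (\<integral>x. c * f x \<partial>N)"
  proof eventually_elim
    case (elim x)
    have "(\<lambda>n. c * (ergodic_sum f n x / real n)) \<longlonglongrightarrow> c * (\<integral>x. f x \<partial>N)"
      by (intro tendsto_intros elim)
    then show ?case by (simp add: ergodic_sum_def sum_distrib_left)
  qed
  then show ?thesis using assms by (auto simp: ergodic_average_converges_def)
qed

text \<open>
  For bounded $f$, convergence in $L^1$ along a sequence suffices.  If $h$ is the average of $f$ over $n$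
  steps, the ergodic sums of $f$ and $h$ differ only by boundary terms, which stay bounded.  Hence the
  averages of $f - h + p$, with $p$ the integral of $f$, converge trivially, and this function is close to
  $f$ in $L^1$ if $h$ is close to $p$.
\<close>

lemma ergodic_average_converges_bounded:
  assumes f[measurable]: "f \<in> borel_measurable N" and b: "\<And>x. \<bar>f x\<bar> \<le> B"
    and L1: "\<And>\<eta>. 0 < \<eta> \<Longrightarrow> \<exists>n\<ge>1. (\<integral>x. \<bar>ergodic_sum f n x / real n - (\<integral>x. f x \<partial>N)\<bar> \<partial>N) \<le> \<eta>"
  shows "ergodic_average_converges f"
proof (rule ergodic_average_converges_L1_closed)
  show fi: "integrable N f" by (rule integrable_const_bound[of _ B]) (use b in auto)
  define p where "p = (\<integral>x. f x \<partial>N)"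
  fix \<eta> :: real assume "0 < \<eta>"
  then obtain n where n: "n \<ge> 1" "(\<integral>x. \<bar>ergodic_sum f n x / real n - p\<bar> \<partial>N) \<le> \<eta>"
    using L1 unfolding p_def by blast
  define h where "h = (\<lambda>x. ergodic_sum f n x / real n)"
  define g where "g = (\<lambda>x. f x - h x + p)"
  have hi: "integrable N h" unfolding h_def using ergodic_sum_integrable[OF fi] by simp
  have gi: "integrable N g" unfolding g_def using fi hi by simp
  have "(\<integral>x. h x \<partial>N) = p"
    using n fi by (simp add: h_def ergodic_sum_def p_def Bochner_Integration.integral_sum integrable_funpow_T integral_funpow_T)
  then have gp: "(\<integral>x. g x \<partial>N) = p"
    unfolding g_def using fi hi by (simp add: p_def prob_space)
  have B0: "0 \<le> B" using b[of undefined] by linarith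
  have bd: "\<bar>ergodic_sum f j y\<bar> \<le> real j * B" for j y
    unfolding ergodic_sum_def
    by (rule order_trans[OF sum_abs], rule order_trans[OF sum_bounded_above[of _ _ B]]) (use b in auto)
  \<comment> \<open>The sums of \<open>f\<close> over $k$ steps from $x$ and from $T^j x$ differ by sums over $j < n$ steps.\<close>
  have key: "\<bar>ergodic_sum f k x - ergodic_sum h k x\<bar> \<le> 2 * real n * B" for k x
  proof -
    have e: "ergodic_sum f k ((T ^^ j) x) = ergodic_sum f k x + ergodic_sum f j ((T ^^ k) x) - ergodic_sum f j x" for j
      using ergodic_sum_add[of f j k x] ergodic_sum_add[of f k j x] by (simp add: add.commute)
    have "ergodic_sum h k x = (\<Sum>i<k. \<Sum>j<n. f ((T ^^ j) ((T ^^ i) x))) / real n"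
      by (simp add: h_def ergodic_sum_def sum_divide_distrib)
    also have "(\<Sum>i<k. \<Sum>j<n. f ((T ^^ j) ((T ^^ i) x))) = (\<Sum>j<n. ergodic_sum f k ((T ^^ j) x))"
      unfolding ergodic_sum_def
      by (subst sum.swap) (simp add: funpow_add[unfolded comp_def fun_eq_iff, rule_format, symmetric] add.commute)
    finally have "ergodic_sum f k x - ergodic_sum h k x
        = (\<Sum>j<n. ergodic_sum f j x - ergodic_sum f j ((T ^^ k) x)) / real n"
      using n by (simp add: e sum.distrib sum_subtractf field_simps)
    moreover have "\<bar>\<Sum>j<n. ergodic_sum f j x - ergodic_sum f j ((T ^^ k) x)\<bar> \<le> (\<Sum>j<n. 2 * real n * B)"
    proof (rule order_trans[OF sum_abs], rule sum_mono)
      fix j assume "j \<in> {..<n}"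
      then have "real j * B \<le> real n * B" using B0 by (intro mult_right_mono) auto
      then show "\<bar>ergodic_sum f j x - ergodic_sum f j ((T ^^ k) x)\<bar> \<le> 2 * real n * B"
        using bd[of j x] bd[of j "(T ^^ k) x"] by linarith
    qed
    ultimately have "\<bar>ergodic_sum f k x - ergodic_sum h k x\<bar> \<le> (\<Sum>j<n. 2 * real n * B) / real n"
      using n by (simp only: abs_divide abs_of_nat) (rule divide_right_mono, auto)
    then show ?thesis using n by simp
  qed
  have "(\<lambda>k. ergodic_sum g k x / real k) \<longlonglongrightarrow> p" for x
  proof -
    have "(\<lambda>k. (ergodic_sum f k x - ergodic_sum h k x) / real k) \<longlonglongrightarrow> 0"
    proof (rule Lim_null_comparison)
      show "\<forall>\<^sub>F k in sequentially. norm ((ergodic_sum f k x - ergodic_sum h k x) / real k) \<le> (2 * real n * B) / real k"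
        using key by (auto simp: abs_divide divide_right_mono)
      show "(\<lambda>k. (2 * real n * B) / real k) \<longlonglongrightarrow> 0"
        by (rule lim_const_over_n)
    qed
    then have "(\<lambda>k. (ergodic_sum f k x - ergodic_sum h k x) / real k + p) \<longlonglongrightarrow> 0 + p"
      by (intro tendsto_intros)
    moreover have "\<forall>\<^sub>F k in sequentially. (ergodic_sum f k x - ergodic_sum h k x) / real k + p = ergodic_sum g k x / real k"
      unfolding g_def eventually_sequentially
      by (intro exI[of _ 1]) (auto simp: ergodic_sum_def sum.distrib sum_subtractf field_simps)
    ultimately show ?thesis by (simp add: tendsto_cong)
  qed
  then have "ergodic_average_converges g" using gi gp by (simp add: ergodic_average_converges_def)
  moreover have "(\<integral>x. \<bar>f x - g x\<bar> \<partial>N) \<le> \<eta>"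
    using n(2) by (simp add: g_def h_def)
  ultimately show "\<exists>g. ergodic_average_converges g \<and> (\<integral>x. \<bar>f x - g x\<bar> \<partial>N) \<le> \<eta>" by blast
qed

lemma ergodic_average_converges_sum:
  assumes "\<And>i. i < n \<Longrightarrow> ergodic_average_converges (f i)"
  shows "ergodic_average_converges (\<lambda>x. \<Sum>i<(n::nat). f i x)"
  using assms by (induction n) (auto intro: ergodic_average_converges_const ergodic_average_converges_add)

text \<open>
  Complements and disjoint unions of sets with convergent frequencies again have convergent
  frequencies, the unions by $L^1$-closedness; then indicators generate all integrable functions.
\<close>

lemma ergodic_theorem_from_generator:
  assumes G: "Int_stable G" "G \<subseteq> Pow (space N)" "sets N = sigma_sets (space N) G"
    and base: "\<And>A. A \<in> G \<Longrightarrow> ergodic_average_converges (indicator A)"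
    and f: "integrable N f"
  shows "ergodic_average_converges f"
proof -
  have ind: "ergodic_average_converges (indicator A)" if "A \<in> sets N" for A
    using G(1,2) that[unfolded G(3)]
  proof (induction rule: sigma_sets_induct_disjoint)
    case (basic A)
    then show ?case by (rule base)
  next
    case empty
    show ?case using ergodic_average_converges_const[of 0] by (simp add: indicator_def)
  next
    case (compl A)
    have "ergodic_average_converges (\<lambda>x. 1 + (-1) * indicator A x)"
      by (intro ergodic_average_converges_add ergodic_average_converges_const ergodic_average_converges_scale compl)
    moreover have "(\<lambda>x. indicator (space N - A) x :: real) y = 1 + (-1) * indicator A y" if "y \<in> space N" for y
      using that by (auto simp: indicator_def)
    moreover have Ts: "(T ^^ i) y \<in> space N" if "y \<in> space N" for i y
      using measurable_space[OF funpow_T_measurable that] .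
    moreover have "A \<in> sets N" using compl G(3) by simp
    ultimately show ?case
      unfolding ergodic_average_converges_def ergodic_sum_def
      by (auto simp: Ts cong: Bochner_Integration.integral_cong AE_cong_simp
               intro!: integrable_real_indicator simp: emeasure_eq_measure)
  next
    case (union A)
    then have A[measurable]: "A i \<in> sets N" for i using G(3) by auto
    show ?case
    proof (rule ergodic_average_converges_L1_closed)
      show "integrable N (indicat_real (\<Union>i. A i))"
        by (intro integrable_real_indicator) (auto simp: emeasure_eq_measure)
      fix \<eta> :: real assume "0 < \<eta>"
      have "(\<lambda>n. measure N (\<Union>i<n. A i)) \<longlonglongrightarrow> measure N (\<Union>n. \<Union>i<n. A i)"
        by (rule finite_Lim_measure_incseq) (auto simp: incseq_def intro: less_le_trans)
      moreover have "(\<Union>n. \<Union>i<n. A i) = (\<Union>i. A i)" by auto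
      ultimately obtain n where n: "\<bar>measure N (\<Union>i<n. A i) - measure N (\<Union>i. A i)\<bar> < \<eta>"
        using \<open>0 < \<eta>\<close> by (auto dest!: LIMSEQ_D simp: real_norm_def)
      have s: "(\<Sum>i<n. indicator (A i) x) = (indicator (\<Union>i<n. A i) x :: real)" for x
        using union(1) by (intro indicator_UN_disjoint[symmetric]) (auto simp: disjoint_family_on_def)
      have "ergodic_average_converges (\<lambda>x. \<Sum>i<n. indicator (A i) x)"
        by (intro ergodic_average_converges_sum union)
      moreover have "(\<integral>x. \<bar>indicator (\<Union>i. A i) x - (\<Sum>i<n. indicator (A i) x :: real)\<bar> \<partial>N) =
          (\<integral>x. indicator ((\<Union>i. A i) - (\<Union>i<n. A i)) x \<partial>N)"
        unfolding s by (intro Bochner_Integration.integral_cong refl) (auto split: split_indicator)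
      moreover have "\<dots> = measure N (\<Union>i. A i) - measure N (\<Union>i<n. A i)"
        by (simp, subst finite_measure_Diff) auto
      ultimately show "\<exists>g. ergodic_average_converges g \<and> (\<integral>x. \<bar>indicator (\<Union>i. A i) x - g x\<bar> \<partial>N) \<le> \<eta>"
        using n by (intro exI[of _ "\<lambda>x. \<Sum>i<n. indicator (A i) x"]) auto
    qed
  qed
  show ?thesis using f
  proof (induction rule: integrable_induct)
    case (base A c)
    have "ergodic_average_converges (\<lambda>x. c * indicator A x)"
      by (intro ergodic_average_converges_scale ind base)
    then show ?case by (simp add: mult.commute)
  next
    case (add f g)
    then show ?case by (intro ergodic_average_converges_add)
  next
    case (lim f s)
    show ?case
    proof (rule ergodic_average_converges_L1_closed)
      show "integrable N f" using lim by simp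
      fix \<eta> :: real assume "0 < \<eta>"
      have [measurable]: "f \<in> borel_measurable N" "s i \<in> borel_measurable N" for i using lim by auto
      have "(\<lambda>i. \<integral>x. \<bar>f x - s i x\<bar> \<partial>N) \<longlonglongrightarrow> (\<integral>x. 0 \<partial>N)"
      proof (rule integral_dominated_convergence[where w="\<lambda>x. 3 * norm (f x)"])
        show "integrable N (\<lambda>x. 3 * norm (f x))" using lim by simp
        show "AE x in N. (\<lambda>i. \<bar>f x - s i x\<bar>) \<longlonglongrightarrow> 0"
        proof (rule AE_I2)
          fix x assume "x \<in> space N"
          then have "(\<lambda>i. \<bar>f x - s i x\<bar>) \<longlonglongrightarrow> \<bar>f x - f x\<bar>"
            by (intro tendsto_intros lim)
          then show "(\<lambda>i. \<bar>f x - s i x\<bar>) \<longlonglongrightarrow> 0" by simp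
        qed
        show "AE x in N. norm \<bar>f x - s i x\<bar> \<le> 3 * norm (f x)" for i
          using lim(3)[of _ i] by (intro AE_I2) (force simp: abs_if split: if_splits)
      qed auto
      then obtain i where "\<bar>\<integral>x. \<bar>f x - s i x\<bar> \<partial>N\<bar> < \<eta>"
        using \<open>0 < \<eta>\<close> by (auto dest!: LIMSEQ_D simp: real_norm_def)
      then show "\<exists>g. ergodic_average_converges g \<and> (\<integral>x. \<bar>f x - g x\<bar> \<partial>N) \<le> \<eta>"
        using lim(5)[of i] by (intro exI[of _ "s i"]) auto
    qed
  qed
qed

end

section \<open>Paths of an independent, identically distributed noise\<close>

definition time_shift :: "int \<Rightarrow> (int \<Rightarrow> 'a) \<Rightarrow> int \<Rightarrow> 'a" where
  "time_shift h x = (\<lambda>i. x (i + h))"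

text \<open>
  Being a function of the coordinates in \<open>K\<close> is stated pointwise instead of by measurability, so that
  it passes to arbitrary pointwise limits, exceptional points included.
\<close>

definition depends_on :: "int set \<Rightarrow> ((int \<Rightarrow> real) \<Rightarrow> 'b) \<Rightarrow> bool" where
  "depends_on K f \<longleftrightarrow> (\<forall>x y. (\<forall>i\<in>K. x i = y i) \<longrightarrow> f x = f y)"

lemma shift_shift [simp]: "time_shift g (time_shift h x) = time_shift (g + h) x"
  by (simp add: time_shift_def add.assoc)

lemma shift_0 [simp]: "time_shift 0 x = x"
  by (simp add: time_shift_def)

lemma funpow_shift: "(time_shift 1 ^^ n) x = time_shift (int n) x"
  by (induction n) (auto simp: add.commute)

lemma depends_on_shift:
  "depends_on K f \<Longrightarrow> (\<And>i. i \<in> K \<Longrightarrow> i + h \<in> K') \<Longrightarrow> depends_on K' (\<lambda>x. f (time_shift h x))"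
  unfolding depends_on_def time_shift_def by (intro allI impI) (drule spec, drule spec, erule mp, simp)

lemma depends_on_mono: "depends_on K f \<Longrightarrow> K \<subseteq> K' \<Longrightarrow> depends_on K' f"
  unfolding depends_on_def by blast

locale noise =
  fixes \<mu> :: "real measure"
  assumes prob_\<mu>: "prob_space \<mu>" and sets_\<mu> [measurable_cong]: "sets \<mu> = sets borel"
begin

definition path_measure :: "(int \<Rightarrow> real) measure" where
  "path_measure = (\<Pi>\<^sub>M i\<in>UNIV. \<mu>)"

sublocale \<mu>: prob_space \<mu> by (rule prob_\<mu>)

sublocale P: product_prob_space "\<lambda>_::int. \<mu>" UNIV
  by unfold_locales

lemma space_\<mu> [simp]: "space \<mu> = UNIV"
  using sets_eq_imp_space_eq[OF sets_\<mu>] by simp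

lemma space_path [simp]: "space path_measure = UNIV"
  by (simp add: path_measure_def space_PiM PiE_UNIV_domain)

lemma measurable_coord [measurable]: "(\<lambda>x. x i) \<in> borel_measurable path_measure"
proof -
  have "(\<lambda>x. x i) \<in> path_measure \<rightarrow>\<^sub>M \<mu>" unfolding path_measure_def by measurable
  then show ?thesis using measurable_cong_sets[OF refl sets_\<mu>] by blast
qed

lemma measurable_shift [measurable]: "time_shift h \<in> path_measure \<rightarrow>\<^sub>M path_measure"
  unfolding path_measure_def time_shift_def
  by (rule measurable_PiM_single') (auto simp: space_PiM PiE_UNIV_domain)

lemma distr_shift: "distr path_measure path_measure (time_shift h) = path_measure"
proof -
  have "distr (Pi\<^sub>M UNIV (\<lambda>_. \<mu>)) (Pi\<^sub>M UNIV (\<lambda>_. \<mu>)) (\<lambda>x. \<lambda>n\<in>UNIV. x (n + h)) = Pi\<^sub>M UNIV (\<lambda>_. \<mu>)"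
    by (rule distr_PiM_reindex) (auto intro: prob_\<mu>)
  then show ?thesis by (simp add: path_measure_def time_shift_def[abs_def] restrict_def)
qed

sublocale N: measure_preserving_system path_measure "time_shift 1"
  unfolding measure_preserving_system_def measure_preserving_system_axioms_def
  using distr_shift measurable_shift prob_space_PiM[of UNIV "\<lambda>_::int. \<mu>"] prob_\<mu>
  by (simp add: path_measure_def)

lemma prob_paths [simp]: "measure path_measure UNIV = 1"
  using N.prob_space by simp

lemma integrable_shift:
  fixes f :: "(int \<Rightarrow> real) \<Rightarrow> real"
  assumes "integrable path_measure f"
  shows "integrable path_measure (\<lambda>x. f (time_shift h x))"
  using integrable_distr[of "time_shift h" path_measure path_measure f] assms by (simp add: distr_shift)

lemma integral_shift:
  fixes f :: "(int \<Rightarrow> real) \<Rightarrow> real"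
  assumes "f \<in> borel_measurable path_measure"
  shows "(\<integral>x. f (time_shift h x) \<partial>path_measure) = (\<integral>x. f x \<partial>path_measure)"
  using integral_distr[of "time_shift h" path_measure path_measure f] assms by (simp add: distr_shift)

lemma AE_shift: "AE x in path_measure. Q x \<Longrightarrow> AE x in path_measure. Q (time_shift h x)"
  using AE_distrD[of "time_shift h" path_measure path_measure Q] by (simp only: distr_shift measurable_shift)

definition cylinder :: "int set \<Rightarrow> (int \<Rightarrow> real set) \<Rightarrow> (int \<Rightarrow> real) set" where
  "cylinder J E = {x. \<forall>j\<in>J. x j \<in> E j}"

lemma cylinder_emb: "cylinder J E = prod_emb UNIV (\<lambda>_. \<mu>) J (Pi\<^sub>E J E)"
  by (auto simp: cylinder_def prod_emb_def PiE_def extensional_def Pi_def restrict_def)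

lemma cylinder_sets:
  assumes "finite J" "\<And>j. j \<in> J \<Longrightarrow> E j \<in> sets \<mu>"
  shows "cylinder J E \<in> sets path_measure"
  unfolding cylinder_emb path_measure_def using assms by (intro sets_PiM_I) auto

lemma measure_cylinder:
  assumes "finite J" "\<And>j. j \<in> J \<Longrightarrow> E j \<in> sets \<mu>"
  shows "measure path_measure (cylinder J E) = (\<Prod>j\<in>J. measure \<mu> (E j))"
  unfolding cylinder_emb path_measure_def using assms by (intro P.measure_PiM_emb) auto

text \<open>
  Two shifts of a cylinder that constrain disjoint sets of times intersect in a cylinder again, whose
  measure is the product.
\<close>

lemma cylinder_asymptotically_independent:
  assumes J: "finite J" "\<And>j. j \<in> J \<Longrightarrow> E j \<in> sets \<mu>"
    and disj: "\<And>i j. i \<in> J \<Longrightarrow> j \<in> J \<Longrightarrow> i + h \<noteq> j + k"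
  shows "(\<integral>x. indicator (cylinder J E) (time_shift h x) * indicator (cylinder J E) (time_shift k x) \<partial>path_measure)
       = (measure path_measure (cylinder J E))\<^sup>2"
proof -
  define F where "F = (\<lambda>i. if i - h \<in> J then E (i - h) else E (i - k))"
  define K where "K = (\<lambda>j. j + h) ` J \<union> (\<lambda>j. j + k) ` J"
  have nk: "j + k - h \<notin> J" if "j \<in> J" for j
    using disj[of "j + k - h" j] that by auto
  have F: "F (j + h) = E j" "F (j + k) = E j" if "j \<in> J" for j
    using nk that by (auto simp: F_def)
  have "indicator (cylinder J E) (time_shift h x) * indicator (cylinder J E) (time_shift k x)
      = (indicator (cylinder K F) x :: real)" for x
  proof -
    have "x \<in> cylinder K F \<longleftrightarrow> time_shift h x \<in> cylinder J E \<and> time_shift k x \<in> cylinder J E"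
      unfolding cylinder_def K_def time_shift_def by (auto simp: F ball_Un)
    then show ?thesis by (auto simp: indicator_def)
  qed
  moreover have Kf: "finite K" "\<And>i. i \<in> K \<Longrightarrow> F i \<in> sets \<mu>" using J F by (auto simp: K_def)
  ultimately have "(\<integral>x. indicator (cylinder J E) (time_shift h x) * indicator (cylinder J E) (time_shift k x) \<partial>path_measure)
      = measure path_measure (cylinder K F)" by simp
  also have "\<dots> = (\<Prod>i\<in>K. measure \<mu> (F i))" by (rule measure_cylinder[OF Kf])
  also have "\<dots> = (\<Prod>i\<in>(\<lambda>j. j + h) ` J. measure \<mu> (F i)) * (\<Prod>i\<in>(\<lambda>j. j + k) ` J. measure \<mu> (F i))"
    unfolding K_def using J disj by (intro prod.union_disjoint) auto
  also have "\<dots> = (\<Prod>j\<in>J. measure \<mu> (E j)) * (\<Prod>j\<in>J. measure \<mu> (E j))"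
    by (simp add: prod.reindex inj_on_def F)
  also have "\<dots> = (measure path_measure (cylinder J E))\<^sup>2"
    using measure_cylinder[OF J] by (simp add: power2_eq_square)
  finally show ?thesis .
qed

text \<open>
  Among the $n^2$ covariances of the shifted indicators only $O(n)$ do not vanish, so the average
  converges in the mean square.
\<close>

lemma cylinder_average_converges:
  assumes J: "finite J" "\<And>j. j \<in> J \<Longrightarrow> E j \<in> sets \<mu>"
  shows "N.ergodic_average_converges (indicator (cylinder J E))"
proof (rule N.ergodic_average_converges_bounded)
  define A where "A = cylinder J E"
  have A[measurable]: "A \<in> sets path_measure" unfolding A_def using J by (rule cylinder_sets)
  show "indicator (cylinder J E) \<in> borel_measurable path_measure" using A unfolding A_def by measurable
  show "\<bar>indicator (cylinder J E) x\<bar> \<le> (1::real)" for x by (auto simp: indicator_def)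
  fix \<eta> :: real assume \<eta>: "0 < \<eta>"
  define p where "p = measure path_measure A"
  have p: "0 \<le> p" "p \<le> 1" by (auto simp: p_def)
  define a where "a i x = (indicator A (time_shift (int i) x) :: real)" for i x
  have a[measurable]: "a i \<in> borel_measurable path_measure" for i
    unfolding a_def by measurable
  have a01: "0 \<le> a i x" "a i x \<le> 1" for i x by (auto simp: a_def indicator_def)
  have ai: "integrable path_measure (a i)" for i
    by (rule N.integrable_const_bound[of _ 1]) (use a01 in auto)
  have aai: "integrable path_measure (\<lambda>x. a i x * a j x)" for i j
    by (rule N.integrable_const_bound[of _ 1]) (use a01 in \<open>auto simp: abs_mult intro!: mult_le_one AE_I2\<close>)
  have Ea: "(\<integral>x. a i x \<partial>path_measure) = p" for i
    unfolding a_def using integral_shift[of "indicator A" "int i"] by (simp add: p_def)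
  obtain m where m: "\<And>i. i \<in> J \<Longrightarrow> \<bar>i\<bar> < int m"
  proof -
    have "finite ((\<lambda>i. nat \<bar>i\<bar>) ` J)" using J by auto
    then obtain m where "\<forall>k\<in>(\<lambda>i. nat \<bar>i\<bar>) ` J. k < m" using finite_nat_set_iff_bounded by blast
    then show ?thesis using that[of m] by force
  qed
  have cov: "(\<integral>x. (a i x - p) * (a j x - p) \<partial>path_measure) \<le> (if \<bar>int i - int j\<bar> < 2 * int m then 1 else 0)" for i j
  proof (cases "\<bar>int i - int j\<bar> < 2 * int m")
    case True
    have "(\<integral>x. (a i x - p) * (a j x - p) \<partial>path_measure) \<le> (\<integral>x. 1 \<partial>path_measure)"
    proof (rule integral_mono)
      show "integrable path_measure (\<lambda>x. (a i x - p) * (a j x - p))"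
        using aai ai by (simp add: algebra_simps)
      show "(a i x - p) * (a j x - p) \<le> 1" for x
      proof -
        have "\<bar>a i x - p\<bar> \<le> 1" "\<bar>a j x - p\<bar> \<le> 1" using a01[of i x] a01[of j x] p by (auto simp: abs_le_iff)
        then have "\<bar>(a i x - p) * (a j x - p)\<bar> \<le> 1" by (simp add: abs_mult mult_le_one)
        then show ?thesis by linarith
      qed
    qed auto
    then show ?thesis using True N.prob_space by simp
  next
    case False
    have "(\<integral>x. a i x * a j x \<partial>path_measure) = p\<^sup>2"
      unfolding a_def p_def A_def using J
    proof (rule cylinder_asymptotically_independent)
      fix r s assume "r \<in> J" "s \<in> J"
      then show "r + int i \<noteq> s + int j" using m[of r] m[of s] False by auto
    qed
    then have "(\<integral>x. (a i x - p) * (a j x - p) \<partial>path_measure) = 0"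
      using aai ai Ea by (simp add: algebra_simps N.prob_space power2_eq_square)
    then show ?thesis using False by simp
  qed
  \<comment> \<open>Chosen so that the variance bound $4 m / n$ is at most $\<eta>^2$.\<close>
  define n where "n = Suc (nat \<lceil>4 * real m / \<eta>\<^sup>2\<rceil>)"
  have n: "n \<ge> 1" "4 * real m / \<eta>\<^sup>2 \<le> real n" unfolding n_def by (auto, linarith)
  define S where "S x = (\<Sum>i<n. a i x - p)" for x
  have [measurable]: "S \<in> borel_measurable path_measure" unfolding S_def by measurable
  have Si: "integrable path_measure S" unfolding S_def using ai by auto
  have S2: "S x ^ 2 = (\<Sum>i<n. \<Sum>j<n. (a i x - p) * (a j x - p))" for x
    by (simp add: S_def power2_eq_square sum_product)
  have ii: "integrable path_measure (\<lambda>x. (a i x - p) * (a j x - p))" for i j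
    using aai ai by (simp add: algebra_simps)
  have "(\<integral>x. S x ^ 2 \<partial>path_measure) = (\<Sum>i<n. \<Sum>j<n. \<integral>x. (a i x - p) * (a j x - p) \<partial>path_measure)"
    unfolding S2 using ii by simp
  also have "\<dots> \<le> (\<Sum>i<n. \<Sum>j<n. (if \<bar>int i - int j\<bar> < 2 * int m then 1 else 0))"
    by (intro sum_mono cov)
  also have "\<dots> \<le> (\<Sum>i<n. 4 * real m)"
  proof (rule sum_mono)
    fix i assume "i \<in> {..<n}"
    have "(\<Sum>j<n. (if \<bar>int i - int j\<bar> < 2 * int m then 1 else 0)) = real (card {j. j < n \<and> \<bar>int i - int j\<bar> < 2 * int m})"
      by (simp add: sum.If_cases Int_def lessThan_def)
    also have "card {j. j < n \<and> \<bar>int i - int j\<bar> < 2 * int m} \<le> card {int i - 2 * int m<..<int i + 2 * int m}"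
      by (rule card_inj_on_le[of int]) auto
    then have "real (card {j. j < n \<and> \<bar>int i - int j\<bar> < 2 * int m}) \<le> 4 * real m" by simp
    finally show "(\<Sum>j<n. (if \<bar>int i - int j\<bar> < 2 * int m then 1 else 0)) \<le> 4 * real m" .
  qed
  finally have var: "(\<integral>x. S x ^ 2 \<partial>path_measure) \<le> real n * (4 * real m)" by simp
  have S2i: "integrable path_measure (\<lambda>x. S x ^ 2)" unfolding S2 using ii by auto
  have "(\<integral>x. \<bar>S x / real n\<bar> \<partial>path_measure) \<le> (\<integral>x. \<eta> / 2 + S x ^ 2 / (2 * \<eta> * (real n)\<^sup>2) \<partial>path_measure)"
  proof (rule integral_mono)
    show "\<bar>S x / real n\<bar> \<le> \<eta> / 2 + S x ^ 2 / (2 * \<eta> * (real n)\<^sup>2)" for x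
    proof -
      have "0 \<le> (\<bar>S x / real n\<bar> - \<eta>)\<^sup>2" by simp
      then have "2 * \<eta> * \<bar>S x / real n\<bar> \<le> \<eta>\<^sup>2 + (S x / real n)\<^sup>2"
        by (simp only: power2_diff power2_abs) (simp add: algebra_simps)
      then have "\<bar>S x / real n\<bar> \<le> (\<eta>\<^sup>2 + (S x / real n)\<^sup>2) / (2 * \<eta>)"
        using \<eta> by (simp add: pos_le_divide_eq mult.commute)
      also have "\<dots> = \<eta> / 2 + S x ^ 2 / (2 * \<eta> * (real n)\<^sup>2)"
        using \<eta> n(1) by (simp add: field_simps power2_eq_square)
      finally show ?thesis .
    qed
  qed (use Si S2i in auto)
  also have "\<dots> = \<eta> / 2 + (\<integral>x. S x ^ 2 \<partial>path_measure) / (2 * \<eta> * (real n)\<^sup>2)"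
    using S2i by (simp add: N.prob_space)
  also have "\<dots> \<le> \<eta> / 2 + real n * (4 * real m) / (2 * \<eta> * (real n)\<^sup>2)"
    using var \<eta> by (intro add_mono divide_right_mono) auto
  also have "\<dots> = \<eta> / 2 + (4 * real m / \<eta>\<^sup>2) * \<eta> / (2 * real n)"
    using \<eta> n(1) by (simp add: field_simps power2_eq_square)
  also have "\<dots> \<le> \<eta> / 2 + real n * \<eta> / (2 * real n)"
    using \<eta> n by (intro add_mono divide_right_mono mult_right_mono) auto
  also have "\<dots> = \<eta>" using n(1) by simp
  finally have L1: "(\<integral>x. \<bar>S x / real n\<bar> \<partial>path_measure) \<le> \<eta>" .
  have "(\<integral>x. indicator A x \<partial>path_measure) = p" by (simp add: p_def)
  moreover have "N.ergodic_sum (indicator A) n x / real n - p = S x / real n" for x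
    using n(1) by (simp add: N.ergodic_sum_def S_def sum_subtractf funpow_shift a_def field_simps)
  ultimately show "\<exists>n\<ge>1. (\<integral>x. \<bar>N.ergodic_sum (indicator (cylinder J E)) n x / real n
      - (\<integral>x. indicator (cylinder J E) x \<partial>path_measure)\<bar> \<partial>path_measure) \<le> \<eta>"
    using L1 n(1) unfolding A_def by (intro exI[of _ n]) simp
qed

lemma ergodic_theorem:
  assumes "integrable path_measure f"
  shows "N.ergodic_average_converges f"
proof (rule N.ergodic_theorem_from_generator[OF _ _ _ _ assms])
  show "Int_stable (prod_algebra UNIV (\<lambda>_::int. \<mu>))" by (rule Int_stable_prod_algebra)
  show "prod_algebra UNIV (\<lambda>_::int. \<mu>) \<subseteq> Pow (space path_measure)" by simp
  show "sets path_measure = sigma_sets (space path_measure) (prod_algebra UNIV (\<lambda>_::int. \<mu>))"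
    by (simp add: path_measure_def sets_PiM space_PiM)
  fix A assume "A \<in> prod_algebra UNIV (\<lambda>_::int. \<mu>)"
  then obtain J E where "A = prod_emb UNIV (\<lambda>_. \<mu>) J (Pi\<^sub>E J E)" "finite J" "\<And>j. j \<in> J \<Longrightarrow> E j \<in> sets \<mu>"
    by (elim prod_algebraE) auto
  then show "N.ergodic_average_converges (indicator A)"
    using cylinder_average_converges[of J E] by (simp add: cylinder_emb)
qed

lemma time_average_converges:
  assumes f: "integrable path_measure f"
  shows "AE x in path_measure. (\<lambda>n. (\<Sum>t=1..int n. f (time_shift t x)) / real n) \<longlonglongrightarrow> (\<integral>x. f x \<partial>path_measure)"
proof -
  have "AE x in path_measure. (\<lambda>n. N.ergodic_sum (\<lambda>x. f (time_shift 1 x)) n x / real n) \<longlonglongrightarrow> (\<integral>x. f (time_shift 1 x) \<partial>path_measure)"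
    using ergodic_theorem[OF integrable_shift[OF f, of 1]] by (auto simp: N.ergodic_average_converges_def)
  moreover have "N.ergodic_sum (\<lambda>x. f (time_shift 1 x)) n x = (\<Sum>t=1..int n. f (time_shift t x))" for n x
    unfolding N.ergodic_sum_def funpow_shift shift_shift
    by (rule sum.reindex_bij_witness[of _ "\<lambda>t. nat (t - 1)" "\<lambda>i. 1 + int i"]) auto
  ultimately show ?thesis using f by (simp add: integral_shift)
qed

end

section \<open>Limits in the mean square\<close>

lemma square_integrable_mult:
  assumes "square_integrable M f" "square_integrable M g"
  shows "integrable M (\<lambda>x. f x * g x)"
proof (rule Bochner_Integration.integrable_bound)
  show "integrable M (\<lambda>x. (f x)\<^sup>2 + (g x)\<^sup>2)" "(\<lambda>x. f x * g x) \<in> borel_measurable M"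
    using assms by (auto simp: square_integrable_def)
  show "AE x in M. norm (f x * g x) \<le> norm ((f x)\<^sup>2 + (g x)\<^sup>2)"
  proof (rule AE_I2)
    fix x
    have "2 * (\<bar>f x\<bar> * \<bar>g x\<bar>) \<le> (f x)\<^sup>2 + (g x)\<^sup>2"
      using sum_squares_bound[of "\<bar>f x\<bar>" "\<bar>g x\<bar>"] by (simp add: mult.assoc)
    moreover have "0 \<le> \<bar>f x\<bar> * \<bar>g x\<bar>" by simp
    ultimately show "norm (f x * g x) \<le> norm ((f x)\<^sup>2 + (g x)\<^sup>2)"
      by (simp only: real_norm_def abs_mult)
  qed
qed

lemma square_integrable_add:
  assumes "square_integrable M f" "square_integrable M g"
  shows "square_integrable M (\<lambda>x. f x + g x)"
  using assms square_integrable_mult[OF assms]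
  by (auto simp: square_integrable_def power2_sum mult.assoc)

lemma square_integrable_scale:
  assumes "square_integrable M f"
  shows "square_integrable M (\<lambda>x. c * f x)"
  using assms by (auto simp: square_integrable_def power_mult_distrib)

lemma square_integrable_diff:
  assumes "square_integrable M f" "square_integrable M g"
  shows "square_integrable M (\<lambda>x. f x - g x)"
  using square_integrable_add[OF assms(1) square_integrable_scale[OF assms(2), of "-1"]] by simp

lemma square_integrable_sum:
  assumes "\<And>i. i \<in> I \<Longrightarrow> square_integrable M (f i)"
  shows "square_integrable M (\<lambda>x. \<Sum>i\<in>I. f i x)"
  using assms
proof (induction I rule: infinite_finite_induct)
  case (insert i I)
  then have "square_integrable M (\<lambda>x. f i x + (\<Sum>i\<in>I. f i x))" by (intro square_integrable_add) auto
  then show ?case using insert by simp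
qed (auto simp: square_integrable_def)

lemma (in finite_measure) square_integrable_const: "square_integrable M (\<lambda>x. c)"
  by (simp add: square_integrable_def)

lemma (in finite_measure) square_integrable_imp_integrable:
  "square_integrable M f \<Longrightarrow> integrable M f"
  using square_integrable_mult[OF _ square_integrable_const[of 1]] by simp

lemma integral_square_add_le:
  assumes "square_integrable M u" "square_integrable M v"
  shows "(\<integral>x. (u x + v x)\<^sup>2 \<partial>M) \<le> 2 * (\<integral>x. (u x)\<^sup>2 \<partial>M) + 2 * (\<integral>x. (v x)\<^sup>2 \<partial>M)"
proof -
  have i: "integrable M (\<lambda>x. (u x + v x)\<^sup>2)" "integrable M (\<lambda>x. (u x)\<^sup>2)" "integrable M (\<lambda>x. (v x)\<^sup>2)"
    using assms square_integrable_add[OF assms] by (auto simp: square_integrable_def)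
  have "(\<integral>x. (u x + v x)\<^sup>2 \<partial>M) \<le> (\<integral>x. 2 * (u x)\<^sup>2 + 2 * (v x)\<^sup>2 \<partial>M)"
  proof (rule integral_mono)
    show "(u x + v x)\<^sup>2 \<le> 2 * (u x)\<^sup>2 + 2 * (v x)\<^sup>2" for x
      using sum_squares_bound[of "u x" "v x"] by (simp add: power2_sum)
  qed (use i in auto)
  then show ?thesis using i by simp
qed

lemma L2_distance_triangle:
  assumes "square_integrable M f" "square_integrable M g" "square_integrable M h"
  shows "(\<integral>x. (g x - h x)\<^sup>2 \<partial>M) \<le> 2 * (\<integral>x. (f x - g x)\<^sup>2 \<partial>M) + 2 * (\<integral>x. (f x - h x)\<^sup>2 \<partial>M)"
  using integral_square_add_le[of M "\<lambda>x. g x - f x" "\<lambda>x. f x - h x"] assms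
  by (simp add: square_integrable_diff power2_commute[of "g _" "f _"])

lemma integral_square_zero_AE_eq:
  assumes "square_integrable M g" "square_integrable M h" "(\<integral>x. (g x - h x)\<^sup>2 \<partial>M) \<le> 0"
  shows "AE x in M. g x = h x"
proof -
  have "integrable M (\<lambda>x. (g x - h x)\<^sup>2)"
    using square_integrable_diff[OF assms(1,2)] by (simp add: square_integrable_def)
  moreover have "(\<integral>x. (g x - h x)\<^sup>2 \<partial>M) = 0" using assms(3) by (intro antisym) auto
  ultimately have "AE x in M. (g x - h x)\<^sup>2 = 0" by (subst (asm) integral_nonneg_eq_0_iff_AE) auto
  then show ?thesis by eventually_elim simp
qed

lemma L2_tendsto_unique:
  assumes "L2_tendsto M f g F" "L2_tendsto M f h F" "F \<noteq> bot"
  shows "AE x in M. g x = h x"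
proof (rule integral_square_zero_AE_eq)
  show g: "square_integrable M g" and h: "square_integrable M h" using assms by (auto simp: L2_tendsto_def)
  have "((\<lambda>i. 2 * (\<integral>x. (f i x - g x)\<^sup>2 \<partial>M) + 2 * (\<integral>x. (f i x - h x)\<^sup>2 \<partial>M)) \<longlongrightarrow> 2 * 0 + 2 * 0) F"
    using assms by (intro tendsto_intros) (auto simp: L2_tendsto_def)
  moreover have "\<forall>\<^sub>F i in F. square_integrable M (f i)" using assms by (auto simp: L2_tendsto_def)
  then have "\<forall>\<^sub>F i in F. (\<integral>x. (g x - h x)\<^sup>2 \<partial>M) \<le> 2 * (\<integral>x. (f i x - g x)\<^sup>2 \<partial>M) + 2 * (\<integral>x. (f i x - h x)\<^sup>2 \<partial>M)"
    by eventually_elim (rule L2_distance_triangle[OF _ g h])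
  ultimately show "(\<integral>x. (g x - h x)\<^sup>2 \<partial>M) \<le> 0"
    using tendsto_lowerbound[OF _ _ assms(3)] by force
qed

lemma L2_tendsto_AE_subseq:
  assumes "L2_tendsto M f g sequentially"
  obtains r :: "nat \<Rightarrow> nat" where "strict_mono r" "AE x in M. (\<lambda>n. f (r n) x) \<longlonglongrightarrow> g x"
proof -
  obtain n0 where n0: "\<And>n. n \<ge> n0 \<Longrightarrow> square_integrable M (f n)"
    using assms by (auto simp: L2_tendsto_def eventually_sequentially)
  define u where "u n x = (f (n + n0) x - g x)\<^sup>2" for n x
  have "integrable M (u n)" for n
    using square_integrable_diff[of M "f (n + n0)" g] n0 assms
    unfolding u_def by (auto simp: L2_tendsto_def square_integrable_def)
  moreover have "(\<lambda>n. \<integral>x. norm (u n x) \<partial>M) \<longlonglongrightarrow> 0"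
    using LIMSEQ_ignore_initial_segment[of "\<lambda>n. \<integral>x. (f n x - g x)\<^sup>2 \<partial>M" 0 n0] assms
    by (simp add: u_def L2_tendsto_def)
  ultimately obtain r where r: "strict_mono r" "AE x in M. (\<lambda>n. u (r n) x) \<longlonglongrightarrow> 0"
    using tendsto_L1_AE_subseq by blast
  have "AE x in M. (\<lambda>n. f (r n + n0) x) \<longlonglongrightarrow> g x"
    using r(2)
  proof eventually_elim
    case (elim x)
    then have "(\<lambda>n. sqrt (u (r n) x)) \<longlonglongrightarrow> sqrt 0" by (intro tendsto_intros)
    then have "(\<lambda>n. \<bar>f (r n + n0) x - g x\<bar>) \<longlonglongrightarrow> 0" by (simp add: u_def)
    then show ?case by (simp add: tendsto_rabs_zero_iff LIM_zero_iff)
  qed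
  moreover have "strict_mono (\<lambda>n. r n + n0)" using r(1) by (auto simp: strict_mono_def)
  ultimately show ?thesis using that by blast
qed

lemma L2_tendsto_cong_AE:
  assumes "L2_tendsto M f g F" "\<And>i. AE x in M. f i x = f' i x" "\<And>i. f' i \<in> borel_measurable M"
    "AE x in M. g x = g' x" "g' \<in> borel_measurable M"
  shows "L2_tendsto M f' g' F"
proof -
  have sq: "square_integrable M h'" if "square_integrable M h" "AE x in M. h x = h' x" "h' \<in> borel_measurable M" for h h'
    unfolding square_integrable_def
  proof
    have [measurable]: "h' \<in> borel_measurable M" "h \<in> borel_measurable M" using that by (auto simp: square_integrable_def)
    have "integrable M (\<lambda>x. (h x)\<^sup>2) = integrable M (\<lambda>x. (h' x)\<^sup>2)"
      using that(2) by (intro integrable_cong_AE) auto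
    then show "integrable M (\<lambda>x. (h' x)\<^sup>2)" using that by (auto simp: square_integrable_def)
  qed fact
  have 1: "square_integrable M g'" using sq assms by (auto simp: L2_tendsto_def)
  have "\<forall>\<^sub>F i in F. square_integrable M (f i)" using assms by (auto simp: L2_tendsto_def)
  then have 2: "\<forall>\<^sub>F i in F. square_integrable M (f' i)"
    by eventually_elim (rule sq[OF _ assms(2,3)])
  have "\<forall>\<^sub>F i in F. square_integrable M (f i)" using assms by (auto simp: L2_tendsto_def)
  then have "\<forall>\<^sub>F i in F. (\<integral>x. (f i x - g x)\<^sup>2 \<partial>M) = (\<integral>x. (f' i x - g' x)\<^sup>2 \<partial>M)"
  proof eventually_elim
    case (elim i)
    have [measurable]: "f i \<in> borel_measurable M" "g \<in> borel_measurable M" "f' i \<in> borel_measurable M" "g' \<in> borel_measurable M"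
      using elim assms by (auto simp: L2_tendsto_def square_integrable_def)
    show ?case
      using assms(2)[of i] assms(4) by (intro integral_cong_AE) (measurable, auto)
  qed
  then have "((\<lambda>i. \<integral>x. (f' i x - g' x)\<^sup>2 \<partial>M) \<longlongrightarrow> 0) F"
    using assms(1) by (auto simp: L2_tendsto_def elim: Lim_transform_eventually)
  then show ?thesis using 1 2 by (simp add: L2_tendsto_def)
qed

lemma L2_tendsto_add:
  assumes "L2_tendsto M f g F" "L2_tendsto M f' g' F"
  shows "L2_tendsto M (\<lambda>i x. f i x + f' i x) (\<lambda>x. g x + g' x) F"
proof -
  have sg: "square_integrable M g" "square_integrable M g'" using assms by (auto simp: L2_tendsto_def)
  have ev: "\<forall>\<^sub>F i in F. square_integrable M (f i) \<and> square_integrable M (f' i)"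
    using assms by (auto simp: L2_tendsto_def eventually_conj_iff)
  have "((\<lambda>i. \<integral>x. (f i x + f' i x - (g x + g' x))\<^sup>2 \<partial>M) \<longlongrightarrow> 0) F"
  proof (rule tendsto_sandwich[OF _ _ tendsto_const])
    show "((\<lambda>i. 2 * (\<integral>x. (f i x - g x)\<^sup>2 \<partial>M) + 2 * (\<integral>x. (f' i x - g' x)\<^sup>2 \<partial>M)) \<longlongrightarrow> 0) F"
      using assms by (auto simp: L2_tendsto_def intro!: tendsto_eq_intros)
    show "\<forall>\<^sub>F i in F. (\<integral>x. (f i x + f' i x - (g x + g' x))\<^sup>2 \<partial>M)
        \<le> 2 * (\<integral>x. (f i x - g x)\<^sup>2 \<partial>M) + 2 * (\<integral>x. (f' i x - g' x)\<^sup>2 \<partial>M)"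
      using ev
    proof eventually_elim
      case (elim i)
      then have "square_integrable M (\<lambda>x. f i x - g x)" "square_integrable M (\<lambda>x. f' i x - g' x)"
        using sg by (auto intro: square_integrable_diff)
      from integral_square_add_le[OF this] show ?case by (simp add: algebra_simps)
    qed
  qed simp
  then show ?thesis
    using sg ev by (auto simp: L2_tendsto_def intro: square_integrable_add elim: eventually_mono)
qed


lemma L2_tendsto_scale:
  assumes "L2_tendsto M f g F"
  shows "L2_tendsto M (\<lambda>i x. c * f i x) (\<lambda>x. c * g x) F"
proof -
  have "((\<lambda>i. c\<^sup>2 * (\<integral>x. (f i x - g x)\<^sup>2 \<partial>M)) \<longlongrightarrow> c\<^sup>2 * 0) F"
    using assms by (intro tendsto_intros) (auto simp: L2_tendsto_def)
  moreover have "c\<^sup>2 * (\<integral>x. (f i x - g x)\<^sup>2 \<partial>M) = (\<integral>x. (c * f i x - c * g x)\<^sup>2 \<partial>M)" for i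
    by (subst integral_mult_right_zero[symmetric]) (simp only: right_diff_distrib[symmetric] power_mult_distrib)
  ultimately show ?thesis
    using assms by (auto simp: L2_tendsto_def intro: square_integrable_scale elim: eventually_mono)
qed

lemma L2_tendsto_compose:
  assumes "L2_tendsto M f g F" "filterlim h F G"
  shows "L2_tendsto M (\<lambda>i. f (h i)) g G"
  using assms eventually_compose_filterlim[of _ F h G] filterlim_compose[of _ _ F h G]
  unfolding L2_tendsto_def by blast

lemma L2_tendsto_distr:
  assumes E: "E \<in> M \<rightarrow>\<^sub>M N" "distr M N E = N" and f: "\<And>i. f i \<in> borel_measurable N" and g: "g \<in> borel_measurable N"
  shows "L2_tendsto M (\<lambda>i x. f i (E x)) (\<lambda>x. g (E x)) F \<longleftrightarrow> L2_tendsto N f g F"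
proof -
  have sq: "square_integrable M (\<lambda>x. h (E x)) \<longleftrightarrow> square_integrable N h" if "h \<in> borel_measurable N" for h
    using integrable_distr_eq[OF E(1), of "\<lambda>x. (h x)\<^sup>2"] that E
    unfolding square_integrable_def by (auto intro: measurable_compose)
  moreover have "(\<integral>x. (f i (E x) - g (E x))\<^sup>2 \<partial>M) = (\<integral>x. (f i x - g x)\<^sup>2 \<partial>N)" for i
    using integral_distr[OF E(1), of "\<lambda>x. (f i x - g x)\<^sup>2"] f g E(2) by simp
  ultimately show ?thesis using f g by (simp add: L2_tendsto_def)
qed

section \<open>Functionals of the noise as mean square limits\<close>

lemma depends_on_sum: "(\<And>i. i \<in> I \<Longrightarrow> depends_on K (f i)) \<Longrightarrow> depends_on K (\<lambda>x. \<Sum>i\<in>I. f i x)"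
  unfolding depends_on_def by (auto intro!: sum.cong)

lemma depends_on_suminf: "(\<And>i. depends_on K (f i)) \<Longrightarrow> depends_on K (\<lambda>x. \<Sum>i. f i x)"
  unfolding depends_on_def by (auto intro!: suminf_cong)

lemma depends_on_comp2: "depends_on K f \<Longrightarrow> depends_on K g \<Longrightarrow> depends_on K (\<lambda>x. h (f x) (g x))"
  unfolding depends_on_def by (intro allI impI arg_cong2[of _ _ _ _ h]) auto

lemma depends_on_comp: "depends_on K f \<Longrightarrow> depends_on K (\<lambda>x. h (f x))"
  using depends_on_comp2[of K f f "\<lambda>y _. h y"] by simp

lemma depends_on_scale: "depends_on K f \<Longrightarrow> depends_on K (\<lambda>x. (c::real) * f x)"
  by (rule depends_on_comp)

lemma depends_on_coord: "i \<in> K \<Longrightarrow> depends_on K (\<lambda>x. x i)"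
  by (simp add: depends_on_def)

context noise
begin

lemma depends_on_lim:
  assumes "\<And>n. depends_on K (g n)"
  shows "depends_on K (\<lambda>x. lim (\<lambda>n. g n x))"
  unfolding depends_on_def
proof (intro allI impI)
  fix x y :: "int \<Rightarrow> real" assume "\<forall>i\<in>K. x i = y i"
  then have "(\<lambda>n. g n x) = (\<lambda>n. g n y)" using assms unfolding depends_on_def by blast
  then show "lim (\<lambda>n. g n x) = lim (\<lambda>n. g n y)" by simp
qed

text \<open>
  Along a subsequence the functionals \<open>g n\<close> converge at almost every path that occurs, and their
  pointwise limit is the functional sought.
\<close>

lemma L2_limit_factors:
  assumes E: "E \<in> M \<rightarrow>\<^sub>M path_measure"
    and g: "\<And>n. g n \<in> borel_measurable path_measure" "\<And>n. depends_on K (g n)"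
    and lim: "L2_tendsto M (\<lambda>n \<omega>. g n (E \<omega>)) Y sequentially"
  obtains F where "F \<in> borel_measurable path_measure" "depends_on K F" "AE \<omega> in M. Y \<omega> = F (E \<omega>)"
proof -
  obtain r :: "nat \<Rightarrow> nat" where r: "AE \<omega> in M. (\<lambda>n. g (r n) (E \<omega>)) \<longlonglongrightarrow> Y \<omega>"
    using L2_tendsto_AE_subseq[OF lim] by blast
  define F where "F x = lim (\<lambda>n. g (r n) x)" for x
  have "F \<in> borel_measurable path_measure"
    unfolding F_def using g by (intro borel_measurable_lim_metric)
  moreover have "depends_on K F" unfolding F_def by (intro depends_on_lim g)
  moreover have "AE \<omega> in M. Y \<omega> = F (E \<omega>)"
    using r by eventually_elim (simp add: F_def limI)
  ultimately show ?thesis using that by blast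
qed

text \<open>
  One functional serves all times: the functional found at time 0 is the mean square limit of the \<open>g n\<close>
  on path space, a property that the shift preserves, and limits in the mean square are unique.
\<close>

lemma stationary_L2_limit_factors:
  assumes E: "E \<in> M \<rightarrow>\<^sub>M path_measure" "distr M path_measure E = path_measure"
    and g: "\<And>n. g n \<in> borel_measurable path_measure" "\<And>n. depends_on K (g n)"
    and lim: "\<And>t. L2_tendsto M (\<lambda>n \<omega>. g n (time_shift t (E \<omega>))) (Y t) sequentially"
  obtains F where "F \<in> borel_measurable path_measure" "depends_on K F"
    "\<And>t. AE \<omega> in M. Y t \<omega> = F (time_shift t (E \<omega>))" "L2_tendsto path_measure g F sequentially"
proof -
  have "L2_tendsto M (\<lambda>n \<omega>. g n (E \<omega>)) (Y 0) sequentially" using lim[of 0] by simp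
  with E(1) g obtain F where F: "F \<in> borel_measurable path_measure" "depends_on K F"
    "AE \<omega> in M. Y 0 \<omega> = F (E \<omega>)" by (rule L2_limit_factors)
  have "L2_tendsto M (\<lambda>n \<omega>. g n (E \<omega>)) (\<lambda>\<omega>. F (E \<omega>)) sequentially"
    by (rule L2_tendsto_cong_AE[OF lim[of 0]]) (use F g E in \<open>auto intro: measurable_compose\<close>)
  then have gF: "L2_tendsto path_measure g F sequentially"
    using L2_tendsto_distr[OF E, of g F sequentially] F g by simp
  have "AE \<omega> in M. Y t \<omega> = F (time_shift t (E \<omega>))" for t
  proof (rule L2_tendsto_unique[OF lim])
    have "L2_tendsto path_measure (\<lambda>n x. g n (time_shift t x)) (\<lambda>x. F (time_shift t x)) sequentially"
      using L2_tendsto_distr[OF measurable_shift distr_shift, of g F t sequentially] F g gF by simp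
    then show "L2_tendsto M (\<lambda>n \<omega>. g n (time_shift t (E \<omega>))) (\<lambda>\<omega>. F (time_shift t (E \<omega>))) sequentially"
      using L2_tendsto_distr[OF E, of "\<lambda>n x. g n (time_shift t x)" "\<lambda>x. F (time_shift t x)" sequentially] F g by simp
  qed simp
  then show ?thesis using that F gF by blast
qed

lemma distr_coord: "distr path_measure borel (\<lambda>x. x k) = \<mu>"
proof -
  have "distr path_measure borel (\<lambda>x. x k) = distr (Pi\<^sub>M UNIV (\<lambda>_. \<mu>)) \<mu> (\<lambda>x. x k)"
    unfolding path_measure_def by (rule distr_cong) (auto simp: sets_\<mu>)
  then show ?thesis using P.PiM_component[of k] by simp
qed

text \<open>
  A function of the coordinates in \<open>K\<close> factors measurably through the restriction to \<open>K\<close>: extend the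
  restricted path by 0.
\<close>

lemma indep_coord:
  assumes f: "f \<in> borel_measurable path_measure" and d: "depends_on K f" and k: "k \<notin> K"
  shows "N.indep_var borel (\<lambda>x. x k) borel f"
proof -
  have c: "path_measure = (\<Pi>\<^sub>M i\<in>UNIV. distr path_measure borel (\<lambda>x. x i))"
    unfolding distr_coord by (simp add: path_measure_def)
  have sb: "sets (Pi\<^sub>M UNIV (\<lambda>_::int. borel :: real measure)) = sets path_measure"
    unfolding path_measure_def by (intro sets_PiM_cong) (auto simp: sets_\<mu>)
  have "N.indep_vars (\<lambda>_. borel) (\<lambda>i x. x i) UNIV"
  proof (subst N.indep_vars_iff_distr_eq_PiM)
    have "distr path_measure (Pi\<^sub>M UNIV (\<lambda>_. borel)) (\<lambda>x. \<lambda>i\<in>UNIV. x i) = distr path_measure path_measure (\<lambda>x. x)"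
      by (rule distr_cong) (auto simp: sb)
    then show "distr path_measure (Pi\<^sub>M UNIV (\<lambda>_. borel)) (\<lambda>x. \<lambda>i\<in>UNIV. x i) = (\<Pi>\<^sub>M i\<in>UNIV. distr path_measure borel (\<lambda>x. x i))"
      using c by (simp add: distr_id)
  qed auto
  then have ind: "N.indep_var (PiM {k} (\<lambda>_. borel)) (\<lambda>x. restrict (\<lambda>i. x i) {k}) (PiM K (\<lambda>_. borel)) (\<lambda>x. restrict (\<lambda>i. x i) K)"
    by (rule N.indep_var_restrict) (use k in auto)
  define ext where "ext z = (\<lambda>i. if i \<in> K then z i else 0 :: real)" for z
  have [measurable]: "ext \<in> PiM K (\<lambda>_. borel) \<rightarrow>\<^sub>M path_measure"
  proof -
    have "ext \<in> PiM K (\<lambda>_. borel) \<rightarrow>\<^sub>M PiM UNIV (\<lambda>_. borel)"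
    proof (rule measurable_PiM_single')
      show "(\<lambda>z. ext z i) \<in> borel_measurable (PiM K (\<lambda>_. borel))" for i
        unfolding ext_def by (cases "i \<in> K") auto
    qed (auto simp: space_PiM PiE_UNIV_domain)
    then show ?thesis using measurable_cong_sets[OF refl sb] by blast
  qed
  have "N.indep_var borel ((\<lambda>z. z k) \<circ> (\<lambda>x. restrict (\<lambda>i. x i) {k})) borel ((\<lambda>z. f (ext z)) \<circ> (\<lambda>x. restrict (\<lambda>i. x i) K))"
    by (rule N.indep_var_compose[OF ind]) (use f in auto)
  moreover have "(\<lambda>z. f (ext z)) \<circ> (\<lambda>x. restrict (\<lambda>i. x i) K) = f"
  proof
    fix x show "((\<lambda>z. f (ext z)) \<circ> (\<lambda>x. restrict (\<lambda>i. x i) K)) x = f x"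
      using d by (auto simp: depends_on_def ext_def)
  qed
  ultimately show ?thesis by (simp add: o_def)
qed

end

locale white_noise = noise +
  assumes integrable_id: "integrable \<mu> (\<lambda>y. y)" and mean_zero: "(\<integral>y. y \<partial>\<mu>) = 0"
    and integrable_square: "integrable \<mu> (\<lambda>y. y\<^sup>2)" and unit_variance: "(\<integral>y. y\<^sup>2 \<partial>\<mu>) = 1"
    and atomless: "measure \<mu> {y} = 0"
begin

lemma coord_mult:
  assumes f: "integrable path_measure f" and d: "depends_on K f" and k: "k \<notin> K"
  shows "(\<integral>x. x k * f x \<partial>path_measure) = 0"
    and "integrable path_measure (\<lambda>x. (x k)\<^sup>2 * f x)"
    and "(\<integral>x. (x k)\<^sup>2 * f x \<partial>path_measure) = (\<integral>x. f x \<partial>path_measure)"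
proof -
  have i: "N.indep_var borel (\<lambda>x. x k) borel f" by (rule indep_coord[OF borel_measurable_integrable[OF f] d k])
  have i2: "N.indep_var borel (\<lambda>x. (x k)\<^sup>2) borel f"
    by (rule N.indep_var_compose[OF i, of "\<lambda>y. y\<^sup>2" borel "\<lambda>y. y" borel, unfolded comp_def]) auto
  have tr: "integrable path_measure (\<lambda>x. h (x k))" "(\<integral>x. h (x k) \<partial>path_measure) = (\<integral>y. h y \<partial>\<mu>)"
    if "integrable \<mu> h" for h :: "real \<Rightarrow> real"
  proof -
    have "integrable (distr path_measure borel (\<lambda>x. x k)) h" by (simp only: distr_coord that)
    then show "integrable path_measure (\<lambda>x. h (x k))" by (rule integrable_distr[rotated]) (rule measurable_coord)
    have "h \<in> borel_measurable borel"
      using borel_measurable_integrable[OF that] measurable_cong_sets[OF sets_\<mu> refl] by blast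
    from integral_distr[OF measurable_coord this]
    show "(\<integral>x. h (x k) \<partial>path_measure) = (\<integral>y. h y \<partial>\<mu>)" unfolding distr_coord by (rule sym)
  qed
  have c1: "integrable path_measure (\<lambda>x. x k)" "(\<integral>x. x k \<partial>path_measure) = 0"
    using tr[OF integrable_id] unfolding mean_zero .
  have c2: "integrable path_measure (\<lambda>x. (x k)\<^sup>2)" "(\<integral>x. (x k)\<^sup>2 \<partial>path_measure) = 1"
    using tr[OF integrable_square] unfolding unit_variance .
  show "(\<integral>x. x k * f x \<partial>path_measure) = 0"
    unfolding N.indep_var_lebesgue_integral[OF i c1(1) f] c1(2) by simp
  show "integrable path_measure (\<lambda>x. (x k)\<^sup>2 * f x)" by (rule N.indep_var_integrable[OF i2 c2(1) f])
  show "(\<integral>x. (x k)\<^sup>2 * f x \<partial>path_measure) = (\<integral>x. f x \<partial>path_measure)"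
    unfolding N.indep_var_lebesgue_integral[OF i2 c2(1) f] c2(2) by simp
qed

text \<open>
  Fubini: given \<open>W\<close>, which is independent of coordinate \<open>k\<close>, the event has probability 0 as the noise
  has no atoms.
\<close>

lemma coord_neq:
  assumes W[measurable]: "W \<in> borel_measurable path_measure" and d: "depends_on K W" and k: "k \<notin> K"
  shows "AE x in path_measure. x k \<noteq> W x"
proof -
  \<comment> \<open>The law of the pair is a product measure.\<close>
  define \<nu> where "\<nu> = distr path_measure borel W"
  interpret \<nu>: prob_space \<nu> unfolding \<nu>_def by (rule N.prob_space_distr) simp
  interpret pair_sigma_finite \<nu> \<mu> ..
  have s\<nu>: "sets \<nu> = sets borel" by (simp add: \<nu>_def)
  have eq: "\<mu> \<Otimes>\<^sub>M \<nu> = distr path_measure (borel \<Otimes>\<^sub>M borel) (\<lambda>x. (x k, W x))"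
    using indep_coord[OF W d k] unfolding N.indep_var_distribution_eq \<nu>_def distr_coord by simp
  interpret Q: pair_sigma_finite \<mu> \<nu> ..
  have m: "{z \<in> space (\<mu> \<Otimes>\<^sub>M \<nu>). fst z \<noteq> snd z} \<in> sets (\<mu> \<Otimes>\<^sub>M \<nu>)"
  proof -
    have [measurable]: "fst \<in> borel_measurable (\<mu> \<Otimes>\<^sub>M \<nu>)" "snd \<in> borel_measurable (\<mu> \<Otimes>\<^sub>M \<nu>)"
      using measurable_fst[of \<mu> \<nu>] measurable_snd[of \<mu> \<nu>] measurable_cong_sets[OF refl sets_\<mu>] measurable_cong_sets[OF refl s\<nu>]
      by blast+
    show ?thesis by measurable
  qed
  have "AE w in \<nu>. AE y in \<mu>. y \<noteq> w"
  proof (rule AE_I2)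
    fix w
    have "{w} \<in> null_sets \<mu>" using atomless[of w] by (auto simp: null_sets_def \<mu>.emeasure_eq_measure sets_\<mu>)
    from AE_not_in[OF this] show "AE y in \<mu>. y \<noteq> w" by simp
  qed
  then have "AE y in \<mu>. AE w in \<nu>. y \<noteq> w"
    using Q.AE_commute[of "\<lambda>y w. y \<noteq> w"] m by simp
  then have "AE z in \<mu> \<Otimes>\<^sub>M \<nu>. fst z \<noteq> snd z"
    using Q.AE_pair_measure[OF m] by simp
  then have "AE z in distr path_measure (borel \<Otimes>\<^sub>M borel) (\<lambda>x. (x k, W x)). fst z \<noteq> snd z" unfolding eq .
  from AE_distrD[OF _ this] show ?thesis by simp
qed

end

text \<open>
  The functional is obtained by two limits: for each order of the expansion over the finite sets of lag
  lists with lags up to \<open>n\<close>, then over the orders.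
\<close>

lemma (in noise) volterra_expansion_factors:
  assumes E: "(\<lambda>\<omega> t. \<epsilon> t \<omega>) \<in> M \<rightarrow>\<^sub>M path_measure" "distr M path_measure (\<lambda>\<omega> t. \<epsilon> t \<omega>) = path_measure"
    and V: "\<And>t. volterra_expansion M \<epsilon> b a t (\<sigma> t)"
  obtains \<phi> where "\<phi> \<in> borel_measurable path_measure" "depends_on {..<0} \<phi>"
    "\<And>t. AE \<omega> in M. \<sigma> t \<omega> = \<phi> (time_shift t (\<lambda>i. \<epsilon> i \<omega>))"
proof -
  define monomial where "monomial js x = volterra_term (\<lambda>i x. x i) b 0 js x" for js and x :: "int \<Rightarrow> real"
  have [measurable]: "monomial js \<in> borel_measurable path_measure" for js
    unfolding monomial_def[abs_def] volterra_term_def by measurable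
  have monomial_shift: "volterra_term \<epsilon> b t js \<omega> = monomial js (time_shift t (\<lambda>i. \<epsilon> i \<omega>))" for t js \<omega>
    by (simp add: monomial_def volterra_term_def time_shift_def add.commute)
  have monomial_dep: "depends_on {..<0} (monomial js)" if js: "\<forall>j\<in>set js. j \<ge> 1" for js
    unfolding depends_on_def
  proof (intro allI impI)
    fix x y :: "int \<Rightarrow> real" assume xy: "\<forall>i\<in>{..<0}. x i = y i"
    have "0 < sum_list (take (Suc i) js)" if "i < length js" for i
    proof (cases js)
      case (Cons j js')
      then show ?thesis using js by simp
    qed (use that in simp)
    then show "monomial js x = monomial js y"
      unfolding monomial_def volterra_term_def using xy by (intro arg_cong2[of _ _ _ _ "(*)"] prod.cong) auto
  qed
  have "\<forall>t. \<exists>W. (\<forall>k\<ge>1. L2_has_sum M (volterra_term \<epsilon> b t) {js. length js = k \<and> (\<forall>j\<in>set js. j \<ge> 1)} (W k)) \<and>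
      L2_sums M (\<lambda>k \<omega>. a * W (Suc k) \<omega>) (\<lambda>\<omega>. \<sigma> t \<omega> - a)"
    using V unfolding volterra_expansion_def by (rule allI)
  from choice[OF this] obtain V where V1: "\<And>t k. k \<ge> 1 \<Longrightarrow> L2_has_sum M (volterra_term \<epsilon> b t) {js. length js = k \<and> (\<forall>j\<in>set js. j \<ge> 1)} (V t k)"
    and V2: "\<And>t. L2_sums M (\<lambda>k \<omega>. a * V t (Suc k) \<omega>) (\<lambda>\<omega>. \<sigma> t \<omega> - a)"
    by blast
  define lags where "lags k n = {js. length js = k \<and> (\<forall>j\<in>set js. 1 \<le> j \<and> j \<le> n)}" for k n :: nat
  have lags_finite: "finite (lags k n)" for k n
    by (rule finite_subset[OF _ finite_lists_length_eq[of "{..n}" k]]) (auto simp: lags_def)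
  have lags_filter: "filterlim (lags k) (finite_subsets_at_top {js. length js = k \<and> (\<forall>j\<in>set js. j \<ge> 1)}) sequentially" for k :: nat
    unfolding filterlim_def le_filter_def eventually_filtermap
  proof (intro allI impI)
    fix P :: "nat list set \<Rightarrow> bool"
    assume "eventually P (finite_subsets_at_top {js. length js = k \<and> (\<forall>j\<in>set js. j \<ge> 1)})"
    then obtain Y :: "nat list set" where Y: "finite Y" "Y \<subseteq> {js. length js = k \<and> (\<forall>j\<in>set js. j \<ge> 1)}"
      "\<And>Z. finite Z \<and> Y \<subseteq> Z \<and> Z \<subseteq> {js. length js = k \<and> (\<forall>j\<in>set js. j \<ge> 1)} \<Longrightarrow> P Z"
      unfolding eventually_finite_subsets_at_top by meson
    define m where "m = Max (insert 0 (\<Union>js\<in>Y. set js))"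
    have "finite (\<Union>js\<in>Y. set js)" using Y(1) by auto
    then have "j \<le> m" if "js \<in> Y" "j \<in> set js" for j js
      unfolding m_def using that by (intro Max_ge) auto
    then have "P (lags k n)" if "n \<ge> m" for n
      using that Y(2) lags_finite by (intro Y(3)) (force simp: lags_def)
    then show "\<forall>\<^sub>F n in sequentially. P (lags k n)" unfolding eventually_sequentially by blast
  qed
  have "\<forall>k. \<exists>G. G \<in> borel_measurable path_measure \<and> depends_on {..<0} G \<and>
      (\<forall>t. AE \<omega> in M. V t (Suc k) \<omega> = G (time_shift t (\<lambda>i. \<epsilon> i \<omega>)))"
  proof
    fix k
    define g where "g n x = (\<Sum>js\<in>lags (Suc k) n. monomial js x)" for n x
    have g: "g n \<in> borel_measurable path_measure" "depends_on {..<0} (g n)" for n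
    proof -
      show "g n \<in> borel_measurable path_measure" unfolding g_def by measurable
      show "depends_on {..<0} (g n)" unfolding g_def by (intro depends_on_sum monomial_dep) (auto simp: lags_def)
    qed
    have "L2_tendsto M (\<lambda>n \<omega>. g n (time_shift t (\<lambda>i. \<epsilon> i \<omega>))) (V t (Suc k)) sequentially" for t
      using L2_tendsto_compose[OF V1[of "Suc k" t, unfolded L2_has_sum_def] lags_filter]
      unfolding g_def monomial_shift by simp
    from stationary_L2_limit_factors[OF E g this] show "\<exists>G. G \<in> borel_measurable path_measure \<and> depends_on {..<0} G \<and>
      (\<forall>t. AE \<omega> in M. V t (Suc k) \<omega> = G (time_shift t (\<lambda>i. \<epsilon> i \<omega>)))" by metis
  qed
  then obtain G where G: "\<And>k. G k \<in> borel_measurable path_measure" "\<And>k. depends_on {..<0} (G k)"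
    "\<And>k t. AE \<omega> in M. V t (Suc k) \<omega> = G k (time_shift t (\<lambda>i. \<epsilon> i \<omega>))" by metis
  have [measurable]: "G k \<in> borel_measurable path_measure" for k by (rule G)
  define g where "g n x = (\<Sum>k<n. a * G k x)" for n x
  have g: "g n \<in> borel_measurable path_measure" "depends_on {..<0} (g n)" for n
  proof -
    show "g n \<in> borel_measurable path_measure" unfolding g_def by measurable
    show "depends_on {..<0} (g n)" unfolding g_def by (intro depends_on_sum depends_on_scale G)
  qed
  have "L2_tendsto M (\<lambda>n \<omega>. g n (time_shift t (\<lambda>i. \<epsilon> i \<omega>))) (\<lambda>\<omega>. \<sigma> t \<omega> - a) sequentially" for t
  proof (rule L2_tendsto_cong_AE)
    show "L2_tendsto M (\<lambda>n \<omega>. \<Sum>k<n. a * V t (Suc k) \<omega>) (\<lambda>\<omega>. \<sigma> t \<omega> - a) sequentially"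
      using V2[of t] unfolding L2_sums_def .
    fix n
    have "AE \<omega> in M. \<forall>k. V t (Suc k) \<omega> = G k (time_shift t (\<lambda>i. \<epsilon> i \<omega>))"
      unfolding AE_all_countable using G(3) by blast
    then show "AE \<omega> in M. (\<Sum>k<n. a * V t (Suc k) \<omega>) = g n (time_shift t (\<lambda>i. \<epsilon> i \<omega>))"
      by eventually_elim (simp add: g_def)
    show "(\<lambda>\<omega>. g n (time_shift t (\<lambda>i. \<epsilon> i \<omega>))) \<in> borel_measurable M"
      using measurable_compose[OF measurable_compose[OF E(1) measurable_shift] g(1)] .
    show "(\<lambda>\<omega>. \<sigma> t \<omega> - a) \<in> borel_measurable M"
      using V2[of t] by (simp add: L2_sums_def L2_tendsto_def square_integrable_def)
  qed simp
  from stationary_L2_limit_factors[OF E g this] obtain F where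
    F: "F \<in> borel_measurable path_measure" "depends_on {..<0} F"
      "\<And>t. AE \<omega> in M. \<sigma> t \<omega> - a = F (time_shift t (\<lambda>i. \<epsilon> i \<omega>))" by metis
  show ?thesis
  proof (rule that)
    show "(\<lambda>x. F x + a) \<in> borel_measurable path_measure" using F(1) by simp
    show "depends_on {..<0} (\<lambda>x. F x + a)" by (rule depends_on_comp[OF F(2)])
    show "AE \<omega> in M. \<sigma> t \<omega> = F (time_shift t (\<lambda>i. \<epsilon> i \<omega>)) + a" for t
      using F(3)[of t] by eventually_elim simp
  qed
qed

section \<open>Abel summation of the hyperbolic weights\<close>

text \<open>
  The differences of $s^{d-q}$ at the integers, which are the coefficients left by a summation by parts,
  and a bound for them and for their derivative in \<open>d\<close>; the logarithm in the bound is due to the latter.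
\<close>

definition abel_coeff :: "real \<Rightarrow> real \<Rightarrow> nat \<Rightarrow> real" where
  "abel_coeff q d j = real (Suc j) powr (d - q) - real (Suc (Suc j)) powr (d - q)"

definition abel_weight :: "real \<Rightarrow> nat \<Rightarrow> real" where
  "abel_weight \<delta> j = (1 + ln (real (Suc (Suc j)))) * real (Suc j) powr (- 1 - \<delta>)"

lemma abel_weight_nonneg: "0 \<le> abel_weight \<delta> j"
  unfolding abel_weight_def by (intro mult_nonneg_nonneg add_nonneg_nonneg) auto

lemma abel_weight_summable:
  assumes "0 < \<delta>"
  shows "summable (abel_weight \<delta>)"
proof (rule summable_comparison_test)
  define a where "a = \<delta> / 2"
  have a: "0 < a" using assms by (simp add: a_def)
  have "summable (\<lambda>j. real j powr (- 1 - a))" using a by (subst summable_real_powr_iff) auto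
  then have "summable (\<lambda>j. real (Suc j) powr (- 1 - a))" by (subst summable_Suc_iff)
  then show "summable (\<lambda>j. (1 + 2 powr a / a) * real (Suc j) powr (- 1 - a))" by (rule summable_mult)
  have "norm (abel_weight \<delta> j) \<le> (1 + 2 powr a / a) * real (Suc j) powr (- 1 - a)" for j
  proof -
    have "ln (real (Suc (Suc j))) \<le> real (Suc (Suc j)) powr a / a" using a by (intro ln_powr_bound) auto
    also have "\<dots> \<le> (2 * real (Suc j)) powr a / a" using a by (intro divide_right_mono powr_mono2) auto
    also have "\<dots> = 2 powr a / a * real (Suc j) powr a" by (subst powr_mult) auto
    finally have "1 + ln (real (Suc (Suc j))) \<le> 1 * 1 + 2 powr a / a * real (Suc j) powr a" by simp
    also have "\<dots> \<le> 1 * real (Suc j) powr a + 2 powr a / a * real (Suc j) powr a"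
      using a by (intro add_mono mult_left_mono ge_one_powr_ge_zero) auto
    finally have "abel_weight \<delta> j \<le> ((1 + 2 powr a / a) * real (Suc j) powr a) * real (Suc j) powr (- 1 - \<delta>)"
      unfolding abel_weight_def by (intro mult_right_mono) (auto simp: algebra_simps)
    also have "\<dots> = (1 + 2 powr a / a) * real (Suc j) powr (- 1 - a)"
    proof -
      have "a + (- 1 - \<delta>) = - 1 - a" by (simp add: a_def)
      then show ?thesis by (simp only: mult.assoc powr_add[symmetric])
    qed
    finally show ?thesis using abel_weight_nonneg[of \<delta> j] by simp
  qed
  then show "\<exists>N. \<forall>n\<ge>N. norm (abel_weight \<delta> n) \<le> (1 + 2 powr a / a) * real (Suc n) powr (- 1 - a)" by blast
qed

lemma abel_coeff_bound:
  assumes d: "q - 1 \<le> d" "d \<le> q - \<delta>" and "0 < \<delta>"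
  shows "\<bar>abel_coeff q d j\<bar> \<le> abel_weight \<delta> j"
proof -
  have "\<exists>z>real (Suc j). z < real (Suc (Suc j)) \<and>
      real (Suc (Suc j)) powr (d - q) - real (Suc j) powr (d - q)
        = (real (Suc (Suc j)) - real (Suc j)) * ((d - q) * z powr (d - q - 1))"
    by (rule MVT2, simp, rule has_real_derivative_powr) auto
  then obtain z where z: "real (Suc j) < z" and
    e: "abel_coeff q d j = - ((d - q) * z powr (d - q - 1))"
    by (auto simp: abel_coeff_def)
  have "\<bar>abel_coeff q d j\<bar> = (q - d) * z powr (d - q - 1)"
    unfolding e using d \<open>0 < \<delta>\<close> by (simp add: abs_mult)
  also have "\<dots> \<le> 1 * real (Suc j) powr (d - q - 1)"
    using d z \<open>0 < \<delta>\<close> by (intro mult_mono powr_mono2') auto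
  also have "\<dots> \<le> 1 * real (Suc j) powr (- 1 - \<delta>)"
    using d by (intro mult_left_mono powr_mono) auto
  also have "\<dots> \<le> abel_weight \<delta> j"
    unfolding abel_weight_def by (intro mult_right_mono) auto
  finally show ?thesis .
qed

text \<open>
  A mixed second difference of $s^{d-q}$: the mean value theorem in \<open>d\<close> produces $s^{z-q} \ln s$, and in
  $s$ one more power of $s$ is gained.
\<close>

lemma abel_coeff_lipschitz_aux:
  assumes d: "q - 1 \<le> d" "d < d'" "d' \<le> q - \<delta>" and "0 < \<delta>"
  shows "\<bar>abel_coeff q d' j - abel_coeff q d j\<bar> \<le> abel_weight \<delta> j * (d' - d)"
proof -
  define s where "s = real (Suc j)"
  have s: "s \<ge> 1" "real (Suc (Suc j)) = s + 1" by (auto simp: s_def)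
  have "\<exists>z>d. z < d' \<and> abel_coeff q d' j - abel_coeff q d j
      = (d' - d) * (s powr (z - q) * ln s - (s + 1) powr (z - q) * ln (s + 1))"
    unfolding abel_coeff_def s(2) s_def[symmetric]
    by (rule MVT2) (use d s in \<open>auto intro!: derivative_eq_intros\<close>)
  then obtain z where z: "d < z" "z < d'" and
    e: "abel_coeff q d' j - abel_coeff q d j = (d' - d) * (s powr (z - q) * ln s - (s + 1) powr (z - q) * ln (s + 1))"
    by blast
  have "\<exists>y>s. y < s + 1 \<and> (s + 1) powr (z - q) * ln (s + 1) - s powr (z - q) * ln s
      = (s + 1 - s) * (y powr (z - q - 1) * (1 + (z - q) * ln y))"
  proof (rule MVT2)
    fix y assume "s \<le> y"
    then have y: "0 < y" using s by simp
    then have "y powr (z - q - 1) = y powr (z - q) / y" by (simp add: powr_diff)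
    with DERIV_mult[OF has_real_derivative_powr[OF y, of "z - q"] DERIV_ln_divide[OF y]]
    show "((\<lambda>y. y powr (z - q) * ln y) has_real_derivative y powr (z - q - 1) * (1 + (z - q) * ln y)) (at y)"
      by (simp add: algebra_simps add_divide_distrib)
  qed simp
  then obtain y where y: "s < y" "y < s + 1" and
    f: "(s + 1) powr (z - q) * ln (s + 1) - s powr (z - q) * ln s = y powr (z - q - 1) * (1 + (z - q) * ln y)"
    by auto
  have ly: "0 \<le> ln y" "ln y \<le> ln (s + 1)" using y s by auto
  have "\<bar>(z - q) * ln y\<bar> \<le> 1 * ln (s + 1)"
    unfolding abs_mult using z d \<open>0 < \<delta>\<close> ly by (intro mult_mono) auto
  then have 1: "\<bar>1 + (z - q) * ln y\<bar> \<le> 1 + ln (s + 1)" by linarith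
  have "y powr (z - q - 1) \<le> s powr (z - q - 1)" using y s z d \<open>0 < \<delta>\<close> by (intro powr_mono2') auto
  also have "\<dots> \<le> s powr (- 1 - \<delta>)" using s z d by (intro powr_mono) auto
  finally have "\<bar>y powr (z - q - 1) * (1 + (z - q) * ln y)\<bar> \<le> s powr (- 1 - \<delta>) * (1 + ln (s + 1))"
    unfolding abs_mult using 1 by (intro mult_mono) auto
  also have "\<dots> = abel_weight \<delta> j" by (simp add: abel_weight_def s_def add.commute mult.commute)
  finally have g: "\<bar>s powr (z - q) * ln s - (s + 1) powr (z - q) * ln (s + 1)\<bar> \<le> abel_weight \<delta> j"
    unfolding f[symmetric] by (simp add: abs_minus_commute)
  then show ?thesis unfolding e abs_mult using d by (simp add: mult.commute mult_right_mono)
qed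

lemma abel_coeff_lipschitz:
  assumes "q - 1 \<le> d" "d \<le> q - \<delta>" "q - 1 \<le> d'" "d' \<le> q - \<delta>" and "0 < \<delta>"
  shows "\<bar>abel_coeff q d j - abel_coeff q d' j\<bar> \<le> abel_weight \<delta> j * \<bar>d - d'\<bar>"
  using abel_coeff_lipschitz_aux[of q d d' \<delta> j] abel_coeff_lipschitz_aux[of q d' d \<delta> j] assms
  by (cases d d' rule: linorder_cases) (auto simp: abs_minus_commute)

lemma powr_neg_tendsto_0:
  assumes "a < 0"
  shows "(\<lambda>n. real (Suc n) powr a) \<longlonglongrightarrow> 0"
  using tendsto_neg_powr[OF assms filterlim_real_sequentially] by (rule LIMSEQ_Suc)

lemma abel_coeff_sums:
  assumes "d < q"
  shows "abel_coeff q d sums 1" "(\<lambda>j. abel_coeff q d (Suc j)) sums (2 powr (d - q))"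
proof -
  have "(\<lambda>n. real (Suc n) powr (d - q)) \<longlonglongrightarrow> 0" using assms by (intro powr_neg_tendsto_0) auto
  from telescope_sums'[OF this] telescope_sums'[OF LIMSEQ_Suc[OF this]]
  show "abel_coeff q d sums 1" "(\<lambda>j. abel_coeff q d (Suc j)) sums (2 powr (d - q))"
    by (simp_all add: abel_coeff_def[abs_def] numeral_2_eq_2)
qed

text \<open>
  With $\sum_j j^{q-1} y_j$ in place of the partial sums of \<open>y\<close>, the coefficients of the new series are
  summable as soon as $d < q$.
\<close>

lemma abel_summation:
  "(\<Sum>j<n. real (Suc j) powr (d - 1) * y (Suc j)) =
     real (Suc n) powr (d - q) * (\<Sum>j<n. real (Suc j) powr (q - 1) * y (Suc j)) +
     (\<Sum>j<n. abel_coeff q d j * (\<Sum>i<Suc j. real (Suc i) powr (q - 1) * y (Suc i)))"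
proof (induction n)
  case (Suc n)
  have "real (Suc n) powr (d - 1) = real (Suc n) powr (d - q) * real (Suc n) powr (q - 1)"
    by (simp add: powr_add[symmetric])
  then show ?case unfolding sum.lessThan_Suc Suc abel_coeff_def by (simp add: algebra_simps)
qed simp

section \<open>The filtered observations as a Lipschitz function of the memory parameter\<close>

text \<open>
  Here \<open>\<phi>\<close> is the volatility at time 0.  Memory parameters range over $[0, q - \delta]$: the bound
  $q < 1/2$ keeps the variances of the partial sums with exponent $q - 1$ bounded, and $\delta > 0$ makes the
  weights of the summation by parts summable uniformly in the memory parameter.
\<close>

locale driven_volatility = white_noise +
  fixes \<phi> :: "(int \<Rightarrow> real) \<Rightarrow> real" and q \<delta> :: real
  assumes \<phi>_measurable [measurable]: "\<phi> \<in> borel_measurable path_measure"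
    and \<phi>_predictable: "depends_on {..<0} \<phi>"
    and \<phi>_square_integrable: "square_integrable path_measure \<phi>"
    and q_less: "q < 1 / 2" and \<delta>_pos: "0 < \<delta>" and \<delta>_less: "\<delta> < q"
begin

text \<open>
  The observation $X_{-j} = \varepsilon_{-j} \sigma_{-j}$.
\<close>

definition lag :: "nat \<Rightarrow> (int \<Rightarrow> real) \<Rightarrow> real" where
  "lag j x = x (- int j) * \<phi> (time_shift (- int j) x)"

lemma lag_measurable [measurable]: "lag j \<in> borel_measurable path_measure"
  unfolding lag_def by measurable

lemma \<phi>_lag_depends: "depends_on {..<- int j} (\<lambda>x. \<phi> (time_shift (- int j) x))"
  by (rule depends_on_shift[OF \<phi>_predictable]) auto

lemma lag_depends: "int k \<le> int j \<Longrightarrow> depends_on {..- int k} (lag j)"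
  unfolding lag_def
  by (rule depends_on_comp2[of _ _ _ "(*)"], rule depends_on_coord, simp, rule depends_on_mono[OF \<phi>_lag_depends]) auto

lemma lag_predictable: "k < j \<Longrightarrow> depends_on {..<- int k} (lag j)"
  by (rule depends_on_mono[OF lag_depends[of j j]]) auto

lemma lag_square_integrable: "square_integrable path_measure (lag j)"
  and lag_second_moment: "(\<integral>x. (lag j x)\<^sup>2 \<partial>path_measure) = (\<integral>x. (\<phi> x)\<^sup>2 \<partial>path_measure)"
proof -
  have i: "integrable path_measure (\<lambda>x. (\<phi> (time_shift (- int j) x))\<^sup>2)"
    using \<phi>_square_integrable by (intro integrable_shift) (auto simp: square_integrable_def)
  have d: "depends_on {..<- int j} (\<lambda>x. (\<phi> (time_shift (- int j) x))\<^sup>2)"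
    by (rule depends_on_comp[OF \<phi>_lag_depends])
  note c = coord_mult[OF i d, of "- int j"]
  show "square_integrable path_measure (lag j)"
    using c(2) by (simp add: square_integrable_def lag_def[abs_def] power_mult_distrib)
  show "(\<integral>x. (lag j x)\<^sup>2 \<partial>path_measure) = (\<integral>x. (\<phi> x)\<^sup>2 \<partial>path_measure)"
    using c(3) integral_shift[of "\<lambda>x. (\<phi> x)\<^sup>2" "- int j"] by (simp add: lag_def power_mult_distrib)
qed

text \<open>
  The more recent of the two innovations is independent of all other factors and has mean 0.
\<close>

lemma lag_orthogonal_aux:
  assumes "i < j"
  shows "(\<integral>x. lag i x * lag j x \<partial>path_measure) = 0"
proof -
  have s: "square_integrable path_measure (\<lambda>x. \<phi> (time_shift (- int i) x))"
    using \<phi>_square_integrable integrable_shift[of "\<lambda>x. (\<phi> x)\<^sup>2" "- int i"] by (auto simp: square_integrable_def)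
  have "(\<integral>x. x (- int i) * (\<phi> (time_shift (- int i) x) * lag j x) \<partial>path_measure) = 0"
  proof (rule coord_mult(1))
    show "integrable path_measure (\<lambda>x. \<phi> (time_shift (- int i) x) * lag j x)"
      by (rule square_integrable_mult[OF s lag_square_integrable])
    show "depends_on {..<- int i} (\<lambda>x. \<phi> (time_shift (- int i) x) * lag j x)"
      by (rule depends_on_comp2[OF \<phi>_lag_depends lag_predictable[OF assms]])
  qed simp
  then show ?thesis by (simp add: lag_def mult.assoc)
qed

lemma lag_orthogonal: "i \<noteq> j \<Longrightarrow> (\<integral>x. lag i x * lag j x \<partial>path_measure) = 0"
  using lag_orthogonal_aux[of i j] lag_orthogonal_aux[of j i]
  by (cases i j rule: linorder_cases) (auto simp: mult.commute)

definition partial_filter :: "nat \<Rightarrow> (int \<Rightarrow> real) \<Rightarrow> real" where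
  "partial_filter n x = (\<Sum>j<n. real (Suc j) powr (q - 1) * lag (Suc j) x)"

lemma partial_filter_measurable [measurable]: "partial_filter n \<in> borel_measurable path_measure"
  unfolding partial_filter_def by measurable

lemma partial_filter_square_integrable: "square_integrable path_measure (partial_filter n)"
  unfolding partial_filter_def[abs_def]
  by (intro square_integrable_sum square_integrable_scale lag_square_integrable)

definition filter_variance :: real where
  "filter_variance = (\<integral>x. (\<phi> x)\<^sup>2 \<partial>path_measure) * (\<Sum>j. real (Suc j) powr (2 * q - 2))"

lemma partial_filter_variance: "(\<integral>x. (partial_filter n x)\<^sup>2 \<partial>path_measure) \<le> filter_variance"
proof -
  have sm: "summable (\<lambda>j. real (Suc j) powr (2 * q - 2))"
    using q_less by (subst summable_Suc_iff) (auto simp: summable_real_powr_iff)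
  have "(\<integral>x. (partial_filter n x)\<^sup>2 \<partial>path_measure) =
     (\<integral>x. (\<Sum>i<n. \<Sum>j<n. (real (Suc i) powr (q - 1) * real (Suc j) powr (q - 1)) * (lag (Suc i) x * lag (Suc j) x)) \<partial>path_measure)"
    unfolding partial_filter_def power2_eq_square sum_product by (simp add: ac_simps)
  also have "\<dots> = (\<Sum>i<n. \<Sum>j<n. (real (Suc i) powr (q - 1) * real (Suc j) powr (q - 1)) * (\<integral>x. lag (Suc i) x * lag (Suc j) x \<partial>path_measure))"
    using square_integrable_mult[OF lag_square_integrable lag_square_integrable] by simp
  also have "\<dots> = (\<Sum>i<n. \<Sum>j<n. if j = i then real (Suc i) powr (2 * q - 2) * (\<integral>x. (\<phi> x)\<^sup>2 \<partial>path_measure) else 0)"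
  proof (intro sum.cong refl)
    fix i j
    have "real (Suc i) powr (q - 1) * real (Suc i) powr (q - 1) = real (Suc i) powr (2 * q - 2)"
      by (simp add: powr_add[symmetric])
    then show "(real (Suc i) powr (q - 1) * real (Suc j) powr (q - 1)) * (\<integral>x. lag (Suc i) x * lag (Suc j) x \<partial>path_measure)
        = (if j = i then real (Suc i) powr (2 * q - 2) * (\<integral>x. (\<phi> x)\<^sup>2 \<partial>path_measure) else 0)"
      using lag_orthogonal[of "Suc i" "Suc j"] lag_second_moment[of "Suc i"]
      by (auto simp: power2_eq_square)
  qed
  also have "\<dots> = (\<Sum>i<n. real (Suc i) powr (2 * q - 2)) * (\<integral>x. (\<phi> x)\<^sup>2 \<partial>path_measure)"
    by (simp add: sum_distrib_right)
  also have "\<dots> \<le> filter_variance"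
    unfolding filter_variance_def mult.commute[of _ "\<integral>x. (\<phi> x)\<^sup>2 \<partial>path_measure"]
    using sm by (intro mult_left_mono sum_le_suminf) auto
  finally show ?thesis .
qed

text \<open>
  One random variable that bounds the filtered observations for all memory parameters, and also their
  increments relative to the increment of the memory parameter.
\<close>

definition envelope :: "(int \<Rightarrow> real) \<Rightarrow> real" where
  "envelope x = (\<Sum>j. abel_weight \<delta> j * \<bar>partial_filter (Suc j) x\<bar>)"

definition regular_path :: "(int \<Rightarrow> real) \<Rightarrow> bool" where
  "regular_path x \<longleftrightarrow> summable (\<lambda>j. abel_weight \<delta> j * \<bar>partial_filter (Suc j) x\<bar>)"

text \<open>
  The partial sums are bounded in $L^2$, hence in $L^1$, and the weights are summable.
\<close>

lemma AE_regular_path: "AE x in path_measure. regular_path x"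
  and envelope_integrable: "integrable path_measure envelope"
proof -
  define f where "f j x = abel_weight \<delta> j * \<bar>partial_filter (Suc j) x\<bar>" for j x
  have f0: "0 \<le> f j x" for j x by (simp add: f_def abel_weight_nonneg)
  have pi: "integrable path_measure (\<lambda>x. \<bar>partial_filter n x\<bar>)" for n
    using N.square_integrable_imp_integrable[OF partial_filter_square_integrable[of n]] by simp
  have pb: "(\<integral>x. \<bar>partial_filter n x\<bar> \<partial>path_measure) \<le> 1 + filter_variance" for n
  proof -
    have i2: "integrable path_measure (\<lambda>x. (partial_filter n x)\<^sup>2)"
      using partial_filter_square_integrable[of n] by (simp add: square_integrable_def)
    have "(\<integral>x. \<bar>partial_filter n x\<bar> \<partial>path_measure) \<le> (\<integral>x. 1 + (partial_filter n x)\<^sup>2 \<partial>path_measure)"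
    proof (rule integral_mono)
      show "\<bar>partial_filter n x\<bar> \<le> 1 + (partial_filter n x)\<^sup>2" for x
        using sum_squares_bound[of 1 "\<bar>partial_filter n x\<bar>"] by simp
    qed (use pi i2 in auto)
    then show ?thesis using partial_filter_variance[of n] i2 by simp
  qed
  have fi: "integrable path_measure (f j)" for j unfolding f_def using pi by simp
  have "summable (\<lambda>j. abel_weight \<delta> j * (1 + filter_variance))"
    by (rule summable_mult2[OF abel_weight_summable[OF \<delta>_pos]])
  then have sI: "summable (\<lambda>j. \<integral>x. f j x \<partial>path_measure)"
  proof (rule summable_comparison_test'[where N=0])
    fix j
    have "(\<integral>x. f j x \<partial>path_measure) \<le> abel_weight \<delta> j * (1 + filter_variance)"
      using pb[of "Suc j"] abel_weight_nonneg[of \<delta> j] unfolding f_def by (simp add: mult_left_mono)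
    then show "norm (\<integral>x. f j x \<partial>path_measure) \<le> abel_weight \<delta> j * (1 + filter_variance)"
      using f0 by simp
  qed
  have "(\<integral>\<^sup>+x. (\<Sum>j. ennreal (f j x)) \<partial>path_measure) = (\<Sum>j. \<integral>\<^sup>+x. ennreal (f j x) \<partial>path_measure)"
    using fi by (intro nn_integral_suminf) auto
  also have "\<dots> = (\<Sum>j. ennreal (\<integral>x. f j x \<partial>path_measure))"
    using fi f0 by (simp add: nn_integral_eq_integral)
  also have "\<dots> \<noteq> top" using sI f0 by (intro ennreal_suminf_neq_top) auto
  finally have "AE x in path_measure. (\<Sum>j. ennreal (f j x)) \<noteq> \<infinity>"
    using fi by (intro nn_integral_PInf_AE) auto
  then have s: "AE x in path_measure. summable (\<lambda>j. f j x)"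
    by eventually_elim (rule summable_suminf_not_top, auto simp: f0)
  then show "AE x in path_measure. regular_path x" by (simp add: regular_path_def f_def)
  have "integrable path_measure (\<lambda>x. \<Sum>j. f j x)"
    using fi s sI f0 by (intro integrable_suminf) auto
  then show "integrable path_measure envelope" by (simp add: envelope_def[abs_def] f_def)
qed

lemma envelope_nonneg: "regular_path x \<Longrightarrow> 0 \<le> envelope x"
  unfolding regular_path_def envelope_def by (intro suminf_nonneg) (auto simp: abel_weight_nonneg)

text \<open>
  The sum $\sum_{j \ge 1} j^{d-1} X_{-j}$ after summation by parts.  The rewritten series converges
  absolutely, on an event that does not depend on \<open>d\<close>.
\<close>

definition filter_sum :: "real \<Rightarrow> (int \<Rightarrow> real) \<Rightarrow> real" where
  "filter_sum d x = (\<Sum>j. abel_coeff q d j * partial_filter (Suc j) x)"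

lemma filter_sum_measurable [measurable]: "filter_sum d \<in> borel_measurable path_measure"
  unfolding filter_sum_def by measurable

lemma filter_sum_summable:
  assumes "regular_path x" "0 \<le> d" "d \<le> q - \<delta>"
  shows "summable (\<lambda>j. \<bar>abel_coeff q d j * partial_filter (Suc j) x\<bar>)"
proof (rule summable_comparison_test'[where N=0])
  show "summable (\<lambda>j. abel_weight \<delta> j * \<bar>partial_filter (Suc j) x\<bar>)"
    using assms by (simp add: regular_path_def)
  show "norm \<bar>abel_coeff q d j * partial_filter (Suc j) x\<bar> \<le> abel_weight \<delta> j * \<bar>partial_filter (Suc j) x\<bar>" for j
    using abel_coeff_bound[of q d \<delta> j] assms q_less \<delta>_pos by (simp add: abs_mult mult_right_mono)
qed

lemma filter_sum_bound:
  assumes "regular_path x" "0 \<le> d" "d \<le> q - \<delta>"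
  shows "\<bar>filter_sum d x\<bar> \<le> envelope x"
proof -
  have "\<bar>filter_sum d x\<bar> \<le> (\<Sum>j. \<bar>abel_coeff q d j * partial_filter (Suc j) x\<bar>)"
    unfolding filter_sum_def by (rule summable_rabs[OF filter_sum_summable[OF assms]])
  also have "\<dots> \<le> envelope x"
    unfolding envelope_def
  proof (rule suminf_le)
    show "\<bar>abel_coeff q d j * partial_filter (Suc j) x\<bar> \<le> abel_weight \<delta> j * \<bar>partial_filter (Suc j) x\<bar>" for j
      using abel_coeff_bound[of q d \<delta> j] assms q_less \<delta>_pos by (simp add: abs_mult mult_right_mono)
  qed (use filter_sum_summable[OF assms] assms in \<open>auto simp: regular_path_def\<close>)
  finally show ?thesis .
qed

lemma filter_sum_lipschitz:
  assumes x: "regular_path x" and "0 \<le> d" "d \<le> q - \<delta>" "0 \<le> d'" "d' \<le> q - \<delta>"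
  shows "\<bar>filter_sum d x - filter_sum d' x\<bar> \<le> \<bar>d - d'\<bar> * envelope x"
proof -
  define u where "u j = (abel_coeff q d j - abel_coeff q d' j) * partial_filter (Suc j) x" for j
  have w: "summable (\<lambda>j. \<bar>d - d'\<bar> * (abel_weight \<delta> j * \<bar>partial_filter (Suc j) x\<bar>))"
    using x by (intro summable_mult) (simp add: regular_path_def)
  have b: "\<bar>u j\<bar> \<le> \<bar>d - d'\<bar> * (abel_weight \<delta> j * \<bar>partial_filter (Suc j) x\<bar>)" for j
    using mult_right_mono[OF abel_coeff_lipschitz[of q d \<delta> d' j], of "\<bar>partial_filter (Suc j) x\<bar>"] assms q_less \<delta>_pos
    by (simp add: u_def abs_mult mult.assoc mult.left_commute mult.commute)
  have su: "summable (\<lambda>j. \<bar>u j\<bar>)"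
    by (rule summable_comparison_test'[OF w, of 0]) (use b in auto)
  have "filter_sum d x - filter_sum d' x = (\<Sum>j. u j)"
    unfolding filter_sum_def u_def left_diff_distrib
    by (rule suminf_diff) (use filter_sum_summable assms in \<open>auto intro: summable_rabs_cancel\<close>)
  also have "\<bar>\<dots>\<bar> \<le> (\<Sum>j. \<bar>u j\<bar>)" by (rule summable_rabs[OF su])
  also have "\<dots> \<le> (\<Sum>j. \<bar>d - d'\<bar> * (abel_weight \<delta> j * \<bar>partial_filter (Suc j) x\<bar>))"
    by (rule suminf_le[OF b su w])
  also have "\<dots> = \<bar>d - d'\<bar> * envelope x"
    unfolding envelope_def using x by (intro suminf_mult) (simp add: regular_path_def)
  finally show ?thesis .
qed

text \<open>
  The boundary term of the summation by parts is $n^{d-q}$ times a sequence bounded in $L^2$, so it tends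
  to 0 in the mean square; the remaining sum converges almost surely.
\<close>

lemma linear_filter_eq_filter_sum:
  assumes E: "E \<in> M \<rightarrow>\<^sub>M path_measure" "distr M path_measure E = path_measure"
    and d: "0 \<le> d" "d \<le> q - \<delta>"
    and lim: "L2_tendsto M (\<lambda>n \<omega>. \<Sum>j<n. (c * real (Suc j) powr (d - 1)) * lag (Suc j) (E \<omega>)) Y sequentially"
  shows "AE \<omega> in M. Y \<omega> = c * filter_sum d (E \<omega>)"
proof -
  define B where "B n x = real (Suc n) powr (d - q) * partial_filter n x" for n x
  define A where "A n x = (\<Sum>j<n. abel_coeff q d j * partial_filter (Suc j) x)" for n x
  have AB: "(\<Sum>j<n. (c * real (Suc j) powr (d - 1)) * lag (Suc j) x) = c * B n x + c * A n x" for n x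
    unfolding A_def B_def partial_filter_def
    using abel_summation[of d "\<lambda>j. lag j x" n q]
    by (simp add: sum_distrib_left[symmetric] mult.assoc distrib_left[symmetric])
  have Bsq: "square_integrable path_measure (B n)" for n
    unfolding B_def by (intro square_integrable_scale partial_filter_square_integrable)
  have "(\<lambda>n. \<integral>x. (B n x - 0)\<^sup>2 \<partial>path_measure) \<longlonglongrightarrow> 0"
  proof (rule tendsto_sandwich[OF _ _ tendsto_const])
    show "(\<lambda>n. (real (Suc n) powr (d - q))\<^sup>2 * filter_variance) \<longlonglongrightarrow> 0"
    proof -
      have "(\<lambda>n. real (Suc n) powr (d - q)) \<longlonglongrightarrow> 0" using d \<delta>_pos by (intro powr_neg_tendsto_0) simp
      from tendsto_mult[OF tendsto_power[OF this, of 2] tendsto_const[of filter_variance]] show ?thesis by simp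
    qed
    show "\<forall>\<^sub>F n in sequentially. (\<integral>x. (B n x - 0)\<^sup>2 \<partial>path_measure) \<le> (real (Suc n) powr (d - q))\<^sup>2 * filter_variance"
      using partial_filter_variance by (auto simp: B_def power_mult_distrib mult_left_mono)
  qed simp
  then have "L2_tendsto path_measure B (\<lambda>_. 0) sequentially"
    using Bsq by (simp add: L2_tendsto_def square_integrable_def)
  then have "L2_tendsto M (\<lambda>n \<omega>. B n (E \<omega>)) (\<lambda>_. 0) sequentially"
    using L2_tendsto_distr[OF E, of B "\<lambda>_. 0" sequentially] Bsq by (simp add: square_integrable_def)
  from L2_tendsto_add[OF lim L2_tendsto_scale[OF this, of "- c"]]
  have "L2_tendsto M (\<lambda>n \<omega>. c * A n (E \<omega>)) Y sequentially" by (simp only: AB) simp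
  then obtain r :: "nat \<Rightarrow> nat" where r: "strict_mono r" "AE \<omega> in M. (\<lambda>n. c * A (r n) (E \<omega>)) \<longlonglongrightarrow> Y \<omega>"
    by (rule L2_tendsto_AE_subseq)
  have "AE \<omega> in M. regular_path (E \<omega>)"
    using AE_regular_path AE_distrD[OF E(1), of regular_path] by (simp only: E(2))
  with r(2) show ?thesis
  proof eventually_elim
    case (elim \<omega>)
    have "(\<lambda>n. A n (E \<omega>)) \<longlonglongrightarrow> filter_sum d (E \<omega>)"
      unfolding A_def filter_sum_def
      by (rule summable_LIMSEQ) (use filter_sum_summable[OF elim(2) d] in \<open>rule summable_rabs_cancel\<close>)
    from LIMSEQ_subseq_LIMSEQ[OF this r(1)]
    have "(\<lambda>n. c * A (r n) (E \<omega>)) \<longlonglongrightarrow> c * filter_sum d (E \<omega>)"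
      unfolding comp_def by (rule tendsto_mult_left)
    then show ?case using elim(1) LIMSEQ_unique by blast
  qed
qed

text \<open>
  The part of \<open>filter_sum\<close> that comes from lags 3 and higher; the summation index is the lag minus 1.
\<close>

definition remote_filter :: "real \<Rightarrow> (int \<Rightarrow> real) \<Rightarrow> real" where
  "remote_filter d x = (\<Sum>j. abel_coeff q d j * (\<Sum>i=2..<Suc j. real (Suc i) powr (q - 1) * lag (Suc i) x))"

lemma remote_filter_measurable [measurable]: "remote_filter d \<in> borel_measurable path_measure"
  unfolding remote_filter_def by measurable

lemma remote_filter_depends: "depends_on {..<- 2} (remote_filter d)"
  unfolding remote_filter_def
proof (rule depends_on_suminf, rule depends_on_scale, rule depends_on_sum, rule depends_on_scale)
  fix i j :: nat assume "i \<in> {2..<Suc j}"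
  then show "depends_on {..<- 2} (lag (Suc i))" using lag_predictable[of 2 "Suc i"] by simp
qed

text \<open>
  Summation by parts is undone for lags 1 and 2 only, by telescoping: the coefficients from index 0 on
  add up to 1, and those from index 1 on to $2^{d-q}$.  Identification needs two lags, since the
  coefficient $1$ of lag 1 does not involve \<open>d\<close>.
\<close>

lemma filter_sum_decompose:
  assumes x: "regular_path x" and d: "0 \<le> d" "d \<le> q - \<delta>"
  shows "filter_sum d x = lag 1 x + 2 powr (d - 1) * lag 2 x + remote_filter d x"
proof -
  have dq: "d < q" using d \<delta>_pos by simp
  define u where "u j = 2 powr (q - 1) * lag 2 x * (if j = 0 then 0 else abel_coeff q d j)" for j
  have "(\<lambda>j. if Suc j = 0 then 0 else abel_coeff q d (Suc j)) sums (2 powr (d - q))"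
    using abel_coeff_sums(2)[OF dq] by simp
  then have "(\<lambda>j. if j = 0 then 0 else abel_coeff q d j) sums (2 powr (d - q) + 0)"
    by (subst (asm) sums_Suc_iff) simp
  then have "u sums (2 powr (q - 1) * lag 2 x * (2 powr (d - q) + 0))"
    unfolding u_def by (rule sums_mult)
  also have "2 powr (q - 1) * lag 2 x * (2 powr (d - q) + 0) = 2 powr (d - 1) * lag 2 x"
    using powr_add[of 2 "q - 1" "d - q"] by simp
  finally have s2: "u sums (2 powr (d - 1) * lag 2 x)" .
  have s1: "(\<lambda>j. lag 1 x * abel_coeff q d j) sums (lag 1 x * 1)"
    by (rule sums_mult[OF abel_coeff_sums(1)[OF dq]])
  have sD: "(\<lambda>j. abel_coeff q d j * partial_filter (Suc j) x) sums filter_sum d x"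
    unfolding filter_sum_def by (rule summable_sums, rule summable_rabs_cancel, rule filter_sum_summable[OF assms])
  have "(\<lambda>j. abel_coeff q d j * partial_filter (Suc j) x - lag 1 x * abel_coeff q d j - u j) sums
     (filter_sum d x - lag 1 x * 1 - 2 powr (d - 1) * lag 2 x)"
    by (intro sums_diff sD s1 s2)
  moreover have "abel_coeff q d j * partial_filter (Suc j) x - lag 1 x * abel_coeff q d j - u j
      = abel_coeff q d j * (\<Sum>i=2..<Suc j. real (Suc i) powr (q - 1) * lag (Suc i) x)" for j
  proof (cases j)
    case 0
    then show ?thesis by (simp add: partial_filter_def u_def)
  next
    case (Suc k)
    have "{..<Suc j} = insert 0 (insert 1 {2..<Suc j})" using Suc by auto
    then have "partial_filter (Suc j) x = lag 1 x + 2 powr (q - 1) * lag 2 x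
        + (\<Sum>i=2..<Suc j. real (Suc i) powr (q - 1) * lag (Suc i) x)"
      unfolding partial_filter_def by (simp add: numeral_2_eq_2)
    then show ?thesis using Suc by (simp add: u_def algebra_simps)
  qed
  ultimately have "remote_filter d x = filter_sum d x - lag 1 x * 1 - 2 powr (d - 1) * lag 2 x"
    unfolding remote_filter_def by (simp add: sums_iff)
  then show ?thesis by simp
qed

lemma filter_sum_predictable: "depends_on {..<0} (filter_sum d)"
  unfolding filter_sum_def partial_filter_def
proof (rule depends_on_suminf, rule depends_on_scale, rule depends_on_sum, rule depends_on_scale)
  show "depends_on {..<0} (lag (Suc i))" for i using lag_predictable[of 0 "Suc i"] by simp
qed

end

section \<open>The contrast as a function of the volatility\<close>

definition contrast :: "real \<Rightarrow> real \<Rightarrow> real \<Rightarrow> real" where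
  "contrast e z s = (z\<^sup>2 + e) / (s\<^sup>2 + e) + ln (s\<^sup>2 + e)"

lemma contrast_measurable [measurable]:
  assumes [measurable]: "f \<in> borel_measurable M" "g \<in> borel_measurable M"
  shows "(\<lambda>x. contrast e (f x) (g x)) \<in> borel_measurable M"
  unfolding contrast_def by measurable

lemma abs_le_sqrt_mult:
  assumes "0 < e"
  shows "2 * \<bar>s\<bar> * sqrt e \<le> s\<^sup>2 + (e::real)"
  using sum_squares_bound[of "\<bar>s\<bar>" "sqrt e"] assms by simp

lemma ln_square_lipschitz:
  assumes e: "0 < e"
  shows "\<bar>ln (s\<^sup>2 + e) - ln (t\<^sup>2 + e)\<bar> \<le> \<bar>s - t\<bar> / sqrt e"
proof -
  have "norm (ln (s\<^sup>2 + e) - ln (t\<^sup>2 + e)) \<le> 1 / sqrt e * norm (s - t)"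
  proof (rule field_differentiable_bound[of UNIV "\<lambda>u. ln (u\<^sup>2 + e)" "\<lambda>u. 2 * u / (u\<^sup>2 + e)"])
    fix u
    have p: "0 < u\<^sup>2 + e" using e by (simp add: add_nonneg_pos)
    show "((\<lambda>u. ln (u\<^sup>2 + e)) has_field_derivative 2 * u / (u\<^sup>2 + e)) (at u within UNIV)"
      using p by (auto intro!: derivative_eq_intros)
    show "norm (2 * u / (u\<^sup>2 + e)) \<le> 1 / sqrt e"
      using abs_le_sqrt_mult[OF e, of u] p e by (simp add: abs_mult divide_simps)
  qed auto
  then show ?thesis by simp
qed

lemma inverse_square_lipschitz:
  assumes e: "0 < e"
  shows "\<bar>1 / (s\<^sup>2 + e) - 1 / (t\<^sup>2 + e)\<bar> \<le> min (1 / e) (\<bar>s - t\<bar> / (e * sqrt e))"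
proof -
  have "norm (1 / (s\<^sup>2 + e) - 1 / (t\<^sup>2 + e)) \<le> 1 / (e * sqrt e) * norm (s - t)"
  proof (rule field_differentiable_bound[of UNIV "\<lambda>u. 1 / (u\<^sup>2 + e)" "\<lambda>u. - (2 * u) / (u\<^sup>2 + e)\<^sup>2"])
    fix u
    have p: "0 < u\<^sup>2 + e" using e by (simp add: add_nonneg_pos)
    show "((\<lambda>u. 1 / (u\<^sup>2 + e)) has_field_derivative - (2 * u) / (u\<^sup>2 + e)\<^sup>2) (at u within UNIV)"
      using p by (auto intro!: derivative_eq_intros simp: power2_eq_square)
    have "(2 * \<bar>u\<bar> * sqrt e) * e \<le> (u\<^sup>2 + e) * (u\<^sup>2 + e)"
      using abs_le_sqrt_mult[OF e, of u] p e by (intro mult_mono) auto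
    then show "norm (- (2 * u) / (u\<^sup>2 + e)\<^sup>2) \<le> 1 / (e * sqrt e)"
      using p e by (simp add: abs_mult power2_eq_square divide_simps mult.commute mult.left_commute)
  qed auto
  moreover have "0 \<le> 1 / (u\<^sup>2 + e)" "1 / (u\<^sup>2 + e) \<le> 1 / e" for u
    using e by (auto simp: divide_simps add_nonneg_pos)
  then have "\<bar>1 / (s\<^sup>2 + e) - 1 / (t\<^sup>2 + e)\<bar> \<le> 1 / e"
    by (smt (verit))
  ultimately show ?thesis by simp
qed

text \<open>
  The minimum with $1/e$ matters: $z^2$ is to be replaced by an observation with no more than a second
  moment, so that its product with an integrable, unbounded \<open>h\<close> need not be integrable.
\<close>

lemma contrast_lipschitz:
  assumes e: "0 < e" and h: "\<bar>s - t\<bar> \<le> h"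
  shows "\<bar>contrast e z s - contrast e z t\<bar> \<le> (z\<^sup>2 + e) * min (1 / e) (h / (e * sqrt e)) + h / sqrt e"
proof -
  have "contrast e z s - contrast e z t
      = (z\<^sup>2 + e) * (1 / (s\<^sup>2 + e) - 1 / (t\<^sup>2 + e)) + (ln (s\<^sup>2 + e) - ln (t\<^sup>2 + e))"
    by (simp add: contrast_def right_diff_distrib)
  also have "\<bar>\<dots>\<bar> \<le> (z\<^sup>2 + e) * min (1 / e) (\<bar>s - t\<bar> / (e * sqrt e)) + \<bar>s - t\<bar> / sqrt e"
    using inverse_square_lipschitz[OF e, of s t] ln_square_lipschitz[OF e, of s t] e
    by (intro order_trans[OF abs_triangle_ineq] add_mono) (auto simp: abs_mult intro!: mult_left_mono)
  also have "\<dots> \<le> (z\<^sup>2 + e) * min (1 / e) (h / (e * sqrt e)) + h / sqrt e"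
    using e h by (intro add_mono mult_left_mono min.mono divide_right_mono) auto
  finally show ?thesis .
qed

section \<open>Identifiability and the expected contrast\<close>

locale larch_model = driven_volatility +
  fixes d\<^sub>0 c\<^sub>0 a\<^sub>0 e :: real
  assumes d\<^sub>0: "0 \<le> d\<^sub>0" "d\<^sub>0 \<le> q - \<delta>" and c\<^sub>0_pos: "0 < c\<^sub>0" and a\<^sub>0_pos: "0 < a\<^sub>0" and e_pos: "0 < e"
    and \<phi>_eq: "AE x in path_measure. \<phi> x = a\<^sub>0 + c\<^sub>0 * filter_sum d\<^sub>0 x"
begin

text \<open>
  Where the volatility at time $-k$ is nonzero, the combination vanishes only if the innovation at time
  $-k$ takes a value determined by the path before $-k$.
\<close>

lemma lag_combination_nonzero:
  assumes F[measurable]: "F \<in> borel_measurable path_measure" and dF: "depends_on {..<- int k} F" and \<kappa>: "\<kappa> \<noteq> 0"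
  shows "AE x in path_measure. \<phi> (time_shift (- int k) x) \<noteq> 0 \<longrightarrow> \<kappa> * lag k x + F x \<noteq> 0"
proof -
  define W where "W x = - F x / (\<kappa> * \<phi> (time_shift (- int k) x))" for x
  have "AE x in path_measure. x (- int k) \<noteq> W x"
  proof (rule coord_neq)
    show "W \<in> borel_measurable path_measure" unfolding W_def by measurable
    show "depends_on {..<- int k} W"
      unfolding W_def by (rule depends_on_comp2[OF dF \<phi>_lag_depends])
  qed simp
  then show ?thesis
  proof eventually_elim
    case (elim x)
    then show ?case using \<kappa> by (auto simp: W_def lag_def field_simps)
  qed
qed

text \<open>
  The volatility at a time can vanish only if it vanishes one step earlier, hence only if it has always
  vanished.  But then all past observations are 0 and the volatility equals $a_0 > 0$.
\<close>

lemma \<phi>_nonzero: "AE x in path_measure. \<phi> x \<noteq> 0"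
proof -
  define F where "F x = a\<^sub>0 + c\<^sub>0 * (2 powr (d\<^sub>0 - 1) * lag 2 x + remote_filter d\<^sub>0 x)" for x
  have "AE x in path_measure. \<phi> (time_shift (- int 1) x) \<noteq> 0 \<longrightarrow> c\<^sub>0 * lag 1 x + F x \<noteq> 0"
  proof (rule lag_combination_nonzero)
    show "F \<in> borel_measurable path_measure" unfolding F_def by measurable
    show "depends_on {..<- int 1} F"
      unfolding F_def
      by (intro depends_on_comp2[of _ "lag 2" "remote_filter d\<^sub>0" "\<lambda>y z. a\<^sub>0 + c\<^sub>0 * (2 powr (d\<^sub>0 - 1) * y + z)"]
        lag_predictable depends_on_mono[OF remote_filter_depends]) auto
  qed (use c\<^sub>0_pos in simp)
  then have "AE x in path_measure. \<phi> x = 0 \<longrightarrow> \<phi> (time_shift (- 1) x) = 0"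
    using \<phi>_eq AE_regular_path
  proof eventually_elim
    case (elim x)
    then show ?case using filter_sum_decompose[OF elim(3) d\<^sub>0] by (auto simp: F_def algebra_simps)
  qed
  then have "AE x in path_measure. \<forall>k. \<phi> (time_shift (- int k) x) = 0 \<longrightarrow> \<phi> (time_shift (- 1) (time_shift (- int k) x)) = 0"
    by (auto simp only: AE_all_countable intro!: AE_shift)
  with \<phi>_eq show ?thesis
  proof eventually_elim
    case (elim x)
    show ?case
    proof
      assume z: "\<phi> x = 0"
      have "\<phi> (time_shift (- int k) x) = 0" for k
      proof (induction k)
        case (Suc k)
        then show ?case using elim(2)[rule_format, of k] by (simp add: algebra_simps)
      qed (use z in simp)
      then have "lag k x = 0" for k by (simp add: lag_def)
      then have "filter_sum d\<^sub>0 x = 0" by (simp add: filter_sum_def partial_filter_def)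
      then show False using elim(1) z a\<^sub>0_pos by simp
    qed
  qed
qed

text \<open>
  The set is convenient rather than natural: it contains a compact box around the parameter space, and
  the bound 1 for \<open>c\<close> gives the volatility a Lipschitz constant that does not depend on the parameters.
\<close>

definition admissible :: "real \<times> real \<times> real \<Rightarrow> bool" where
  "admissible = (\<lambda>(d, c, a). 0 \<le> d \<and> d \<le> q - \<delta> \<and> 0 \<le> c \<and> c \<le> 1)"

definition model_volatility :: "real \<times> real \<times> real \<Rightarrow> (int \<Rightarrow> real) \<Rightarrow> real" where
  "model_volatility = (\<lambda>(d, c, a) x. a + c * filter_sum d x)"

lemma model_volatility_measurable [measurable]: "model_volatility \<theta> \<in> borel_measurable path_measure"
  by (cases \<theta>) (simp add: model_volatility_def)

lemma model_volatility_predictable: "depends_on {..<0} (model_volatility \<theta>)"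
  by (cases \<theta>) (auto simp: model_volatility_def intro!: depends_on_comp[OF filter_sum_predictable, of "\<lambda>y. _ + _ * y"])

lemma volatility_combination_nonzero:
  assumes F[measurable]: "F \<in> borel_measurable path_measure" and dF: "depends_on {..<- int k} F" and \<kappa>: "\<kappa> \<noteq> 0"
  shows "AE x in path_measure. \<kappa> * lag k x + F x \<noteq> 0"
  using lag_combination_nonzero[OF assms] AE_shift[OF \<phi>_nonzero, of "- int k"] by eventually_elim simp

text \<open>
  The sum of the two volatilities has the coefficient $c + c_0 > 0$ at lag 1, so it does not vanish and
  the volatilities themselves agree.  Their difference then has vanishing coefficients at lag 1, which is
  $c - c_0$, and at lag 2, which gives \<open>d = d\<^sub>0\<close>; the constant term remains.
\<close>

lemma identification:
  assumes \<theta>: "admissible \<theta>" and eq: "AE x in path_measure. (model_volatility \<theta> x)\<^sup>2 = (\<phi> x)\<^sup>2"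
  shows "\<theta> = (d\<^sub>0, c\<^sub>0, a\<^sub>0)"
proof -
  obtain d c a where \<theta>_def: "\<theta> = (d, c, a)" by (cases \<theta>)
  have d: "0 \<le> d" "d \<le> q - \<delta>" and c: "0 \<le> c" using \<theta> by (auto simp: admissible_def \<theta>_def)
  have dep: "depends_on {..<- int 1} (\<lambda>x. h (lag 2 x) (remote_filter d x) (remote_filter d\<^sub>0 x))" for h :: "real \<Rightarrow> real \<Rightarrow> real \<Rightarrow> real"
  proof -
    have r: "depends_on {..<- int 1} (remote_filter d)" for d by (rule depends_on_mono[OF remote_filter_depends]) auto
    have "depends_on {..<- int 1} (lag 2)" by (rule lag_predictable) simp
    from depends_on_comp2[OF this depends_on_comp2[OF r[of d] r[of d\<^sub>0], of Pair], of "\<lambda>y p. h y (fst p) (snd p)"]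
    show ?thesis by simp
  qed
  have "AE x in path_measure. (c + c\<^sub>0) * lag 1 x +
      (a + a\<^sub>0 + c * (2 powr (d - 1) * lag 2 x + remote_filter d x)
        + c\<^sub>0 * (2 powr (d\<^sub>0 - 1) * lag 2 x + remote_filter d\<^sub>0 x)) \<noteq> 0"
    by (rule volatility_combination_nonzero[OF _ dep]) (use c c\<^sub>0_pos in auto)
  with eq \<phi>_eq AE_regular_path have same: "AE x in path_measure. model_volatility \<theta> x = \<phi> x"
  proof eventually_elim
    case (elim x)
    have "model_volatility \<theta> x + \<phi> x \<noteq> 0"
      using elim(2,4) filter_sum_decompose[OF elim(3) d\<^sub>0] filter_sum_decompose[OF elim(3) d]
      by (simp add: model_volatility_def \<theta>_def algebra_simps)
    then show ?case using elim(1) by (auto simp: power2_eq_iff)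
  qed
  have ex: False if "AE x in path_measure. \<not> Q x" "AE x in path_measure. Q x" for Q
  proof -
    have "AE x in path_measure. False" using that by eventually_elim simp
    then show False by simp
  qed
  have "c = c\<^sub>0"
  proof (rule ccontr)
    assume "c \<noteq> c\<^sub>0"
    then have "AE x in path_measure. (c - c\<^sub>0) * lag 1 x +
      (a - a\<^sub>0 + c * (2 powr (d - 1) * lag 2 x + remote_filter d x)
        - c\<^sub>0 * (2 powr (d\<^sub>0 - 1) * lag 2 x + remote_filter d\<^sub>0 x)) \<noteq> 0"
      by (intro volatility_combination_nonzero[OF _ dep]) auto
    with \<phi>_eq AE_regular_path have "AE x in path_measure. model_volatility \<theta> x \<noteq> \<phi> x"
    proof eventually_elim
      case (elim x)
      then show ?case
        using filter_sum_decompose[OF elim(2) d\<^sub>0] filter_sum_decompose[OF elim(2) d]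
        by (simp add: model_volatility_def \<theta>_def algebra_simps)
    qed
    with same show False by (rule ex[rotated])
  qed
  have "d = d\<^sub>0"
  proof (rule ccontr)
    assume "d \<noteq> d\<^sub>0"
    then have "(2::real) powr (d - 1) \<noteq> 2 powr (d\<^sub>0 - 1)" by (simp add: powr_inj)
    then have n: "c\<^sub>0 * (2 powr (d - 1) - 2 powr (d\<^sub>0 - 1)) \<noteq> 0" using c\<^sub>0_pos by simp
    have "depends_on {..<- int 2} (\<lambda>x. a - a\<^sub>0 + c\<^sub>0 * (remote_filter d x - remote_filter d\<^sub>0 x))"
      by (rule depends_on_comp2[of _ "remote_filter d" "remote_filter d\<^sub>0" "\<lambda>y z. a - a\<^sub>0 + c\<^sub>0 * (y - z)"])
         (use remote_filter_depends in auto)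
    from volatility_combination_nonzero[OF _ this n]
    have "AE x in path_measure. c\<^sub>0 * (2 powr (d - 1) - 2 powr (d\<^sub>0 - 1)) * lag 2 x
       + (a - a\<^sub>0 + c\<^sub>0 * (remote_filter d x - remote_filter d\<^sub>0 x)) \<noteq> 0" by simp
    with \<phi>_eq AE_regular_path have "AE x in path_measure. model_volatility \<theta> x \<noteq> \<phi> x"
    proof eventually_elim
      case (elim x)
      then show ?case
        using filter_sum_decompose[OF elim(2) d\<^sub>0] filter_sum_decompose[OF elim(2) d] \<open>c = c\<^sub>0\<close>
        by (simp add: model_volatility_def \<theta>_def algebra_simps)
    qed
    with same show False by (rule ex[rotated])
  qed
  have "a = a\<^sub>0"
  proof (rule ccontr)
    assume "a \<noteq> a\<^sub>0"
    from \<phi>_eq have "AE x in path_measure. model_volatility \<theta> x \<noteq> \<phi> x"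
    proof eventually_elim
      case (elim x)
      then show ?case using \<open>a \<noteq> a\<^sub>0\<close> by (simp add: model_volatility_def \<theta>_def \<open>c = c\<^sub>0\<close> \<open>d = d\<^sub>0\<close>)
    qed
    with same show False by (rule ex[rotated])
  qed
  then show ?thesis using \<open>c = c\<^sub>0\<close> \<open>d = d\<^sub>0\<close> \<theta>_def by simp
qed

definition path_contrast :: "real \<times> real \<times> real \<Rightarrow> (int \<Rightarrow> real) \<Rightarrow> real" where
  "path_contrast \<theta> x = contrast e (lag 0 x) (model_volatility \<theta> x)"

definition expected_contrast :: "real \<times> real \<times> real \<Rightarrow> real" where
  "expected_contrast \<theta> = (\<integral>x. path_contrast \<theta> x \<partial>path_measure)"

definition contrast_modulus :: "real \<Rightarrow> (int \<Rightarrow> real) \<Rightarrow> real" where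
  "contrast_modulus h x = ((lag 0 x)\<^sup>2 + e) * min (1 / e) (h * (1 + 2 * envelope x) / (e * sqrt e))
     + h * (1 + 2 * envelope x) / sqrt e"

lemma path_contrast_measurable [measurable]: "path_contrast \<theta> \<in> borel_measurable path_measure"
  unfolding path_contrast_def by measurable

lemma envelope_measurable [measurable]: "envelope \<in> borel_measurable path_measure"
  using envelope_integrable by auto

lemma model_volatility_lipschitz:
  assumes x: "regular_path x" and \<theta>: "admissible \<theta>" and \<theta>': "admissible \<theta>'"
  shows "\<bar>model_volatility \<theta> x - model_volatility \<theta>' x\<bar> \<le> dist \<theta> \<theta>' * (1 + 2 * envelope x)"
proof -
  obtain d c a where 1: "\<theta> = (d, c, a)" by (cases \<theta>)
  obtain d' c' a' where 2: "\<theta>' = (d', c', a')" by (cases \<theta>')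
  have d: "0 \<le> d" "d \<le> q - \<delta>" "0 \<le> c" "c \<le> 1" and d': "0 \<le> d'" "d' \<le> q - \<delta>"
    using \<theta> \<theta>' by (auto simp: admissible_def 1 2)
  have H: "0 \<le> envelope x" by (rule envelope_nonneg[OF x])
  have D: "\<bar>d - d'\<bar> \<le> dist \<theta> \<theta>'" "\<bar>c - c'\<bar> \<le> dist \<theta> \<theta>'" "\<bar>a - a'\<bar> \<le> dist \<theta> \<theta>'"
    using dist_fst_le[of \<theta> \<theta>'] dist_snd_le[of \<theta> \<theta>'] dist_fst_le[of "snd \<theta>" "snd \<theta>'"] dist_snd_le[of "snd \<theta>" "snd \<theta>'"]
    by (auto simp: 1 2 dist_real_def)
  have "model_volatility \<theta> x - model_volatility \<theta>' x
      = (a - a') + (c - c') * filter_sum d' x + c * (filter_sum d x - filter_sum d' x)"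
    by (simp add: model_volatility_def 1 2 algebra_simps)
  also have "\<bar>\<dots>\<bar> \<le> \<bar>a - a'\<bar> + \<bar>c - c'\<bar> * \<bar>filter_sum d' x\<bar> + c * \<bar>filter_sum d x - filter_sum d' x\<bar>"
    using d(3) by (intro order_trans[OF abs_triangle_ineq] add_mono) (auto simp: abs_mult)
  also have "\<dots> \<le> dist \<theta> \<theta>' + dist \<theta> \<theta>' * envelope x + 1 * (dist \<theta> \<theta>' * envelope x)"
  proof (intro add_mono mult_mono)
    show "\<bar>filter_sum d x - filter_sum d' x\<bar> \<le> dist \<theta> \<theta>' * envelope x"
      by (rule order_trans[OF filter_sum_lipschitz[OF x d(1,2) d']]) (use D H in \<open>auto intro: mult_right_mono\<close>)
  qed (use D H d filter_sum_bound[OF x d'] in auto)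
  finally show ?thesis by (simp add: algebra_simps)
qed

lemma path_contrast_modulus:
  assumes "regular_path x" "admissible \<theta>" "admissible \<theta>'" "dist \<theta> \<theta>' \<le> h"
  shows "\<bar>path_contrast \<theta> x - path_contrast \<theta>' x\<bar> \<le> contrast_modulus h x"
  unfolding path_contrast_def contrast_modulus_def
proof (rule contrast_lipschitz[OF e_pos])
  have "dist \<theta> \<theta>' * (1 + 2 * envelope x) \<le> h * (1 + 2 * envelope x)"
    using assms envelope_nonneg[of x] by (intro mult_right_mono) auto
  then show "\<bar>model_volatility \<theta> x - model_volatility \<theta>' x\<bar> \<le> h * (1 + 2 * envelope x)"
    using model_volatility_lipschitz[OF assms(1-3)] by linarith
qed

lemma squared_observation_integrable: "integrable path_measure (\<lambda>x. (lag 0 x)\<^sup>2)"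
  using lag_square_integrable[of 0] by (simp add: square_integrable_def)

lemma contrast_modulus_integrable:
  assumes "0 \<le> h"
  shows "integrable path_measure (contrast_modulus h)"
proof -
  have "integrable path_measure (\<lambda>x. ((lag 0 x)\<^sup>2 + e) * min (1 / e) (h * (1 + 2 * envelope x) / (e * sqrt e)))"
  proof (rule Bochner_Integration.integrable_bound)
    show "integrable path_measure (\<lambda>x. ((lag 0 x)\<^sup>2 + e) * (1 / e))" using squared_observation_integrable by simp
    show "AE x in path_measure. norm (((lag 0 x)\<^sup>2 + e) * min (1 / e) (h * (1 + 2 * envelope x) / (e * sqrt e)))
        \<le> norm (((lag 0 x)\<^sup>2 + e) * (1 / e))"
      using AE_regular_path
    proof eventually_elim
      case (elim x)
      then have "0 \<le> h * (1 + 2 * envelope x) / (e * sqrt e)" using envelope_nonneg[OF elim] assms e_pos by auto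
      then have "\<bar>min (1 / e) (h * (1 + 2 * envelope x) / (e * sqrt e))\<bar> \<le> \<bar>1 / e\<bar>" using e_pos by simp
      then show ?case unfolding real_norm_def abs_mult by (intro mult_left_mono) auto
    qed
  qed measurable
  then show ?thesis
    unfolding contrast_modulus_def[abs_def] using envelope_integrable by auto
qed

text \<open>
  Dominated convergence with the modulus at 1; of its two summands one is at most $(X_0^2 + e) / e$ and
  the other is a multiple of the integrable $1 + 2 H$, where $H$ is the envelope.
\<close>

lemma contrast_modulus_tendsto_0:
  "(\<lambda>k. \<integral>x. contrast_modulus (1 / real (Suc k)) x \<partial>path_measure) \<longlonglongrightarrow> 0"
proof -
  have "(\<lambda>k. \<integral>x. contrast_modulus (1 / real (Suc k)) x \<partial>path_measure) \<longlonglongrightarrow> (\<integral>x. 0 \<partial>path_measure)"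
  proof (rule integral_dominated_convergence[where w="contrast_modulus 1"])
    show "integrable path_measure (contrast_modulus 1)" by (rule contrast_modulus_integrable) simp
    show "contrast_modulus (1 / real (Suc k)) \<in> borel_measurable path_measure" for k
      unfolding contrast_modulus_def by measurable
    show "AE x in path_measure. (\<lambda>k. contrast_modulus (1 / real (Suc k)) x) \<longlonglongrightarrow> 0"
    proof (rule AE_I2)
      fix x
      have t: "(\<lambda>k. 1 / real (Suc k)) \<longlonglongrightarrow> 0" using LIMSEQ_inverse_real_of_nat by (simp add: inverse_eq_divide)
      have "(\<lambda>k. contrast_modulus (1 / real (Suc k)) x) \<longlonglongrightarrow>
        ((lag 0 x)\<^sup>2 + e) * min (1 / e) (0 * (1 + 2 * envelope x) / (e * sqrt e)) + 0 * (1 + 2 * envelope x) / sqrt e"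
        unfolding contrast_modulus_def using e_pos by (intro tendsto_intros t) auto
      then show "(\<lambda>k. contrast_modulus (1 / real (Suc k)) x) \<longlonglongrightarrow> 0" using e_pos by simp
    qed
    show "AE x in path_measure. norm (contrast_modulus (1 / real (Suc k)) x) \<le> contrast_modulus 1 x" for k
      using AE_regular_path
    proof eventually_elim
      case (elim x)
      define y where "y = 1 + 2 * envelope x"
      have y: "0 \<le> y" using envelope_nonneg[OF elim] by (simp add: y_def)
      then have "1 / real (Suc k) * y \<le> 1 * y" by (intro mult_right_mono) auto
      then have "contrast_modulus (1 / real (Suc k)) x \<le> contrast_modulus 1 x"
        unfolding contrast_modulus_def y_def[symmetric] using e_pos
        by (intro add_mono mult_left_mono min.mono divide_right_mono) auto
      moreover have "0 \<le> contrast_modulus (1 / real (Suc k)) x"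
        unfolding contrast_modulus_def y_def[symmetric] using e_pos y
        by (intro add_nonneg_nonneg mult_nonneg_nonneg divide_nonneg_nonneg min.boundedI) auto
      ultimately show ?case by simp
    qed
  qed simp
  then show ?thesis by simp
qed

lemma path_contrast_integrable:
  assumes \<theta>: "admissible \<theta>"
  shows "integrable path_measure (path_contrast \<theta>)"
    and "integrable path_measure (\<lambda>x. ln ((model_volatility \<theta> x)\<^sup>2 + e))"
proof -
  obtain d c a where 1: "\<theta> = (d, c, a)" by (cases \<theta>)
  have d: "0 \<le> d" "d \<le> q - \<delta>" "0 \<le> c" "c \<le> 1"
    using \<theta> by (auto simp: admissible_def 1)
  show l: "integrable path_measure (\<lambda>x. ln ((model_volatility \<theta> x)\<^sup>2 + e))"
  proof (rule Bochner_Integration.integrable_bound)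
    show "integrable path_measure (\<lambda>x. \<bar>ln e\<bar> + (\<bar>a\<bar> + envelope x) / sqrt e)"
      using envelope_integrable by auto
    show "AE x in path_measure. norm (ln ((model_volatility \<theta> x)\<^sup>2 + e)) \<le> norm (\<bar>ln e\<bar> + (\<bar>a\<bar> + envelope x) / sqrt e)"
      using AE_regular_path
    proof eventually_elim
      case (elim x)
      have H: "0 \<le> envelope x" by (rule envelope_nonneg[OF elim])
      have "c * \<bar>filter_sum d x\<bar> \<le> 1 * envelope x"
        using d filter_sum_bound[OF elim d(1,2)] by (intro mult_mono) auto
      then have "\<bar>model_volatility \<theta> x\<bar> \<le> \<bar>a\<bar> + envelope x"
        unfolding model_volatility_def 1 using d abs_triangle_ineq[of a "c * filter_sum d x"] by (simp add: abs_mult)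
      then have "\<bar>model_volatility \<theta> x - 0\<bar> / sqrt e \<le> (\<bar>a\<bar> + envelope x) / sqrt e"
        using e_pos by (intro divide_right_mono) auto
      then have "\<bar>ln ((model_volatility \<theta> x)\<^sup>2 + e) - ln (0\<^sup>2 + e)\<bar> \<le> (\<bar>a\<bar> + envelope x) / sqrt e"
        using ln_square_lipschitz[OF e_pos, of "model_volatility \<theta> x" 0] by linarith
      then show ?case using H e_pos by simp
    qed
  qed measurable
  have "integrable path_measure (\<lambda>x. ((lag 0 x)\<^sup>2 + e) / ((model_volatility \<theta> x)\<^sup>2 + e))"
  proof (rule Bochner_Integration.integrable_bound)
    show "integrable path_measure (\<lambda>x. ((lag 0 x)\<^sup>2 + e) / e)" using squared_observation_integrable by simp
    show "AE x in path_measure. norm (((lag 0 x)\<^sup>2 + e) / ((model_volatility \<theta> x)\<^sup>2 + e)) \<le> norm (((lag 0 x)\<^sup>2 + e) / e)"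
      using e_pos by (intro AE_I2) (auto simp: abs_div_pos add_nonneg_pos intro!: divide_left_mono)
  qed measurable
  then show "integrable path_measure (path_contrast \<theta>)"
    unfolding path_contrast_def[abs_def] contrast_def using l by simp
qed

text \<open>
  The squared innovation at time 0 is independent of everything else in the contrast, so it may be
  replaced by its expectation 1.
\<close>

lemma expected_contrast_eq:
  assumes \<theta>: "admissible \<theta>"
  shows "integrable path_measure (\<lambda>x. ((\<phi> x)\<^sup>2 + e) / ((model_volatility \<theta> x)\<^sup>2 + e))"
    and "expected_contrast \<theta> = (\<integral>x. ((\<phi> x)\<^sup>2 + e) / ((model_volatility \<theta> x)\<^sup>2 + e) \<partial>path_measure)
      + (\<integral>x. ln ((model_volatility \<theta> x)\<^sup>2 + e) \<partial>path_measure)"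
proof -
  define f where "f x = (\<phi> x)\<^sup>2 / ((model_volatility \<theta> x)\<^sup>2 + e)" for x
  define g where "g x = e / ((model_volatility \<theta> x)\<^sup>2 + e)" for x
  have pos: "0 < (model_volatility \<theta> x)\<^sup>2 + e" for x using e_pos by (simp add: add_nonneg_pos)
  have fi: "integrable path_measure f"
  proof (rule Bochner_Integration.integrable_bound)
    show "integrable path_measure (\<lambda>x. (\<phi> x)\<^sup>2 / e)" using \<phi>_square_integrable by (simp add: square_integrable_def)
    show "AE x in path_measure. norm (f x) \<le> norm ((\<phi> x)\<^sup>2 / e)"
      unfolding f_def using e_pos pos by (intro AE_I2) (auto simp: abs_div_pos intro!: divide_left_mono)
    show "f \<in> borel_measurable path_measure" unfolding f_def by measurable
  qed
  have gi: "integrable path_measure g"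
  proof (rule N.integrable_const_bound[of _ 1])
    show "AE x in path_measure. norm (g x) \<le> 1"
      unfolding g_def using e_pos pos by (intro AE_I2) (auto simp: abs_div_pos)
    show "g \<in> borel_measurable path_measure" unfolding g_def by measurable
  qed
  have fd: "depends_on {..<0} f"
    unfolding f_def by (rule depends_on_comp2[OF \<phi>_predictable model_volatility_predictable, of "\<lambda>y z. y\<^sup>2 / (z\<^sup>2 + e)"])
  note c = coord_mult(2,3)[OF fi fd, of 0, simplified]
  have p: "path_contrast \<theta> x = (x 0)\<^sup>2 * f x + g x + ln ((model_volatility \<theta> x)\<^sup>2 + e)" for x
    by (simp add: path_contrast_def contrast_def f_def g_def lag_def power_mult_distrib add_divide_distrib)
  have s: "((\<phi> x)\<^sup>2 + e) / ((model_volatility \<theta> x)\<^sup>2 + e) = f x + g x" for x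
    by (simp add: f_def g_def add_divide_distrib)
  show "integrable path_measure (\<lambda>x. ((\<phi> x)\<^sup>2 + e) / ((model_volatility \<theta> x)\<^sup>2 + e))"
    unfolding s using fi gi by simp
  show "expected_contrast \<theta> = (\<integral>x. ((\<phi> x)\<^sup>2 + e) / ((model_volatility \<theta> x)\<^sup>2 + e) \<partial>path_measure)
      + (\<integral>x. ln ((model_volatility \<theta> x)\<^sup>2 + e) \<partial>path_measure)"
    unfolding s expected_contrast_def p
    using fi gi c path_contrast_integrable(2)[OF \<theta>] by simp
qed

lemma expected_contrast_minimal:
  assumes \<theta>: "admissible \<theta>" and \<theta>\<^sub>0: "admissible (d\<^sub>0, c\<^sub>0, a\<^sub>0)" and ne: "\<theta> \<noteq> (d\<^sub>0, c\<^sub>0, a\<^sub>0)"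
  shows "expected_contrast (d\<^sub>0, c\<^sub>0, a\<^sub>0) < expected_contrast \<theta>"
proof -
  let ?\<theta> = "(d\<^sub>0, c\<^sub>0, a\<^sub>0)"
  have pos: "0 < y\<^sup>2 + e" for y :: real using e_pos by (simp add: add_nonneg_pos)
  have same: "AE x in path_measure. model_volatility ?\<theta> x = \<phi> x"
    using \<phi>_eq by eventually_elim (simp add: model_volatility_def)
  define u where "u x = ((\<phi> x)\<^sup>2 + e) / ((model_volatility \<theta> x)\<^sup>2 + e)" for x
  have [measurable]: "u \<in> borel_measurable path_measure" unfolding u_def by measurable
  have u0: "0 < u x" for x unfolding u_def using pos by simp
  have ui: "integrable path_measure u" unfolding u_def by (rule expected_contrast_eq(1)[OF \<theta>])
  have li: "integrable path_measure (\<lambda>x. ln ((\<phi> x)\<^sup>2 + e))"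
    using path_contrast_integrable(2)[OF \<theta>\<^sub>0] same by (subst integrable_cong_AE) auto
  have "(\<integral>x. ((\<phi> x)\<^sup>2 + e) / ((model_volatility ?\<theta> x)\<^sup>2 + e) \<partial>path_measure) = (\<integral>x. 1 \<partial>path_measure)"
    using same pos by (intro integral_cong_AE) (auto simp: less_imp_neq[OF pos, symmetric])
  moreover have "(\<integral>x. ln ((model_volatility ?\<theta> x)\<^sup>2 + e) \<partial>path_measure) = (\<integral>x. ln ((\<phi> x)\<^sup>2 + e) \<partial>path_measure)"
    using same by (intro integral_cong_AE) auto
  ultimately have E0: "expected_contrast ?\<theta> = 1 + (\<integral>x. ln ((\<phi> x)\<^sup>2 + e) \<partial>path_measure)"
    using expected_contrast_eq(2)[OF \<theta>\<^sub>0] by simp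
  have lu: "ln (u x) = ln ((\<phi> x)\<^sup>2 + e) - ln ((model_volatility \<theta> x)\<^sup>2 + e)" for x
    unfolding u_def using pos[of "\<phi> x"] pos[of "model_volatility \<theta> x"] by (simp add: ln_div)
  have lui: "integrable path_measure (\<lambda>x. ln (u x))"
    unfolding lu using li path_contrast_integrable(2)[OF \<theta>] by simp
  have diff: "expected_contrast \<theta> - expected_contrast ?\<theta> = (\<integral>x. u x - 1 - ln (u x) \<partial>path_measure)"
    using E0 expected_contrast_eq(2)[OF \<theta>] ui lui li path_contrast_integrable(2)[OF \<theta>]
    by (simp add: lu u_def[symmetric])
  have nn: "0 \<le> u x - 1 - ln (u x)" for x using ln_le_minus_one[OF u0[of x]] by simp
  have "(\<integral>x. u x - 1 - ln (u x) \<partial>path_measure) \<noteq> 0"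
  proof
    assume "(\<integral>x. u x - 1 - ln (u x) \<partial>path_measure) = 0"
    then have "AE x in path_measure. u x - 1 - ln (u x) = 0"
      using ui lui nn by (subst (asm) integral_nonneg_eq_0_iff_AE) auto
    then have "AE x in path_measure. (model_volatility \<theta> x)\<^sup>2 = (\<phi> x)\<^sup>2"
    proof eventually_elim
      case (elim x)
      then have "u x = 1" using ln_eq_minus_one[OF u0[of x]] by simp
      then show ?case using pos[of "model_volatility \<theta> x"] by (simp add: u_def)
    qed
    from identification[OF \<theta> this] ne show False by simp
  qed
  moreover have "0 \<le> (\<integral>x. u x - 1 - ln (u x) \<partial>path_measure)" using nn by simp
  ultimately show ?thesis using diff by linarith
qed

end

section \<open>Uniform convergence and minimisers\<close>

context larch_model
begin

definition empirical_contrast :: "nat \<Rightarrow> real \<times> real \<times> real \<Rightarrow> (int \<Rightarrow> real) \<Rightarrow> real" where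
  "empirical_contrast n \<theta> x = (\<Sum>t=1..int n. path_contrast \<theta> (time_shift t x)) / real n"

lemma expected_contrast_modulus:
  assumes "admissible \<theta>" "admissible \<theta>'" "dist \<theta> \<theta>' \<le> h" "0 \<le> h"
  shows "\<bar>expected_contrast \<theta> - expected_contrast \<theta>'\<bar> \<le> (\<integral>x. contrast_modulus h x \<partial>path_measure)"
proof -
  have i: "integrable path_measure (\<lambda>x. path_contrast \<theta> x - path_contrast \<theta>' x)"
    using path_contrast_integrable(1) assms by (intro Bochner_Integration.integrable_diff)
  have "\<bar>expected_contrast \<theta> - expected_contrast \<theta>'\<bar> = \<bar>\<integral>x. path_contrast \<theta> x - path_contrast \<theta>' x \<partial>path_measure\<bar>"
    unfolding expected_contrast_def using path_contrast_integrable(1) assms by simp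
  also have "\<dots> \<le> (\<integral>x. \<bar>path_contrast \<theta> x - path_contrast \<theta>' x\<bar> \<partial>path_measure)"
    by (rule integral_abs_bound)
  also have "\<dots> \<le> (\<integral>x. contrast_modulus h x \<partial>path_measure)"
  proof (rule integral_mono_AE)
    show "AE x in path_measure. \<bar>path_contrast \<theta> x - path_contrast \<theta>' x\<bar> \<le> contrast_modulus h x"
      using AE_regular_path by eventually_elim (rule path_contrast_modulus[OF _ assms(1-3)])
  qed (use i contrast_modulus_integrable[OF assms(4)] in auto)
  finally show ?thesis .
qed

lemma continuous_on_expected_contrast: "continuous_on {\<theta>. admissible \<theta>} expected_contrast"
  unfolding continuous_on_iff
proof (intro ballI allI impI)
  fix \<theta> and r :: real assume \<theta>: "\<theta> \<in> {\<theta>. admissible \<theta>}" and r: "0 < r"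
  obtain k where k: "(\<integral>x. contrast_modulus (1 / real (Suc k)) x \<partial>path_measure) < r"
    using order_tendstoD(2)[OF contrast_modulus_tendsto_0 r] by (auto simp: eventually_sequentially)
  show "\<exists>d>0. \<forall>\<theta>'\<in>{\<theta>. admissible \<theta>}. dist \<theta>' \<theta> < d \<longrightarrow> dist (expected_contrast \<theta>') (expected_contrast \<theta>) < r"
  proof (intro exI[of _ "1 / real (Suc k)"] conjI ballI impI)
    fix \<theta>' assume "\<theta>' \<in> {\<theta>. admissible \<theta>}" "dist \<theta>' \<theta> < 1 / real (Suc k)"
    then have "\<bar>expected_contrast \<theta>' - expected_contrast \<theta>\<bar> \<le> (\<integral>x. contrast_modulus (1 / real (Suc k)) x \<partial>path_measure)"
      using \<theta> by (intro expected_contrast_modulus) auto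
    then show "dist (expected_contrast \<theta>') (expected_contrast \<theta>) < r" using k by (simp add: dist_real_def)
  qed simp
qed

text \<open>
  The expected contrast exceeds its minimum by some $4 \kappa$ on \<open>K\<close>.  For a net so fine that the
  expected modulus is below $\kappa$, eventually the average modulus is below $\kappa$ too, and the empirical
  contrasts at the true parameter and on the net are within $\kappa$ of their expectations.
\<close>

lemma contrast_separation:
  assumes K: "compact K" "\<And>\<theta>. \<theta> \<in> K \<Longrightarrow> admissible \<theta>"
    and \<theta>\<^sub>0: "admissible (d\<^sub>0, c\<^sub>0, a\<^sub>0)" "(d\<^sub>0, c\<^sub>0, a\<^sub>0) \<notin> K"
  shows "AE x in path_measure. \<forall>\<^sub>F n in sequentially.
           \<forall>\<theta>\<in>K. empirical_contrast n (d\<^sub>0, c\<^sub>0, a\<^sub>0) x < empirical_contrast n \<theta> x"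
proof (cases "K = {}")
  case False
  let ?\<theta> = "(d\<^sub>0, c\<^sub>0, a\<^sub>0)"
  have "continuous_on K expected_contrast"
    by (rule continuous_on_subset[OF continuous_on_expected_contrast]) (use K in auto)
  then obtain \<theta>m where m: "\<theta>m \<in> K" "\<And>\<theta>. \<theta> \<in> K \<Longrightarrow> expected_contrast \<theta>m \<le> expected_contrast \<theta>"
    using continuous_attains_inf[OF K(1) False] by blast
  define \<kappa> where "\<kappa> = (expected_contrast \<theta>m - expected_contrast ?\<theta>) / 4"
  have "\<theta>m \<noteq> ?\<theta>" using m(1) \<theta>\<^sub>0(2) by blast
  then have \<kappa>: "0 < \<kappa>"
    unfolding \<kappa>_def using expected_contrast_minimal[OF K(2)[OF m(1)] \<theta>\<^sub>0(1)] by simp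
  obtain k where k: "(\<integral>x. contrast_modulus (1 / real (Suc k)) x \<partial>path_measure) < \<kappa>"
    using order_tendstoD(2)[OF contrast_modulus_tendsto_0 \<kappa>] by (auto simp: eventually_sequentially)
  define h where "h = 1 / real (Suc k)"
  have h: "0 < h" by (simp add: h_def)
  obtain F where F: "finite F" "F \<subseteq> K" "K \<subseteq> (\<Union>\<theta>\<in>F. ball \<theta> h)"
    using seq_compact_imp_totally_bounded[OF compact_imp_seq_compact[OF K(1)], rule_format, OF h] by blast
  have conv: "AE x in path_measure. \<forall>\<theta>\<in>insert ?\<theta> F. (\<lambda>n. empirical_contrast n \<theta> x) \<longlonglongrightarrow> expected_contrast \<theta>"
  proof (rule AE_finite_allI)
    fix \<theta> assume "\<theta> \<in> insert ?\<theta> F"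
    then have "admissible \<theta>" using F(2) K(2)[of \<theta>] \<theta>\<^sub>0(1) by blast
    from time_average_converges[OF path_contrast_integrable(1)[OF this]]
    show "AE x in path_measure. (\<lambda>n. empirical_contrast n \<theta> x) \<longlonglongrightarrow> expected_contrast \<theta>"
      by (simp add: empirical_contrast_def expected_contrast_def)
  qed (use F in auto)
  have mod: "AE x in path_measure. (\<lambda>n. (\<Sum>t=1..int n. contrast_modulus h (time_shift t x)) / real n)
      \<longlonglongrightarrow> (\<integral>x. contrast_modulus h x \<partial>path_measure)"
    using h by (intro time_average_converges contrast_modulus_integrable) simp
  have reg: "AE x in path_measure. \<forall>t. regular_path (time_shift t x)"
    unfolding AE_all_countable by (intro allI AE_shift AE_regular_path)
  show ?thesis using conv mod reg
  proof eventually_elim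
    case (elim x)
    note reg_x = elim(3)[rule_format]
    have 1: "\<forall>\<^sub>F n in sequentially. \<forall>\<theta>\<in>F. expected_contrast \<theta> - \<kappa> < empirical_contrast n \<theta> x"
      using F(1) elim(1) \<kappa> by (intro eventually_ball_finite ballI order_tendstoD(1)) auto
    have 2: "\<forall>\<^sub>F n in sequentially. empirical_contrast n ?\<theta> x < expected_contrast ?\<theta> + \<kappa>"
      using elim(1) \<kappa> by (intro order_tendstoD(2)) auto
    have 3: "\<forall>\<^sub>F n in sequentially. (\<Sum>t=1..int n. contrast_modulus h (time_shift t x)) / real n < \<kappa>"
      using elim(2) k unfolding h_def by (rule order_tendstoD(2))
    show ?case using 1 2 3
    proof eventually_elim
      case (elim n)
      show ?case
      proof
        fix \<theta> assume \<theta>: "\<theta> \<in> K"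
        then obtain \<theta>' where \<theta>': "\<theta>' \<in> F" "dist \<theta>' \<theta> < h" using F(3) by auto
        have "empirical_contrast n \<theta>' x - empirical_contrast n \<theta> x
            = (\<Sum>t=1..int n. path_contrast \<theta>' (time_shift t x) - path_contrast \<theta> (time_shift t x)) / real n"
          by (simp add: empirical_contrast_def sum_subtractf diff_divide_distrib)
        also have "\<dots> \<le> (\<Sum>t=1..int n. contrast_modulus h (time_shift t x)) / real n"
        proof (intro divide_right_mono sum_mono)
          fix t
          have "\<bar>path_contrast \<theta>' (time_shift t x) - path_contrast \<theta> (time_shift t x)\<bar> \<le> contrast_modulus h (time_shift t x)"
            using reg_x K(2)[of \<theta>] K(2)[of \<theta>'] F(2) \<theta> \<theta>' by (intro path_contrast_modulus) auto
          then show "path_contrast \<theta>' (time_shift t x) - path_contrast \<theta> (time_shift t x) \<le> contrast_modulus h (time_shift t x)"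
            by linarith
        qed simp
        also have "\<dots> < \<kappa>" by (rule elim(3))
        finally have "empirical_contrast n \<theta>' x - \<kappa> < empirical_contrast n \<theta> x" by linarith
        moreover have "expected_contrast \<theta>m \<le> expected_contrast \<theta>'" using m(2)[of \<theta>'] \<theta>'(1) F(2) by blast
        moreover have "expected_contrast \<theta>m = expected_contrast ?\<theta> + 4 * \<kappa>" by (simp add: \<kappa>_def field_simps)
        moreover have "expected_contrast \<theta>' - \<kappa> < empirical_contrast n \<theta>' x" using elim(1) \<theta>' by auto
        ultimately show "empirical_contrast n ?\<theta> x < empirical_contrast n \<theta> x" using elim(2) \<kappa> by linarith
      qed
    qed
  qed
qed simp

lemma contrast_minimizers_converge:
  assumes K: "compact K" "\<And>\<theta>. \<theta> \<in> K \<Longrightarrow> admissible \<theta>" and \<theta>\<^sub>0: "(d\<^sub>0, c\<^sub>0, a\<^sub>0) \<in> K"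
  shows "AE x in path_measure. \<forall>est. (\<forall>n\<ge>1. est n \<in> K \<and>
             empirical_contrast n (est n) x \<le> empirical_contrast n (d\<^sub>0, c\<^sub>0, a\<^sub>0) x) \<longrightarrow> est \<longlonglongrightarrow> (d\<^sub>0, c\<^sub>0, a\<^sub>0)"
proof -
  let ?\<theta> = "(d\<^sub>0, c\<^sub>0, a\<^sub>0)"
  have "AE x in path_measure. \<forall>k. \<forall>\<^sub>F n in sequentially.
     \<forall>\<theta>\<in>K - ball ?\<theta> (1 / real (Suc k)). empirical_contrast n ?\<theta> x < empirical_contrast n \<theta> x"
    unfolding AE_all_countable
  proof
    fix k
    show "AE x in path_measure. \<forall>\<^sub>F n in sequentially.
     \<forall>\<theta>\<in>K - ball ?\<theta> (1 / real (Suc k)). empirical_contrast n ?\<theta> x < empirical_contrast n \<theta> x"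
      by (rule contrast_separation) (use K \<theta>\<^sub>0 in \<open>auto intro: compact_diff\<close>)
  qed
  then show ?thesis
  proof eventually_elim
    case (elim x)
    show ?case
    proof (intro allI impI)
      fix est assume est: "\<forall>n\<ge>1. est n \<in> K \<and> empirical_contrast n (est n) x \<le> empirical_contrast n ?\<theta> x"
      show "est \<longlonglongrightarrow> ?\<theta>"
      proof (rule tendstoI)
        fix r :: real assume "0 < r"
        then obtain k where k: "1 / real (Suc k) < r" using reals_Archimedean[of r] by (auto simp: inverse_eq_divide)
        show "\<forall>\<^sub>F n in sequentially. dist (est n) ?\<theta> < r"
          using elim[rule_format, of k] eventually_ge_at_top[of 1]
        proof eventually_elim
          case (elim n)
          then have "est n \<in> ball ?\<theta> (1 / real (Suc k))" using est by (meson Diff_iff not_less)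
          then show ?case using k by (simp add: dist_commute)
        qed
      qed
    qed
  qed
qed

end

section \<open>Strong consistency\<close>

lemma c_upper_le:
  assumes "d < 1 / 2" "0 \<le> C"
  shows "c_upper C d \<le> C"
proof -
  have sm: "summable (\<lambda>j. real (Suc j) powr (2 * d - 2))"
    using assms by (subst summable_Suc_iff) (auto simp: summable_real_powr_iff)
  have "(\<Sum>j<1. real (Suc j) powr (2 * d - 2)) \<le> (\<Sum>j. real (Suc j) powr (2 * d - 2))"
    by (rule sum_le_suminf[OF sm]) auto
  then have "1 \<le> (\<Sum>j. real (Suc j) powr (2 * d - 2))" by simp
  then have "(\<Sum>j. real (Suc j) powr (2 * d - 2)) powr (- 1 / 2) \<le> 1"
    using powr_mono[of "- 1 / 2" 0 "\<Sum>j. real (Suc j) powr (2 * d - 2)"] by simp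
  then show ?thesis unfolding c_upper_def using assms by (simp add: mult_left_le)
qed

text \<open>
  By continuity \<open>f\<close> stays in a small interval on a neighbourhood of \<open>\<theta>\<close>.  So does \<open>y\<close> at the rational
  points of the neighbourhood, and by separability also at \<open>\<theta>\<close>.
\<close>

lemma separable_version_identified:
  fixes f :: "real \<times> real \<times> real \<Rightarrow> real"
  assumes sep: "\<And>A B. openin (top_of_set T) A \<Longrightarrow> closed B \<Longrightarrow> is_interval B \<Longrightarrow>
        (\<forall>\<theta>\<in>A \<inter> (\<rat> \<times> \<rat> \<times> \<rat>). y \<theta> \<in> B) \<Longrightarrow> (\<forall>\<theta>\<in>A. y \<theta> \<in> (B :: real set))"
    and f: "continuous_on T f" and eq: "\<And>\<theta>. \<theta> \<in> T \<inter> (\<rat> \<times> \<rat> \<times> \<rat>) \<Longrightarrow> y \<theta> = f \<theta>" and \<theta>: "\<theta> \<in> T"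
  shows "y \<theta> = f \<theta>"
proof (rule ccontr)
  assume ne: "y \<theta> \<noteq> f \<theta>"
  define r where "r = \<bar>y \<theta> - f \<theta>\<bar> / 2"
  have r: "0 < r" using ne by (simp add: r_def)
  define A where "A = T \<inter> f -` ball (f \<theta>) r"
  have "openin (top_of_set T) A"
    unfolding A_def using f by (rule continuous_openin_preimage_gen) simp
  moreover have "closed (cball (f \<theta>) r)" "is_interval (cball (f \<theta>) r)" by (auto simp: is_interval_cball_1)
  moreover have "\<forall>\<theta>'\<in>A \<inter> (\<rat> \<times> \<rat> \<times> \<rat>). y \<theta>' \<in> cball (f \<theta>) r" using eq by (auto simp: A_def)
  ultimately have "\<forall>\<theta>'\<in>A. y \<theta>' \<in> cball (f \<theta>) r" by (rule sep)
  moreover have "\<theta> \<in> A" using \<theta> r by (simp add: A_def)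
  ultimately have "y \<theta> \<in> cball (f \<theta>) r" by blast
  then show False using r by (simp add: r_def dist_real_def abs_minus_commute)
qed

theorem theorem1:
  fixes M :: "'w measure"
    and \<epsilon> X \<sigma> :: "int \<Rightarrow> 'w \<Rightarrow> real"
    and sig :: "int \<Rightarrow> real \<times> real \<times> real \<Rightarrow> 'w \<Rightarrow> real"
    and est :: "nat \<Rightarrow> 'w \<Rightarrow> real \<times> real \<times> real"
    and \<Theta> :: "(real \<times> real \<times> real) set"
    and \<theta>\<^sub>0 :: "real \<times> real \<times> real"
    and d\<^sub>u C a\<^sub>d a\<^sub>u e \<zeta> :: real
  assumes "prob_space M"
    and "innovations M \<epsilon>"
    and "0 < d\<^sub>u" "d\<^sub>u < 1 / 2" "0 < C" "C < 1" "0 < a\<^sub>d" "a\<^sub>d < a\<^sub>u"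
    and "\<Theta> = parameter_space d\<^sub>u C a\<^sub>d a\<^sub>u"
    and "\<theta>\<^sub>0 \<in> interior \<Theta>"
    and "stationary_larch M \<epsilon> (coeff_b \<theta>\<^sub>0) (intercept \<theta>\<^sub>0) X \<sigma>"
    and "\<And>t \<theta>. \<theta> \<in> \<Theta> \<Longrightarrow> linear_filter M (coeff_b \<theta>) (intercept \<theta>) X t (sig t \<theta>)"
    and "\<And>t. separable_process M \<Theta> (sig t)"
    and "0 < e"
    and "integrable M (\<lambda>\<omega>. \<bar>\<epsilon> 0 \<omega>\<bar> ^ 3)"
    and "0 < \<zeta>" "3 * \<zeta>\<^sup>2 - 3 * \<zeta> - 1 = 0"
    and "abs_moment M \<epsilon> 3 powr (1 / 3) * lp_norm 3 (coeff_b \<theta>\<^sub>0) + 3 * \<zeta> * lp_norm 2 (coeff_b \<theta>\<^sub>0) < 1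
       \<or> sqrt (2 ^ 3 - 3 - 1) * abs_moment M \<epsilon> 3 powr (1 / 3) * lp_norm 2 (coeff_b \<theta>\<^sub>0) < 1"
    and "\<And>n. n \<ge> 1 \<Longrightarrow>
           AE \<omega> in M. is_arg_min (\<lambda>\<theta>. L_contrast e X sig n \<theta> \<omega>) (\<lambda>\<theta>. \<theta> \<in> \<Theta>) (est n \<omega>)"
  shows "AE \<omega> in M. (\<lambda>n. est n \<omega>) \<longlonglongrightarrow> \<theta>\<^sub>0"
proof -
  note innov = assms(2) and du = assms(3,4) and \<Theta>_eq = assms(9) and \<theta>\<^sub>0_int = assms(10)
    and larch = assms(11) and filt = assms(12) and sep = assms(13) and e = assms(14) and argmin = assms(19)
  interpret M: prob_space M by (rule assms(1))
  obtain d\<^sub>0 c\<^sub>0 a\<^sub>0 where \<theta>\<^sub>0: "\<theta>\<^sub>0 = (d\<^sub>0, c\<^sub>0, a\<^sub>0)" by (cases \<theta>\<^sub>0)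
  have indep: "M.indep_vars (\<lambda>_. borel) \<epsilon> UNIV" using innov by (simp add: innovations_def)
  have [measurable]: "\<epsilon> t \<in> borel_measurable M" for t
    using indep unfolding M.indep_vars_def by auto
  define \<mu> where "\<mu> = distr M borel (\<epsilon> 0)"
  have \<mu>_eq: "distr M borel (\<epsilon> t) = \<mu>" for t using innov by (simp add: innovations_def \<mu>_def)
  have real_\<mu>: "real_distribution \<mu>" unfolding \<mu>_def by (rule M.real_distribution_distr) simp
  \<comment> \<open>Reduction to the space of paths of the innovations.\<close>
  interpret white_noise \<mu>
    unfolding white_noise_def white_noise_axioms_def noise_def
  proof (intro conjI allI)
    interpret R: real_distribution \<mu> by (rule real_\<mu>)
    show "prob_space \<mu>" by (rule R.prob_space_axioms)
    show "sets \<mu> = sets borel" by simp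
    have 0: "integrable M (\<epsilon> 0)" "(\<integral>\<omega>. \<epsilon> 0 \<omega> \<partial>M) = 0"
      "integrable M (\<lambda>\<omega>. (\<epsilon> 0 \<omega>)\<^sup>2)" "(\<integral>\<omega>. (\<epsilon> 0 \<omega>)\<^sup>2 \<partial>M) = 1"
      using innov by (auto simp: innovations_def)
    show "integrable \<mu> (\<lambda>y. y)" "integrable \<mu> (\<lambda>y. y\<^sup>2)"
      unfolding \<mu>_def using 0 by (simp_all add: integrable_distr_eq)
    show "(\<integral>y. y \<partial>\<mu>) = 0" "(\<integral>y. y\<^sup>2 \<partial>\<mu>) = 1"
      unfolding \<mu>_def using 0 by (simp_all add: integral_distr)
    fix y
    have "continuous_on UNIV (cdf \<mu>)" using innov by (simp add: innovations_def \<mu>_def)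
    then show "measure \<mu> {y} = 0" by (simp add: continuous_on_eq_continuous_at R.isCont_cdf)
  qed
  define E where "E \<omega> = (\<lambda>t. \<epsilon> t \<omega>)" for \<omega>
  have sets_path: "sets path_measure = sets (Pi\<^sub>M UNIV (\<lambda>_. borel))"
    unfolding path_measure_def by (intro sets_PiM_cong) (auto simp: sets_\<mu>)
  have E_borel: "E \<in> M \<rightarrow>\<^sub>M Pi\<^sub>M UNIV (\<lambda>_. borel)"
    unfolding E_def by (rule measurable_PiM_single') (auto simp: space_PiM PiE_UNIV_domain)
  have E: "E \<in> M \<rightarrow>\<^sub>M path_measure" using E_borel measurable_cong_sets[OF refl sets_path] by blast
  have distr_E: "distr M path_measure E = path_measure"
  proof -
    have "distr M path_measure E = distr M (Pi\<^sub>M UNIV (\<lambda>_. borel)) (\<lambda>\<omega>. \<lambda>t\<in>UNIV. \<epsilon> t \<omega>)"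
      by (rule distr_cong) (auto simp: sets_path E_def)
    also have "\<dots> = (\<Pi>\<^sub>M t\<in>UNIV. distr M borel (\<epsilon> t))"
      using indep by (subst (asm) M.indep_vars_iff_distr_eq_PiM) auto
    also have "\<dots> = path_measure" by (simp add: \<mu>_eq path_measure_def)
    finally show ?thesis .
  qed
  define E' where "E' t \<omega> = time_shift t (E \<omega>)" for t \<omega>
  have E': "E' t \<in> M \<rightarrow>\<^sub>M path_measure" for t
    unfolding E'_def by (rule measurable_compose[OF E measurable_shift])
  have distr_E': "distr M path_measure (E' t) = path_measure" for t
    using distr_distr[OF measurable_shift[of t] E] by (simp add: distr_E distr_shift E'_def[abs_def] comp_def)
  have AE_E': "AE \<omega> in M. Q (E' t \<omega>)" if "AE x in path_measure. Q x" for Q t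
    using that AE_distrD[OF E'[of t], of Q] by (simp only: distr_E')
  have XE: "AE \<omega> in M. X t \<omega> = \<epsilon> t \<omega> * \<sigma> t \<omega>" and \<sigma>_filt: "linear_filter M (coeff_b \<theta>\<^sub>0) (intercept \<theta>\<^sub>0) X t (\<sigma> t)"
    and \<sigma>_volt: "volterra_expansion M \<epsilon> (coeff_b \<theta>\<^sub>0) (intercept \<theta>\<^sub>0) t (\<sigma> t)"
    and X_meas: "X t \<in> borel_measurable M" and \<sigma>_sq: "square_integrable M (\<sigma> t)" for t
    using larch by (auto simp: stationary_larch_def second_order_stationary_def square_integrable_def)
  obtain \<phi> where \<phi>: "\<phi> \<in> borel_measurable path_measure" "depends_on {..<0} \<phi>"
    "\<And>t. AE \<omega> in M. \<sigma> t \<omega> = \<phi> (E' t \<omega>)"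
    using volterra_expansion_factors[OF E[unfolded E_def[abs_def]] distr_E[unfolded E_def[abs_def]] \<sigma>_volt]
    unfolding E'_def E_def by metis
  have \<phi>_sq: "square_integrable path_measure \<phi>"
  proof -
    have [measurable]: "\<phi> \<in> borel_measurable path_measure" by (rule \<phi>)
    have m: "(\<lambda>\<omega>. \<phi> (E' 0 \<omega>)) \<in> borel_measurable M" by (rule measurable_compose[OF E' \<phi>(1)])
    have "integrable M (\<lambda>\<omega>. (\<phi> (E' 0 \<omega>))\<^sup>2)"
      using \<sigma>_sq[of 0] \<phi>(3)[of 0] m
      by (subst integrable_cong_AE[of _ _ "\<lambda>\<omega>. (\<sigma> 0 \<omega>)\<^sup>2"]) (auto simp: square_integrable_def)
    then show ?thesis
      using integrable_distr_eq[OF E'[of 0], of "\<lambda>x. (\<phi> x)\<^sup>2"] distr_E'[of 0] by (simp add: square_integrable_def)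
  qed
  \<comment> \<open>Any exponent strictly between $d_u$ and $1/2$ would do.\<close>
  define q where "q = (d\<^sub>u + 1 / 2) / 2"
  define \<delta> where "\<delta> = q - d\<^sub>u"
  have q\<delta>: "q < 1 / 2" "0 < \<delta>" "\<delta> < q" "q - \<delta> = d\<^sub>u" using du by (auto simp: q_def \<delta>_def field_simps)
  interpret driven_volatility \<mu> \<phi> q \<delta>
    using \<phi> \<phi>_sq q\<delta> by unfold_locales auto
  have X_lag: "AE \<omega> in M. X (t - int j) \<omega> = lag j (E' t \<omega>)" for t j
    using XE[of "t - int j"] \<phi>(3)[of "t - int j"]
  proof eventually_elim
    case (elim \<omega>)
    have "E' (t - int j) \<omega> = time_shift (- int j) (E' t \<omega>)" by (simp add: E'_def)
    then show ?case using elim by (simp add: lag_def) (simp add: E'_def E_def time_shift_def)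
  qed
  \<comment> \<open>For a single \<open>\<theta>\<close> the given volatility is a version of the filter on path space.\<close>
  have filter_value: "AE \<omega> in M. s \<omega> = a + c * filter_sum d (E' t \<omega>)"
    if d: "0 \<le> d" "d \<le> d\<^sub>u" and s: "linear_filter M (coeff_b (d, c, a)) (intercept (d, c, a)) X t s" for d c a t s
  proof -
    have "L2_tendsto M (\<lambda>n \<omega>. \<Sum>j<n. (c * real (Suc j) powr (d - 1)) * lag (Suc j) (E' t \<omega>)) (\<lambda>\<omega>. s \<omega> - a) sequentially"
    proof (rule L2_tendsto_cong_AE)
      show "L2_tendsto M (\<lambda>n \<omega>. \<Sum>j<n. (c * real (Suc j) powr (d - 1)) * X (t - int (Suc j)) \<omega>) (\<lambda>\<omega>. s \<omega> - a) sequentially"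
        using s by (simp add: linear_filter_def L2_sums_def coeff_b_def intercept_def)
      show "(\<lambda>\<omega>. s \<omega> - a) \<in> borel_measurable M"
        using s by (simp add: linear_filter_def L2_sums_def L2_tendsto_def square_integrable_def intercept_def)
      fix n
      have "AE \<omega> in M. \<forall>j. X (t - int (Suc j)) \<omega> = lag (Suc j) (E' t \<omega>)"
        unfolding AE_all_countable using X_lag by blast
      then show "AE \<omega> in M. (\<Sum>j<n. (c * real (Suc j) powr (d - 1)) * X (t - int (Suc j)) \<omega>)
          = (\<Sum>j<n. (c * real (Suc j) powr (d - 1)) * lag (Suc j) (E' t \<omega>))"
        by eventually_elim simp
      show "(\<lambda>\<omega>. \<Sum>j<n. (c * real (Suc j) powr (d - 1)) * lag (Suc j) (E' t \<omega>)) \<in> borel_measurable M"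
        using measurable_compose[OF E' lag_measurable] by measurable
    qed simp
    from linear_filter_eq_filter_sum[OF E' distr_E' _ _ this] d q\<delta>
    have "AE \<omega> in M. s \<omega> - a = c * filter_sum d (E' t \<omega>)" by simp
    then show ?thesis by eventually_elim simp
  qed
  have \<theta>\<^sub>0_in: "(d\<^sub>0, c\<^sub>0, a\<^sub>0) \<in> \<Theta>" using \<theta>\<^sub>0_int interior_subset \<theta>\<^sub>0 by blast
  have bounds: "0 \<le> d\<^sub>0" "d\<^sub>0 \<le> d\<^sub>u" "a\<^sub>d \<le> a\<^sub>0" using \<theta>\<^sub>0_in by (auto simp: \<Theta>_eq parameter_space_def)
  \<comment> \<open>An interior point cannot lie on the face $c = 0$.\<close>
  have c\<^sub>0_pos: "0 < c\<^sub>0"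
  proof -
    obtain r where r: "0 < r" "ball \<theta>\<^sub>0 r \<subseteq> \<Theta>" using \<theta>\<^sub>0_int by (auto simp: mem_interior)
    have "dist \<theta>\<^sub>0 (d\<^sub>0, c\<^sub>0 - r / 2, a\<^sub>0) < r" using r(1) by (simp add: \<theta>\<^sub>0 dist_Pair_Pair dist_real_def)
    then have "(d\<^sub>0, c\<^sub>0 - r / 2, a\<^sub>0) \<in> \<Theta>" using r(2) by auto
    then show ?thesis using r(1) by (simp add: \<Theta>_eq parameter_space_def)
  qed
  have \<phi>_eq: "AE x in path_measure. \<phi> x = a\<^sub>0 + c\<^sub>0 * filter_sum d\<^sub>0 x"
  proof -
    have "AE \<omega> in M. \<phi> (E' 0 \<omega>) = a\<^sub>0 + c\<^sub>0 * filter_sum d\<^sub>0 (E' 0 \<omega>)"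
      using filter_value[OF bounds(1,2) \<sigma>_filt[of 0, unfolded \<theta>\<^sub>0]] \<phi>(3)[of 0] by eventually_elim simp
    moreover have "{x \<in> space path_measure. \<phi> x = a\<^sub>0 + c\<^sub>0 * filter_sum d\<^sub>0 x} \<in> sets path_measure" by measurable
    ultimately have "AE x in distr M path_measure (E' 0). \<phi> x = a\<^sub>0 + c\<^sub>0 * filter_sum d\<^sub>0 x"
      by (simp only: AE_distr_iff[OF E'])
    then show ?thesis by (simp only: distr_E')
  qed
  interpret larch_model \<mu> \<phi> q \<delta> d\<^sub>0 c\<^sub>0 a\<^sub>0 e
    using bounds q\<delta> c\<^sub>0_pos \<phi>_eq e assms(7) by unfold_locales auto
  \<comment> \<open>A compact box is more convenient than \<open>\<Theta>\<close>, whose upper bound for \<open>c\<close> varies with \<open>d\<close>.\<close>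
  define K where "K = {0..d\<^sub>u} \<times> {0..C} \<times> {a\<^sub>d..a\<^sub>u}"
  have K: "compact K" "\<And>\<theta>. \<theta> \<in> K \<Longrightarrow> admissible \<theta>"
    unfolding K_def using assms(6) q\<delta> by (auto simp: admissible_def intro!: compact_Times)
  have \<Theta>K: "\<Theta> \<subseteq> K"
  proof
    fix \<theta> assume "\<theta> \<in> \<Theta>"
    moreover obtain d c a where "\<theta> = (d, c, a)" by (cases \<theta>)
    ultimately show "\<theta> \<in> K"
      using c_upper_le[of d C] du assms(5) by (auto simp: \<Theta>_eq K_def parameter_space_def)
  qed
  have reg: "AE \<omega> in M. \<forall>t. regular_path (E' t \<omega>)"
    unfolding AE_all_countable by (intro allI AE_E' AE_regular_path)
  \<comment> \<open>Countably many parameters share one null set; separability extends the identity to all of \<open>\<Theta>\<close>.\<close>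
  have rat: "AE \<omega> in M. \<forall>t. \<forall>\<theta>\<in>\<Theta> \<inter> (\<rat> \<times> \<rat> \<times> \<rat>). sig t \<theta> \<omega> = model_volatility \<theta> (E' t \<omega>)"
    unfolding AE_all_countable
  proof
    fix t
    have "AE \<omega> in M. sig t \<theta> \<omega> = model_volatility \<theta> (E' t \<omega>)" if "\<theta> \<in> \<Theta> \<inter> (\<rat> \<times> \<rat> \<times> \<rat>)" for \<theta>
    proof -
      obtain d c a where "\<theta> = (d, c, a)" by (cases \<theta>)
      then show ?thesis using that filter_value[of d c a t "sig t \<theta>"] filt[of \<theta> t]
        by (auto simp: \<Theta>_eq parameter_space_def model_volatility_def)
    qed
    moreover have "countable (\<Theta> \<inter> (\<rat> \<times> \<rat> \<times> \<rat>))"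
      by (rule countable_subset[of _ "\<rat> \<times> \<rat> \<times> \<rat>"]) (auto intro: countable_rat)
    ultimately show "AE \<omega> in M. \<forall>\<theta>\<in>\<Theta> \<inter> (\<rat> \<times> \<rat> \<times> \<rat>). sig t \<theta> \<omega> = model_volatility \<theta> (E' t \<omega>)"
      by (subst AE_ball_countable) auto
  qed
  have sepAE: "AE \<omega> in M. \<forall>t. \<forall>A B. openin (top_of_set \<Theta>) A \<longrightarrow> closed B \<longrightarrow> is_interval B \<longrightarrow>
        (\<forall>\<theta>\<in>A \<inter> (\<rat> \<times> \<rat> \<times> \<rat>). sig t \<theta> \<omega> \<in> B) \<longrightarrow> (\<forall>\<theta>\<in>A. sig t \<theta> \<omega> \<in> B)"
    unfolding AE_all_countable
  proof
    fix t
    obtain N where N: "N \<in> null_sets M" and sub: "\<forall>A B. openin (top_of_set \<Theta>) A \<and> closed B \<and> is_interval B \<longrightarrow>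
       ({\<omega> \<in> space M. \<forall>\<theta>\<in>A. sig t \<theta> \<omega> \<in> B} - {\<omega> \<in> space M. \<forall>\<theta>\<in>A \<inter> (\<rat> \<times> \<rat> \<times> \<rat>). sig t \<theta> \<omega> \<in> B}) \<union>
       ({\<omega> \<in> space M. \<forall>\<theta>\<in>A \<inter> (\<rat> \<times> \<rat> \<times> \<rat>). sig t \<theta> \<omega> \<in> B} - {\<omega> \<in> space M. \<forall>\<theta>\<in>A. sig t \<theta> \<omega> \<in> B}) \<subseteq> N"
      using sep[of t] unfolding separable_process_def Let_def by (rule bexE)
    show "AE \<omega> in M. \<forall>A B. openin (top_of_set \<Theta>) A \<longrightarrow> closed B \<longrightarrow> is_interval B \<longrightarrow>
        (\<forall>\<theta>\<in>A \<inter> (\<rat> \<times> \<rat> \<times> \<rat>). sig t \<theta> \<omega> \<in> B) \<longrightarrow> (\<forall>\<theta>\<in>A. sig t \<theta> \<omega> \<in> B)"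
      using AE_not_in[OF N] AE_space
    proof eventually_elim
      case (elim \<omega>)
      show ?case
      proof (intro allI impI)
        fix A B assume AB: "openin (top_of_set \<Theta>) A" "closed B" "is_interval B"
          and "\<forall>\<theta>\<in>A \<inter> (\<rat> \<times> \<rat> \<times> \<rat>). sig t \<theta> \<omega> \<in> B"
        with sub[rule_format, of A B, OF conjI[OF AB(1) conjI[OF AB(2,3)]]] elim show "\<forall>\<theta>\<in>A. sig t \<theta> \<omega> \<in> B" by blast
      qed
    qed
  qed
  have "AE \<omega> in M. \<forall>n. n \<ge> 1 \<longrightarrow> is_arg_min (\<lambda>\<theta>. L_contrast e X sig n \<theta> \<omega>) (\<lambda>\<theta>. \<theta> \<in> \<Theta>) (est n \<omega>)"
    unfolding AE_all_countable using argmin by auto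
  moreover have "AE \<omega> in M. \<forall>t. X t \<omega> = lag 0 (E' t \<omega>)"
    unfolding AE_all_countable using X_lag[of _ 0] by simp
  moreover have "AE \<omega> in M. \<forall>est. (\<forall>n\<ge>1. est n \<in> K \<and>
      empirical_contrast n (est n) (E \<omega>) \<le> empirical_contrast n (d\<^sub>0, c\<^sub>0, a\<^sub>0) (E \<omega>)) \<longrightarrow> est \<longlonglongrightarrow> (d\<^sub>0, c\<^sub>0, a\<^sub>0)"
    using AE_E'[OF contrast_minimizers_converge[OF K], of 0] \<theta>\<^sub>0_in \<Theta>K by (auto simp: E'_def)
  ultimately show ?thesis using reg rat sepAE
  proof eventually_elim
    case (elim \<omega>)
    have sig: "sig t \<theta> \<omega> = model_volatility \<theta> (E' t \<omega>)" if "\<theta> \<in> \<Theta>" for t \<theta>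
    proof (rule separable_version_identified[OF _ _ _ that, where y="\<lambda>\<theta>. sig t \<theta> \<omega>"])
      show "continuous_on \<Theta> (\<lambda>\<theta>. model_volatility \<theta> (E' t \<omega>))"
      proof (rule continuous_on_subset[OF lipschitz_on_continuous_on \<Theta>K])
        show "(1 + 2 * envelope (E' t \<omega>))-lipschitz_on K (\<lambda>\<theta>. model_volatility \<theta> (E' t \<omega>))"
          using model_volatility_lipschitz[of "E' t \<omega>"] K(2) envelope_nonneg[of "E' t \<omega>"] elim(4)
          by (intro lipschitz_onI) (auto simp: dist_real_def mult.commute)
      qed
    qed (use elim(5,6) in auto)
    have L: "L_contrast e X sig n \<theta> \<omega> = empirical_contrast n \<theta> (E \<omega>)" if "\<theta> \<in> \<Theta>" for n \<theta>
      using elim(2) sig[OF that]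
      by (simp add: L_contrast_def empirical_contrast_def path_contrast_def contrast_def E'_def)
    have "est n \<omega> \<in> K \<and> empirical_contrast n (est n \<omega>) (E \<omega>) \<le> empirical_contrast n (d\<^sub>0, c\<^sub>0, a\<^sub>0) (E \<omega>)"
      if "n \<ge> 1" for n
    proof -
      have "est n \<omega> \<in> \<Theta>" "\<not> L_contrast e X sig n (d\<^sub>0, c\<^sub>0, a\<^sub>0) \<omega> < L_contrast e X sig n (est n \<omega>) \<omega>"
        using elim(1)[rule_format, OF that] \<theta>\<^sub>0_in by (auto simp: is_arg_min_def)
      then show ?thesis using L \<theta>\<^sub>0_in \<Theta>K by auto
    qed
    then show ?case using elim(3)[rule_format, of "\<lambda>n. est n \<omega>"] \<theta>\<^sub>0 by simp
  qed
qed

end
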